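(* The sequence $(D_n)$ satisfies the quadratic strong law $$\lim_{n\to\infty}\frac{1}{\log n}\sum_{k=1}^n\Big(\frac{D_k}{k}-\frac12\Big)^2=\frac1{12}\quad\text{almost surely.}$$ Moreover, it satisfies the law of iterated logarithm $$\limsup_{n\to\infty}\Big(\frac{n}{2\log\log n}\Big)^{1/2}\Big(\frac{D_n}{n}-\frac12\Big)=-\liminf_{n\to\infty}\Big(\frac{n}{2\log\log n}\Big)^{1/2}\Big(\frac{D_n}{n}-\frac12\Big)=\frac1{\sqrt{12}}\quad\text{almost surely.}$$ In particular, $$\limsup_{n\to\infty}\Big(\frac{n}{2\log\log n}\Big)\Big(\frac{D_n}{n}-\frac12\Big)^2=\frac1{12}\quad\text{almost surely.}$$
   Context: The sequence $(D_n)_{n\ge1}$ is constructed on a single probability space as follows. Let $(V_n)$ be a sequence of independent random variables, $V_n$ being uniformly distributed on $\{1,\dots,n\}$. Set $\pi_1=(1)$ and, for $n\ge1$, define the permutation $\pi_{n+1}$ of $\{1,\dots,n+1\}$ by $\pi_{n+1}(k)=\pi_n(k)$ if $k<V_{n+1}$, $\pi_{n+1}(k)=n+1$ if $k=V_{n+1}$, and $\pi_{n+1}(k)=\pi_n(k-1)$ if $k>V_{n+1}$. Then $\pi_n$ is uniformly distributed on the symmetric group on $\{1,\dots,n\}$. $D_n$ is the number of descents of $\pi_n$: $D_n=\#\{k\in\{1,\dots,n-1\}:\pi_n(k)>\pi_n(k+1)\}$, with $D_1=0$. Equivalently in law, with $\mathcal{F}_n=\sigma(D_1,\dots,D_n)$,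 one has $D_1=0$, $\mathbb{P}(D_{n+1}=D_n+1\mid\mathcal{F}_n)=\frac{n-D_n}{n+1}$ and $\mathbb{P}(D_{n+1}=D_n\mid\mathcal{F}_n)=\frac{D_n+1}{n+1}$. *)

theory Defs
  imports "HOL-Probability.Probability"
begin

text \<open>
  For \<open>n \<ge> 1\<close>, \<open>insertion_perm v n\<close> is the permutation \<open>\<pi>\<^sub>n\<close> of \<open>{1..n}\<close> in which each new value
  \<open>m \<in> {2..n}\<close> was inserted at position \<open>v m\<close>; \<open>v 1\<close> is not used, since \<open>\<pi>\<^sub>1 = (1)\<close>.  As usual for
  \<^const>\<open>permutes\<close>, it is extended by the identity outside \<open>{1..n}\<close>.  The value at index \<open>0\<close> is a
  dummy.
\<close>

fun insertion_perm :: "(nat \<Rightarrow> nat) \<Rightarrow> nat \<Rightarrow> nat \<Rightarrow> nat" where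
  "insertion_perm v 0 = id"
| "insertion_perm v (Suc 0) = id"
| "insertion_perm v (Suc (Suc n)) =
     (\<lambda>k. if k \<notin> {1..Suc (Suc n)} then k
          else if k < v (Suc (Suc n)) then insertion_perm v (Suc n) k
          else if k = v (Suc (Suc n)) then Suc (Suc n)
          else insertion_perm v (Suc n) (k - 1))"

definition num_descents :: "nat \<Rightarrow> (nat \<Rightarrow> nat) \<Rightarrow> nat" where
  "num_descents n p = card {k \<in> {1..<n}. p k > p (k + 1)}"

definition descents :: "(nat \<Rightarrow> 'a \<Rightarrow> nat) \<Rightarrow> nat \<Rightarrow> 'a \<Rightarrow> nat" where
  "descents V n \<omega> = num_descents n (insertion_perm (\<lambda>m. V m \<omega>) n)"

end

theory Submission
  imports Defs "HOL-Real_Asymp.Real_Asymp"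
begin

text \<open>
  Inserting the new maximum at the front of a permutation of \<open>{1..n}\<close> or inside one of its
  ascents creates a descent, and at the end or inside a descent it does not. So \<open>n - D\<^sub>n\<close> of
  the \<open>n + 1\<close> positions raise the number of descents: given the past, it grows with
  probability \<open>p\<^sub>n = (n - D\<^sub>n) / (n + 1)\<close>. It follows that \<open>M\<^sub>n = n (D\<^sub>n - (n - 1) / 2)\<close> is
  a martingale whose increment is \<open>n + 1\<close> times a centred Bernoulli variable of parameter
  \<open>p\<^sub>n\<close>. The conditional variance of this increment is at most \<open>(n + 1)\<^sup>2 / 4\<close>, and nearly
  that much as long as \<open>D\<^sub>n / n\<close> is close to \<open>1 / 2\<close>. Since \<open>1\<^sup>2 / 4 + \<dots> + n\<^sup>2 / 4\<close> is
  asymptotic to \<open>n\<^sup>3 / 12\<close>, the martingale \<open>M\<^sub>n\<close>, which is close to \<open>n\<^sup>2 (D\<^sub>n / n - 1 / 2)\<close>,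
  fluctuates like a Brownian motion at time \<open>n\<^sup>3 / 12\<close>; this is the source of the constant
  \<open>1 / 12\<close>.

  Upper half of the law of the iterated logarithm (\<open>mart_eventually_le\<close>). Hoeffding's bound
  for a Bernoulli variable has the constant that belongs to the maximal variance \<open>1 / 4\<close>, so
  \<open>exp (l M\<^sub>n - l\<^sup>2 V\<^sub>n / 2)\<close> with the deterministic \<open>V\<^sub>n = 1\<^sup>2 / 4 + \<dots> + n\<^sup>2 / 4\<close> is a
  supermartingale. Its maximal inequality on geometric blocks of ratio close to \<open>1\<close> and the
  Borel-Cantelli lemma give the bound with the right constant.

  Lower half (\<open>mart_frequently_ge\<close>). On a block from \<open>Q ^ k\<close> to \<open>Q ^ Suc k\<close> with large \<open>Q\<close>
  the exponential bound can be reversed up to an arbitrarily small loss in the exponent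
  (\<open>mgf_ge\<close>), because under the tilts that matter a deviation of \<open>D\<^sub>j / j\<close> from \<open>1 / 2\<close> has
  exponentially small weight. Matching exponential moments on both sides yield a lower bound
  for the tail (\<open>mart_lower_tail\<close>): given any past for which the block starts near the mean,
  the required increment occurs with probability at least \<open>1 / (4 k)\<close>. These numbers have a
  divergent sum, and what precedes the block is negligible by the upper half.

  Quadratic strong law (\<open>quadratic_strong_law\<close>). With \<open>E\<^sub>n = M\<^sub>n / n\<close> and \<open>\<eta>\<^sub>n\<close> the centred
  step at time \<open>n\<close>, the square of \<open>E\<close> at time \<open>n + 1\<close> is
  \<open>(1 - 2 / (n + 1)) E\<^sub>n\<^sup>2 + 2 E\<^sub>n \<eta>\<^sub>n + 1 / 4\<close>. Dividing by \<open>n + 1\<close> and telescoping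
  expresses three times the sum of \<open>E\<^sub>k\<^sup>2 / k\<^sup>2\<close> as \<open>ln n / 4\<close>, plus a martingale, plus
  terms of order \<open>o (ln n)\<close> by the law of the iterated logarithm. The martingale has second
  moment \<open>O (ln n)\<close>, so it is negligible along \<open>2 ^ m\<^sup>2\<close>, and monotonicity fills the gaps.
\<close>

section \<open>Exponential moments of a centred Bernoulli variable\<close>

text \<open>
  Hoeffding's lemma for one Bernoulli variable. The constant \<open>1 / 8\<close> belongs to the variance
  \<open>1 / 4\<close> of the case \<open>p = 1 / 2\<close>. The step probabilities of the descent process tend to
  \<open>1 / 2\<close>, so nothing is lost in the limit. The estimate \<open>Hoeffdings_lemma_aux\<close> covers
  \<open>x \<ge> 0\<close>; exchanging success and failure gives the rest.
\<close>

lemma bernoulli_mgf_le: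
  fixes p x :: real
  assumes "0 \<le> p" "p \<le> 1"
  shows "(1 - p) * exp (- x * p) + p * exp (x * (1 - p)) \<le> exp (x\<^sup>2 / 8)"
proof -
  have *: "(1 - p) * exp (- x * p) + p * exp (x * (1 - p)) \<le> exp (x\<^sup>2 / 8)"
    if "0 \<le> p" "p \<le> 1" "x \<ge> 0" for p x :: real
  proof -
    have pos: "1 + p * (exp x - 1) > 0"
      using that by (intro add_pos_nonneg mult_nonneg_nonneg) auto
    have "(1 - p) * exp (- x * p) + p * exp (x * (1 - p)) = exp (- x * p) * (1 + p * (exp x - 1))"
      by (simp add: algebra_simps flip: exp_add)
    also have "\<dots> = exp (- x * p + ln (1 + p * (exp x - 1)))"
      unfolding exp_add using pos by simp
    also have "\<dots> \<le> exp (x\<^sup>2 / 8)"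
      using Hoeffdings_lemma_aux[of x p] that by simp
    finally show ?thesis .
  qed
  show ?thesis
  proof (cases "x \<ge> 0")
    case True
    then show ?thesis using * assms by blast
  next
    case False
    then show ?thesis
      using *[of "1 - p" "- x"] assms by (simp add: algebra_simps)
  qed
qed

lemma exp_ge_quadratic:
  fixes y \<kappa> :: real
  assumes "\<bar>y\<bar> \<le> \<kappa>"
  shows "exp y \<ge> 1 + y + (1 - \<kappa>) * y\<^sup>2 / 2"
proof -
  have 1: "exp y \<ge> 1 + y + y^2/2 + y^3/6"
  proof (cases "y = 0")
    case False
    obtain t where t: "exp y = (\<Sum>m<4. y ^ m / fact m) + exp t / fact 4 * y ^ 4"
      using Maclaurin_exp_le[of y 4] by auto
    have "exp t / fact 4 * y ^ 4 \<ge> 0" by simp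
    then show ?thesis using t by (simp add: eval_nat_numeral fact_numeral)
  qed auto
  have "- \<kappa> * y^2 \<le> y * y^2"
    using assms by (intro mult_right_mono) auto
  then have "y^3 \<ge> - \<kappa> * y^2"
    by (simp add: power3_eq_cube power2_eq_square)
  moreover have "\<kappa> * y^2 \<ge> 0" using assms by auto
  ultimately have "1 + y + y^2/2 + y^3/6 \<ge> 1 + y + (1 - \<kappa>) * y\<^sup>2 / 2"
    by (simp add: field_simps)
  with 1 show ?thesis by linarith
qed

text \<open>
  For \<open>p\<close> near \<open>1 / 2\<close> and small \<open>x\<close> Hoeffding's bound can be reversed: the second-order
  Taylor polynomial of the exponential then dominates, and the variance \<open>p (1 - p)\<close> is
  almost \<open>1 / 4\<close>.
\<close>

lemma bernoulli_mgf_ge: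
  fixes p x \<epsilon> :: real
  assumes \<epsilon>: "0 < \<epsilon>" "\<epsilon> \<le> 1" and p: "\<bar>p - 1/2\<bar> \<le> \<epsilon> / 4" and x: "\<bar>x\<bar> \<le> \<epsilon> / 4"
  shows "(1 - p) * exp (- x * p) + p * exp (x * (1 - p)) \<ge> exp ((1 - \<epsilon>) * x\<^sup>2 / 8)"
proof -
  define \<kappa> where "\<kappa> = \<epsilon> / 4"
  have \<kappa>: "0 < \<kappa>" "\<kappa> \<le> 1/4" using \<epsilon> by (auto simp: \<kappa>_def)
  have \<kappa>4: "\<epsilon> = 4 * \<kappa>" by (simp add: \<kappa>_def)
  have p01: "0 \<le> p" "p \<le> 1" using p \<kappa> \<kappa>_def by linarith+
  have b1: "\<bar>- x * p\<bar> \<le> \<kappa>"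
    using mult_mono[of "\<bar>x\<bar>" \<kappa> "\<bar>p\<bar>" 1] x p01 \<kappa> by (simp add: abs_mult \<kappa>_def)
  have b2: "\<bar>x * (1 - p)\<bar> \<le> \<kappa>"
    using mult_mono[of "\<bar>x\<bar>" \<kappa> "\<bar>1-p\<bar>" 1] x p01 \<kappa> by (simp add: abs_mult \<kappa>_def)
  define z where "z = (1 - \<kappa>) * (1 - 4 * \<kappa>\<^sup>2) * x\<^sup>2 / 8"
  have k2: "4 * \<kappa>\<^sup>2 \<le> \<kappa>" using \<kappa> by (simp add: power2_eq_square)
  have x2: "x\<^sup>2 \<le> \<kappa>\<^sup>2" using x \<kappa> abs_le_square_iff[of x \<kappa>] by (simp add: \<kappa>_def)
  have z0: "0 \<le> z" unfolding z_def using \<kappa> k2 by (intro divide_nonneg_nonneg mult_nonneg_nonneg) auto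
  have zk: "z \<le> \<kappa>"
  proof -
    have "(1 - \<kappa>) * (1 - 4 * \<kappa>\<^sup>2) \<le> 1 * 1"
      using \<kappa> k2 by (intro mult_mono) auto
    then have "(1 - \<kappa>) * (1 - 4 * \<kappa>\<^sup>2) * x\<^sup>2 \<le> 1 * \<kappa>\<^sup>2" using x2 by (intro mult_mono) auto
    then show ?thesis unfolding z_def using k2 \<kappa> by linarith
  qed
  have "(1 - \<epsilon>) * x\<^sup>2 / 8 \<le> z * (1 - \<kappa>)"
  proof -
    have "(1 - \<kappa>) * (1 - 4 * \<kappa>\<^sup>2) * (1 - \<kappa>) \<ge> 1 - \<epsilon>"
    proof -
      have "1 - 4 * \<kappa> \<le> (1 - 2 * \<kappa>) * (1 - \<kappa>)" using \<kappa> by (simp add: algebra_simps)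
      also have "\<dots> \<le> ((1 - \<kappa>) * (1 - \<kappa>)) * (1 - 4 * \<kappa>\<^sup>2)"
      proof (rule mult_mono)
        show "1 - 2 * \<kappa> \<le> (1 - \<kappa>) * (1 - \<kappa>)" by (simp add: algebra_simps)
      qed (use \<kappa> k2 in auto)
      finally show ?thesis using \<kappa>4 by (simp only: mult_ac)
    qed
    then have "(1 - \<epsilon>) * (x\<^sup>2 / 8) \<le> (1 - \<kappa>) * (1 - 4 * \<kappa>\<^sup>2) * (1 - \<kappa>) * (x\<^sup>2 / 8)"
      by (intro mult_right_mono) auto
    then show ?thesis unfolding z_def by (simp add: mult_ac)
  qed
  also have "z * (1 - \<kappa>) \<le> z - z\<^sup>2"
    using mult_left_mono[OF zk z0] by (simp add: power2_eq_square algebra_simps)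
  also have "\<dots> \<le> ln (1 + z)"
    using ln_one_plus_pos_lower_bound[of z] z0 zk \<kappa> by auto
  finally have "exp ((1 - \<epsilon>) * x\<^sup>2 / 8) \<le> 1 + z"
    using z0 ln_ge_iff[of "1 + z" "(1 - \<epsilon>) * x\<^sup>2 / 8"] by simp
  also have "1 + z \<le> 1 + (1 - \<kappa>) * x\<^sup>2 / 2 * (p * (1 - p))"
  proof -
    have "(p - 1/2)\<^sup>2 \<le> \<kappa>\<^sup>2" using p \<kappa> abs_le_square_iff[of "p - 1/2" \<kappa>] by (simp add: \<kappa>_def)
    then have "p * (1 - p) \<ge> (1 - 4 * \<kappa>\<^sup>2) / 4" by (simp add: power2_eq_square field_simps)
    then have "(1 - \<kappa>) * x\<^sup>2 / 2 * (p * (1 - p)) \<ge> (1 - \<kappa>) * x\<^sup>2 / 2 * ((1 - 4 * \<kappa>\<^sup>2) / 4)"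
      using \<kappa> by (intro mult_left_mono) auto
    then show ?thesis unfolding z_def by (simp add: field_simps)
  qed
  also have "\<dots> = (1 - p) * (1 + (- x * p) + (1 - \<kappa>) * (- x * p)\<^sup>2 / 2)
      + p * (1 + x * (1 - p) + (1 - \<kappa>) * (x * (1 - p))\<^sup>2 / 2)"
    by (simp add: power2_eq_square field_simps)
  also have "\<dots> \<le> (1 - p) * exp (- x * p) + p * exp (x * (1 - p))"
    using exp_ge_quadratic[OF b1] exp_ge_quadratic[OF b2] p01
    by (intro add_mono mult_left_mono) auto
  finally show ?thesis .
qed

section \<open>Iterated logarithms and logarithmic means\<close>

lemma limsup_ereal_eqI:
  fixes x :: "nat \<Rightarrow> real"
  assumes "\<And>r. r > c \<Longrightarrow> eventually (\<lambda>n. x n \<le> r) sequentially"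
    and "\<And>r. r < c \<Longrightarrow> frequently (\<lambda>n. x n \<ge> r) sequentially"
  shows "limsup (\<lambda>n. ereal (x n)) = ereal c"
proof (rule antisym)
  show "limsup (\<lambda>n. ereal (x n)) \<le> ereal c"
    unfolding Limsup_le_iff
  proof (intro allI impI)
    fix y assume "y > ereal c"
    then obtain r where r: "ereal c < ereal r" "ereal r < y" using ereal_dense2 by blast
    then have "eventually (\<lambda>n. x n \<le> r) sequentially" using assms(1) by simp
    then show "eventually (\<lambda>n. ereal (x n) < y) sequentially"
      by eventually_elim (use r(2) in \<open>meson ereal_less_eq(3) order_le_less_trans\<close>)
  qed
  show "limsup (\<lambda>n. ereal (x n)) \<ge> ereal c"
  proof (rule ccontr)
    assume "\<not> ?thesis"
    then have "limsup (\<lambda>n. ereal (x n)) < ereal c" by simp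
    then obtain r where r: "limsup (\<lambda>n. ereal (x n)) < ereal r" "ereal r < ereal c"
      using ereal_dense2 by blast
    have "eventually (\<lambda>n. ereal (x n) < ereal r) sequentially"
      using r(1) by (rule Limsup_lessD)
    then have "\<not> frequently (\<lambda>n. x n \<ge> r) sequentially"
      unfolding not_frequently by (rule eventually_mono) simp
    moreover have "frequently (\<lambda>n. x n \<ge> r) sequentially"
      using r(2) by (intro assms(2)) simp
    ultimately show False by contradiction
  qed
qed

definition lil_scale :: "nat \<Rightarrow> real" where
  "lil_scale n = sqrt (2 * real n ^ 3 * ln (ln (real n)))"

lemma loglog_at_top: "filterlim (\<lambda>n. ln (ln (real n))) at_top sequentially"
  by real_asymp

lemma lil_scale_small: "(\<lambda>n. lil_scale n / (real n)\<^sup>2) \<longlonglongrightarrow> 0"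
  unfolding lil_scale_def by real_asymp

lemma lil_normalisation:
  assumes "0 < ln (ln (real n))" "1 \<le> n"
  shows "sqrt (real n / (2 * ln (ln (real n)))) / (real n)\<^sup>2 = 1 / lil_scale n"
proof -
  define L where "L = ln (ln (real n))"
  have L: "0 < L" "0 < real n" using assms by (auto simp: L_def)
  have "sqrt (real n / (2 * L)) * lil_scale n = sqrt (((real n)\<^sup>2)\<^sup>2)"
    unfolding lil_scale_def L_def[symmetric] real_sqrt_mult[symmetric]
    using L by (intro arg_cong[of _ _ sqrt]) (simp add: power2_eq_square power3_eq_cube)
  also have "\<dots> = (real n)\<^sup>2" by (simp only: real_sqrt_abs abs_power2)
  finally have "sqrt (real n / (2 * L)) * lil_scale n = (real n)\<^sup>2" .
  moreover have "0 < lil_scale n" using L unfolding lil_scale_def L_def[symmetric] by simp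
  ultimately show ?thesis using L by (simp add: L_def[symmetric] field_simps)
qed

text \<open>
  The constant that the lower half of the law of the iterated logarithm reaches with block
  ratio \<open>m\<close> and relative precision \<open>1 / m\<close>: the first term is the increment over the last
  block, the second one bounds what the value at the start of the block can take away from
  it.
\<close>

lemma block_constant_tendsto:
  "(\<lambda>m. (1 - 1 / real m) * sqrt ((1 - 1 / real m ^ 3) / (12 * (1 + 3 * (1 / real m)))) - sqrt (1 / real m ^ 3))
    \<longlonglongrightarrow> 1 / sqrt 12"
proof -
  have "(\<lambda>m. (1 - 1 / real m) * sqrt ((1 - 1 / real m ^ 3) / (12 * (1 + 3 * (1 / real m)))) - sqrt (1 / real m ^ 3))
    \<longlonglongrightarrow> (1 / 12) powr (1 / 2)"
    by real_asymp
  then show ?thesis by (simp add: powr_half_sqrt real_sqrt_divide)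
qed

lemma harm_over_ln: "(\<lambda>n. harm n / ln (real n)) \<longlonglongrightarrow> 1"
proof -
  have ln_top: "filterlim (\<lambda>n. ln (real n)) at_top sequentially" by real_asymp
  have "(\<lambda>n. (harm n - ln (real n)) / ln (real n) + 1) \<longlonglongrightarrow> 0 + 1"
    by (intro tendsto_add tendsto_const tendsto_divide_0[OF euler_mascheroni_LIMSEQ]
        filterlim_at_top_imp_at_infinity ln_top)
  then have lim: "(\<lambda>n. (harm n - ln (real n)) / ln (real n) + 1) \<longlonglongrightarrow> 1" by simp
  show ?thesis
  proof (rule Lim_transform_eventually[OF lim])
    show "eventually (\<lambda>n. (harm n - ln (real n)) / ln (real n) + 1 = harm n / ln (real n)) sequentially"
      using eventually_gt_at_top[of 1] by eventually_elim (simp add: field_simps)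
  qed
qed

lemma logarithmic_mean_null:
  fixes c :: "nat \<Rightarrow> real"
  assumes "c \<longlonglongrightarrow> 0"
  shows "(\<lambda>n. (\<Sum>k\<in>{1..<n}. c k / real k) / ln (real n)) \<longlonglongrightarrow> 0"
proof (rule tendstoI)
  fix e :: real assume e: "0 < e"
  obtain K where K: "\<And>k. k \<ge> K \<Longrightarrow> \<bar>c k\<bar> < e / 4"
    using tendstoD[OF assms, of "e / 4"] e unfolding eventually_sequentially by (auto simp: dist_real_def)
  define B where "B = (\<Sum>k<K. \<bar>c k\<bar> / real k)"
  have ln_top: "filterlim (\<lambda>n. ln (real n)) at_top sequentially" by real_asymp
  have "eventually (\<lambda>n. harm n / ln (real n) < 2) sequentially"
    by (rule order_tendstoD(2)[OF harm_over_ln]) simp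
  moreover have "eventually (\<lambda>n. 4 * B / e + 1 \<le> ln (real n)) sequentially"
    using ln_top by (simp add: filterlim_at_top)
  ultimately show "eventually (\<lambda>n. dist ((\<Sum>k\<in>{1..<n}. c k / real k) / ln (real n)) 0 < e) sequentially"
    using eventually_gt_at_top[of 1]
  proof eventually_elim
    case (elim n)
    have l: "0 < ln (real n)" using elim(3) by simp
    have "\<bar>\<Sum>k\<in>{1..<n}. c k / real k\<bar> \<le> (\<Sum>k\<in>{1..<n}. \<bar>c k\<bar> / real k)"
      by (rule order_trans[OF sum_abs]) (simp add: abs_divide)
    also have "\<dots> \<le> (\<Sum>k\<in>{1..<n}. (if k < K then \<bar>c k\<bar> / real k else 0) + e / 4 * inverse (real k))"
    proof (rule sum_mono)
      fix k assume "k \<in> {1..<n}"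
      then show "\<bar>c k\<bar> / real k \<le> (if k < K then \<bar>c k\<bar> / real k else 0) + e / 4 * inverse (real k)"
        using K[of k] e by (auto simp: field_simps)
    qed
    also have "\<dots> = (\<Sum>k\<in>{1..<n}. if k < K then \<bar>c k\<bar> / real k else 0) + e / 4 * (\<Sum>k\<in>{1..<n}. inverse (real k))"
      by (simp add: sum.distrib sum_distrib_left)
    also have "(\<Sum>k\<in>{1..<n}. if k < K then \<bar>c k\<bar> / real k else 0) = (\<Sum>k\<in>{k\<in>{1..<n}. k < K}. \<bar>c k\<bar> / real k)"
      by (rule sum.inter_filter[symmetric]) simp
    also have "\<dots> \<le> B" unfolding B_def by (rule sum_mono2) auto
    also have "(\<Sum>k\<in>{1..<n}. inverse (real k)) \<le> harm n"
      unfolding harm_def by (rule sum_mono2) auto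
    also have "harm n \<le> 2 * ln (real n)" using elim(1) l by (simp add: field_simps)
    finally have "\<bar>\<Sum>k\<in>{1..<n}. c k / real k\<bar> \<le> B + e / 4 * (2 * ln (real n))" using e by simp
    moreover have "B < e / 4 * ln (real n)" using elim(2) e by (simp add: field_simps)
    moreover have "0 < e * ln (real n)" using e l by simp
    ultimately have "\<bar>\<Sum>k\<in>{1..<n}. c k / real k\<bar> < e * ln (real n)" by (simp add: algebra_simps)
    then show ?case using l by (simp add: dist_real_def abs_divide divide_simps)
  qed
qed

text \<open>
  The sequence \<open>2 ^ m\<^sup>2\<close> is dense enough on the logarithmic scale, since \<open>(m + 1)\<^sup>2 / m\<^sup>2\<close>
  tends to \<open>1\<close>, to squeeze a monotone function between its values. At the same time it is
  sparse enough to make probabilities of order \<open>1 / ln n\<close> summable along it.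
\<close>

lemma logarithmic_mean_from_subsequence:
  fixes f :: "nat \<Rightarrow> real"
  assumes mono: "mono f" and nonneg: "\<And>n. 0 \<le> f n"
    and lim: "(\<lambda>m. f (2 ^ m\<^sup>2) / ln (real (2 ^ m\<^sup>2))) \<longlonglongrightarrow> c"
  shows "(\<lambda>n. f n / ln (real n)) \<longlonglongrightarrow> c"
proof -
  define g where "g m = (2::nat) ^ m\<^sup>2" for m :: nat
  have ln_g: "ln (real (g m)) = (real m)\<^sup>2 * ln 2" for m by (simp add: g_def ln_realpow)
  have g_less: "g m < g m'" if "m < m'" for m m'
    unfolding g_def using that by (intro power_strict_increasing power_strict_mono) auto
  have g_ge: "m \<le> g m" for m
    by (rule strict_mono_imp_increasing) (use g_less in \<open>simp add: strict_mono_def\<close>)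
  have locate: "\<exists>m\<ge>m0. g m \<le> n \<and> n < g (Suc m)" if "g m0 \<le> n" for m0 n
  proof -
    define j where "j = (LEAST j. n < g j)"
    have "n < g (Suc n)" using g_ge[of "Suc n"] by simp
    then have j: "n < g j" unfolding j_def by (rule LeastI)
    have "m0 < j" using that j g_less[of j m0] by (cases "m0 = j") (auto simp: not_less_iff_gr_or_eq intro: ccontr)
    then obtain m where m: "j = Suc m" "m0 \<le> m" by (cases j) auto
    have "\<not> n < g m" using not_less_Least[of m "\<lambda>j. n < g j"] m(1) unfolding j_def by simp
    then show ?thesis using m j by auto
  qed
  have limg: "(\<lambda>m. f (g m) / ln (real (g m))) \<longlonglongrightarrow> c" using lim by (simp add: g_def)
  have ratio: "(\<lambda>m. ln (real (g m)) / ln (real (g (Suc m)))) \<longlonglongrightarrow> 1"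
    "(\<lambda>m. ln (real (g (Suc m))) / ln (real (g m))) \<longlonglongrightarrow> 1"
    unfolding ln_g by real_asymp+
  have lower: "(\<lambda>m. f (g m) / ln (real (g (Suc m)))) \<longlonglongrightarrow> c"
  proof (rule Lim_transform_eventually)
    show "(\<lambda>m. f (g m) / ln (real (g m)) * (ln (real (g m)) / ln (real (g (Suc m))))) \<longlonglongrightarrow> c"
      using tendsto_mult[OF limg ratio(1)] by simp
    show "eventually (\<lambda>m. f (g m) / ln (real (g m)) * (ln (real (g m)) / ln (real (g (Suc m)))) = f (g m) / ln (real (g (Suc m)))) sequentially"
      using eventually_gt_at_top[of 0] by eventually_elim (simp add: ln_g)
  qed
  have upper: "(\<lambda>m. f (g (Suc m)) / ln (real (g m))) \<longlonglongrightarrow> c"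
  proof (rule Lim_transform_eventually)
    show "(\<lambda>m. f (g (Suc m)) / ln (real (g (Suc m))) * (ln (real (g (Suc m))) / ln (real (g m)))) \<longlonglongrightarrow> c"
      using tendsto_mult[OF LIMSEQ_Suc[OF limg] ratio(2)] by simp
    show "eventually (\<lambda>m. f (g (Suc m)) / ln (real (g (Suc m))) * (ln (real (g (Suc m))) / ln (real (g m))) = f (g (Suc m)) / ln (real (g m))) sequentially"
      by (intro always_eventually) (simp add: ln_g)
  qed
  show ?thesis
  proof (rule tendstoI)
    fix e :: real assume e: "0 < e"
    have "eventually (\<lambda>m. c - e < f (g m) / ln (real (g (Suc m))) \<and> f (g (Suc m)) / ln (real (g m)) < c + e \<and> 1 \<le> m) sequentially"
      using e by (intro eventually_conj order_tendstoD[OF lower] order_tendstoD[OF upper] eventually_ge_at_top) auto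
    then obtain m0 where m0: "\<And>m. m \<ge> m0 \<Longrightarrow> c - e < f (g m) / ln (real (g (Suc m))) \<and> f (g (Suc m)) / ln (real (g m)) < c + e \<and> 1 \<le> m"
      unfolding eventually_sequentially by blast
    show "eventually (\<lambda>n. dist (f n / ln (real n)) c < e) sequentially"
      using eventually_ge_at_top[of "g m0"]
    proof eventually_elim
      case (elim n)
      then obtain m where m: "m0 \<le> m" "g m \<le> n" "n < g (Suc m)" using locate by blast
      have m1: "1 \<le> m" using m0[OF m(1)] by simp
      have lng: "0 < ln (real (g m))" unfolding ln_g using m1 by simp
      have gm: "0 < g m" by (simp add: g_def)
      have lnn: "ln (real (g m)) \<le> ln (real n)" "ln (real n) \<le> ln (real (g (Suc m)))"
        using m gm by (auto intro!: ln_mono)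
      have "f (g m) / ln (real (g (Suc m))) \<le> f n / ln (real n)"
        using monoD[OF mono m(2)] lnn lng nonneg by (intro frac_le) auto
      moreover have "f n / ln (real n) \<le> f (g (Suc m)) / ln (real (g m))"
        using monoD[OF mono, of n "g (Suc m)"] m(3) lnn lng nonneg by (intro frac_le) auto
      ultimately show ?case using m0[OF m(1)] unfolding dist_real_def by linarith
    qed
  qed
qed

lemma pow2_square_at_top: "filterlim (\<lambda>m. (2::nat) ^ m\<^sup>2) at_top sequentially"
  by (intro filterlim_subseq strict_monoI power_strict_increasing power_strict_mono) auto

section \<open>Random variables determined by the past of a bounded process\<close>

text \<open>
  This replaces measurability with respect to the natural filtration of \<open>D\<close>. The pointwise
  form makes closure under arbitrary functions immediate, so events about the past need no
  measurability proofs.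
\<close>

definition determined :: "(nat \<Rightarrow> 'a \<Rightarrow> nat) \<Rightarrow> nat \<Rightarrow> ('a \<Rightarrow> 'b) \<Rightarrow> bool" where
  "determined D n X \<longleftrightarrow> (\<forall>\<omega> \<omega>'. (\<forall>k\<le>n. D k \<omega> = D k \<omega>') \<longrightarrow> X \<omega> = X \<omega>')"

lemma determined_mono: "determined D m X \<Longrightarrow> m \<le> n \<Longrightarrow> determined D n X"
  unfolding determined_def by (meson le_trans)

lemma determined_const: "determined D n (\<lambda>_. c)"
  by (simp add: determined_def)

lemma determined_comp: "determined D n X \<Longrightarrow> determined D n (\<lambda>\<omega>. f (X \<omega>))"
  unfolding determined_def by metis

lemma determined_comp2:
  "determined D n X \<Longrightarrow> determined D n Y \<Longrightarrow> determined D n (\<lambda>\<omega>. f (X \<omega>) (Y \<omega>))"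
  unfolding determined_def by metis

lemma determined_if:
  "determined D n c \<Longrightarrow> determined D n X \<Longrightarrow> determined D n Y \<Longrightarrow>
    determined D n (\<lambda>\<omega>. if c \<omega> then X \<omega> else Y \<omega>)"
  unfolding determined_def by metis

lemma determined_bex:
  "(\<And>j. j \<in> A \<Longrightarrow> determined D n (P j)) \<Longrightarrow> determined D n (\<lambda>\<omega>. \<exists>j\<in>A. P j \<omega>)"
  unfolding determined_def by blast

lemma determined_ball:
  "(\<And>j. j \<in> A \<Longrightarrow> determined D n (P j)) \<Longrightarrow> determined D n (\<lambda>\<omega>. \<forall>j\<in>A. P j \<omega>)"
  unfolding determined_def by blast

lemma determined_sum:
  fixes f :: "nat \<Rightarrow> 'a \<Rightarrow> real"
  shows "(\<And>j. j \<in> A \<Longrightarrow> determined D n (f j)) \<Longrightarrow> determined D n (\<lambda>\<omega>. \<Sum>j\<in>A. f j \<omega>)"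
  unfolding determined_def by (auto intro!: sum.cong)

lemma determined_factor:
  assumes "determined D n X"
  shows "\<exists>f. \<forall>\<omega>. X \<omega> = f (map (\<lambda>k. D k \<omega>) [0..<Suc n])"
proof (intro exI allI)
  fix \<omega>
  let ?h = "\<lambda>\<omega>. map (\<lambda>k. D k \<omega>) [0..<Suc n]"
  define \<omega>' where "\<omega>' = (SOME \<omega>'. ?h \<omega>' = ?h \<omega>)"
  have "?h \<omega>' = ?h \<omega>" unfolding \<omega>'_def by (rule someI) (rule refl)
  then have "D k \<omega>' = D k \<omega>" if "k \<le> n" for k
    using that unfolding map_eq_conv by auto
  then have "X \<omega>' = X \<omega>" using assms unfolding determined_def by blast
  then show "X \<omega> = (\<lambda>l. X (SOME \<omega>'. ?h \<omega>' = l)) (?h \<omega>)" by (simp add: \<omega>'_def)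
qed

lemma measurable_map_count_space:
  assumes "\<And>k. k \<in> set xs \<Longrightarrow> (D k :: 'a \<Rightarrow> nat) \<in> measurable M (count_space UNIV)"
  shows "(\<lambda>\<omega>. map (\<lambda>k. D k \<omega>) xs) \<in> measurable M (count_space UNIV)"
  using assms
proof (induction xs)
  case (Cons k xs)
  have "(\<lambda>\<omega>. d # map (\<lambda>k. D k \<omega>) xs) \<in> measurable M (count_space UNIV)" for d
    by (rule measurable_compose[OF Cons.IH]) (use Cons.prems in auto)
  then have "(\<lambda>\<omega>. D k \<omega> # map (\<lambda>k. D k \<omega>) xs) \<in> measurable M (count_space UNIV)"
    by (rule measurable_compose_countable) (use Cons.prems in auto)
  then show ?case by simp
qed auto

text \<open>
  A process with \<open>D\<^sub>n \<le> n\<close> has only finitely many histories up to time \<open>n\<close>. Hence every real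
  variable determined by such a history is bounded and integrable.
\<close>

locale bounded_process = prob_space M for M :: "'a measure" +
  fixes D :: "nat \<Rightarrow> 'a \<Rightarrow> nat"
  assumes D_measurable: "\<And>n. D n \<in> measurable M (count_space UNIV)"
    and D_le: "\<And>n \<omega>. D n \<omega> \<le> n"

begin

lemma determined_measurable:
  assumes "determined D n X"
  shows "X \<in> measurable M (count_space UNIV)"
proof -
  obtain f where f: "\<And>\<omega>. X \<omega> = f (map (\<lambda>k. D k \<omega>) [0..<Suc n])"
    using determined_factor[OF assms] by blast
  have "(\<lambda>\<omega>. f (map (\<lambda>k. D k \<omega>) [0..<Suc n])) \<in> measurable M (count_space UNIV)"
    by (rule measurable_compose[OF measurable_map_count_space[OF D_measurable]]) simp
  then show ?thesis using f by (simp cong: measurable_cong)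
qed

lemma determined_finite_range:
  assumes "determined D n X"
  shows "finite (range X)"
proof -
  obtain f where f: "\<And>\<omega>. X \<omega> = f (map (\<lambda>k. D k \<omega>) [0..<Suc n])"
    using determined_factor[OF assms] by blast
  have "range X \<subseteq> f ` {l. set l \<subseteq> {..n} \<and> length l = Suc n}"
  proof
    fix x assume "x \<in> range X"
    then obtain \<omega> where "x = f (map (\<lambda>k. D k \<omega>) [0..<Suc n])" using f by blast
    moreover have "set (map (\<lambda>k. D k \<omega>) [0..<Suc n]) \<subseteq> {..n}"
      by (auto simp del: upt_Suc intro: le_trans[OF D_le])
    ultimately show "x \<in> f ` {l. set l \<subseteq> {..n} \<and> length l = Suc n}"
      by (intro image_eqI[of _ _ "map (\<lambda>k. D k \<omega>) [0..<Suc n]"]) simp_all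
  qed
  then show ?thesis
    by (rule finite_subset) (intro finite_imageI finite_lists_length_eq, simp)
qed

lemma determined_integrable:
  fixes X :: "'a \<Rightarrow> real"
  assumes "determined D n X"
  shows "integrable M X"
proof (rule integrable_const_bound)
  have "finite (range (\<lambda>\<omega>. \<bar>X \<omega>\<bar>))"
    using finite_imageI[OF determined_finite_range[OF assms], of abs] by (simp add: image_image)
  then show "AE \<omega> in M. norm (X \<omega>) \<le> Max (range (\<lambda>\<omega>. \<bar>X \<omega>\<bar>))"
    by (intro AE_I2) (simp add: Max_ge)
  show "X \<in> borel_measurable M"
    by (rule measurable_compose[OF determined_measurable[OF assms], of id, simplified id_def]) simp
qed

lemma determined_sets:
  assumes "determined D n P"
  shows "{\<omega> \<in> space M. P \<omega>} \<in> sets M"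
  using determined_measurable[OF assms] by measurable

lemma determined_D: "k \<le> n \<Longrightarrow> determined D n (D k)"
  by (simp add: determined_def)

lemma expectation_if_determined:
  assumes "determined D n P"
  shows "expectation (\<lambda>\<omega>. if P \<omega> then c else 0) = c * prob {\<omega> \<in> space M. P \<omega>}"
proof -
  have "expectation (\<lambda>\<omega>. if P \<omega> then c else 0) =
    expectation (\<lambda>\<omega>. c * indicator {\<omega> \<in> space M. P \<omega>} \<omega>)"
    by (intro Bochner_Integration.integral_cong) auto
  then show ?thesis using determined_sets[OF assms] by simp
qed

end

section \<open>The martingale of the centred descent numbers\<close>

text \<open>
  The transition law of the descent process. As the steps are \<open>0\<close> or \<open>1\<close>, the assumption on
  the drift says that the conditional probability of a step given the past is
  \<open>(n - D\<^sub>n) / (n + 1)\<close>.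
\<close>

locale descent_chain = bounded_process +
  assumes D_1: "\<And>\<omega>. D (Suc 0) \<omega> = 0"
    and D_step: "\<And>n. n \<ge> 1 \<Longrightarrow> AE \<omega> in M. D (Suc n) \<omega> = D n \<omega> \<or> D (Suc n) \<omega> = Suc (D n \<omega>)"
    and D_drift: "\<And>n X. n \<ge> 1 \<Longrightarrow> determined D n X \<Longrightarrow>
      expectation (\<lambda>\<omega>. X \<omega> * (real (D (Suc n) \<omega>) - real (D n \<omega>))) =
      expectation (\<lambda>\<omega>. X \<omega> * ((real n - real (D n \<omega>)) / real (Suc n)))"

begin

definition step_prob :: "nat \<Rightarrow> 'a \<Rightarrow> real" where
  "step_prob n \<omega> = (real n - real (D n \<omega>)) / real (Suc n)"

text \<open>
  The centred descent number \<open>D\<^sub>n - (n - 1) / 2\<close> is contracted by the factor \<open>n / (n + 1)\<close>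
  in conditional mean at each step. Multiplication by \<open>n\<close> compensates this.
\<close>

definition mart :: "nat \<Rightarrow> 'a \<Rightarrow> real" where
  "mart n \<omega> = real n * (real (D n \<omega>) - (real n - 1) / 2)"

lemma determined_mart:
  assumes "k \<le> n"
  shows "determined D n (mart k)"
  using assms by (simp add: determined_def mart_def)

lemma determined_mart_increment:
  "\<lbrakk>m \<le> n; k \<le> n\<rbrakk> \<Longrightarrow> determined D n (\<lambda>\<omega>. mart m \<omega> - mart k \<omega>)"
  by (rule determined_comp2[OF determined_mart determined_mart])

lemma determined_step_prob:
  assumes "k \<le> n"
  shows "determined D n (step_prob k)"
  using assms by (simp add: determined_def step_prob_def)

lemma step_prob_bounds: "0 \<le> step_prob n \<omega>" "step_prob n \<omega> \<le> 1"
  using D_le[of n \<omega>] by (auto simp: step_prob_def)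

lemma step_prob_mart:
  assumes "1 \<le> n"
  shows "step_prob n \<omega> - 1 / 2 = - mart n \<omega> / (real n * (real n + 1))"
proof -
  have "- mart n \<omega> / (real n * (real n + 1)) = - (real (D n \<omega>) - (real n - 1) / 2) / (real n + 1)"
    unfolding mart_def minus_mult_right using assms by (subst mult_divide_mult_cancel_left) auto
  then show ?thesis by (simp add: step_prob_def field_simps)
qed

lemma mart_1: "mart (Suc 0) \<omega> = 0"
  by (simp add: mart_def D_1)

lemma mart_increment:
  "mart (Suc n) \<omega> - mart n \<omega> = real (Suc n) * (real (D (Suc n) \<omega>) - real (D n \<omega>) - step_prob n \<omega>)"
proof -
  have "real (Suc n) * step_prob n \<omega> = real n - real (D n \<omega>)" by (simp add: step_prob_def)
  then show ?thesis by (simp add: mart_def algebra_simps diff_divide_distrib add_divide_distrib)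
qed

text \<open>
  The conditional distribution of the next step in integrated form; \<open>u\<close> and \<open>v\<close> are the
  outcomes without and with a new descent.
\<close>

lemma expectation_step:
  assumes "n \<ge> 1" and u: "determined D n u" and v: "determined D n v"
  shows "expectation (\<lambda>\<omega>. if D (Suc n) \<omega> = D n \<omega> then u \<omega> else v \<omega>) =
    expectation (\<lambda>\<omega>. (1 - step_prob n \<omega>) * u \<omega> + step_prob n \<omega> * v \<omega> :: real)"
proof -
  note sp = determined_step_prob[OF order_refl, of n]
  have d: "determined D n (\<lambda>\<omega>. v \<omega> - u \<omega>)" by (rule determined_comp2[OF v u])
  have d1: "determined D n (\<lambda>\<omega>. (v \<omega> - u \<omega>) * step_prob n \<omega>)"
    by (rule determined_comp2[OF d sp])
  have d2: "determined D (Suc n) (\<lambda>\<omega>. (v \<omega> - u \<omega>) * (real (D (Suc n) \<omega>) - real (D n \<omega>)))"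
    using d unfolding determined_def by simp
  have d3: "determined D (Suc n) (\<lambda>\<omega>. if D (Suc n) \<omega> = D n \<omega> then u \<omega> else v \<omega>)"
    by (intro determined_if determined_mono[OF u] determined_mono[OF v]) (simp_all add: determined_def)
  have "expectation (\<lambda>\<omega>. if D (Suc n) \<omega> = D n \<omega> then u \<omega> else v \<omega>) =
    expectation (\<lambda>\<omega>. u \<omega> + (v \<omega> - u \<omega>) * (real (D (Suc n) \<omega>) - real (D n \<omega>)))"
  proof (rule integral_cong_AE)
    show "AE \<omega> in M. (if D (Suc n) \<omega> = D n \<omega> then u \<omega> else v \<omega>) =
        u \<omega> + (v \<omega> - u \<omega>) * (real (D (Suc n) \<omega>) - real (D n \<omega>))"
      using D_step[OF assms(1)] by eventually_elim auto
  qed (use determined_integrable[OF d2] determined_integrable[OF d3] determined_integrable[OF u] in auto)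
  also have "\<dots> = expectation u + expectation (\<lambda>\<omega>. (v \<omega> - u \<omega>) * step_prob n \<omega>)"
    unfolding step_prob_def
    by (subst Bochner_Integration.integral_add)
       (auto simp: D_drift[OF assms(1) d] intro: determined_integrable u d2)
  also have "\<dots> = expectation (\<lambda>\<omega>. u \<omega> + (v \<omega> - u \<omega>) * step_prob n \<omega>)"
    by (subst Bochner_Integration.integral_add) (auto intro: determined_integrable u d1)
  also have "\<dots> = expectation (\<lambda>\<omega>. (1 - step_prob n \<omega>) * u \<omega> + step_prob n \<omega> * v \<omega>)"
    by (simp add: algebra_simps)
  finally show ?thesis .
qed

lemma AE_mart_increment_cases:
  assumes "n \<ge> 1"
  shows "AE \<omega> in M. f (mart (Suc n) \<omega> - mart n \<omega>) =
    (if D (Suc n) \<omega> = D n \<omega> then f (- real (Suc n) * step_prob n \<omega>)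
     else f (real (Suc n) * (1 - step_prob n \<omega>)))"
  using D_step[OF assms] by eventually_elim (elim disjE; simp add: mart_increment del: of_nat_Suc; simp)

lemma expectation_mart_step:
  fixes f :: "real \<Rightarrow> real"
  assumes "n \<ge> 1" and X: "determined D n X"
  shows "expectation (\<lambda>\<omega>. X \<omega> * f (mart (Suc n) \<omega> - mart n \<omega>)) =
    expectation (\<lambda>\<omega>. X \<omega> * ((1 - step_prob n \<omega>) * f (- real (Suc n) * step_prob n \<omega>) +
                            step_prob n \<omega> * f (real (Suc n) * (1 - step_prob n \<omega>))))"
proof -
  note sp = determined_step_prob[OF order_refl, of n]
  have u: "determined D n (\<lambda>\<omega>. X \<omega> * f (- real (Suc n) * step_prob n \<omega>))"
    by (rule determined_comp2[OF X sp])
  have v: "determined D n (\<lambda>\<omega>. X \<omega> * f (real (Suc n) * (1 - step_prob n \<omega>)))"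
    by (rule determined_comp2[OF X sp])
  have d1: "determined D (Suc n) (\<lambda>\<omega>. X \<omega> * f (mart (Suc n) \<omega> - mart n \<omega>))"
    using X unfolding determined_def by (simp add: mart_def)
  have d2: "determined D (Suc n) (\<lambda>\<omega>. if D (Suc n) \<omega> = D n \<omega>
      then X \<omega> * f (- real (Suc n) * step_prob n \<omega>)
      else X \<omega> * f (real (Suc n) * (1 - step_prob n \<omega>)))"
    by (intro determined_if determined_mono[OF u] determined_mono[OF v]) (simp_all add: determined_def)
  have "expectation (\<lambda>\<omega>. X \<omega> * f (mart (Suc n) \<omega> - mart n \<omega>)) =
    expectation (\<lambda>\<omega>. if D (Suc n) \<omega> = D n \<omega> then X \<omega> * f (- real (Suc n) * step_prob n \<omega>)
       else X \<omega> * f (real (Suc n) * (1 - step_prob n \<omega>)))"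
  proof (rule integral_cong_AE)
    show "AE \<omega> in M. X \<omega> * f (mart (Suc n) \<omega> - mart n \<omega>) =
      (if D (Suc n) \<omega> = D n \<omega> then X \<omega> * f (- real (Suc n) * step_prob n \<omega>)
       else X \<omega> * f (real (Suc n) * (1 - step_prob n \<omega>)))"
      using AE_mart_increment_cases[OF assms(1), of f] by eventually_elim auto
  qed (use determined_integrable[OF d1] determined_integrable[OF d2] in auto)
  also have "\<dots> = expectation (\<lambda>\<omega>. X \<omega> * ((1 - step_prob n \<omega>) * f (- real (Suc n) * step_prob n \<omega>) +
                            step_prob n \<omega> * f (real (Suc n) * (1 - step_prob n \<omega>))))"
    unfolding expectation_step[OF assms(1) u v] by (simp add: algebra_simps)
  finally show ?thesis .
qed

text \<open>
  A deterministic bound for the predictable quadratic variation of \<^const>\<open>mart\<close>, obtained from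
  \<open>p (1 - p) \<le> 1 / 4\<close>.
\<close>

definition qv :: "nat \<Rightarrow> real" where
  "qv n = (\<Sum>i=1..n. (real i)\<^sup>2) / 4"

lemma qv_Suc: "qv (Suc n) = qv n + (real (Suc n))\<^sup>2 / 4"
  by (simp add: qv_def add_divide_distrib)

lemma qv_eq: "qv n = real n * (real n + 1) * (2 * real n + 1) / 24"
  by (induction n) (simp_all add: qv_Suc qv_def[of 0] power2_eq_square field_simps)

lemma qv_nonneg: "0 \<le> qv n"
  by (simp add: qv_def sum_nonneg)

lemma qv_mono: "m \<le> n \<Longrightarrow> qv m \<le> qv n"
  by (rule lift_Suc_mono_le[of qv]) (simp_all add: qv_Suc)

lemma qv_le: "qv n \<le> real n ^ 3 / 4"
proof -
  have "(\<Sum>i=1..n. (real i)\<^sup>2) \<le> (\<Sum>i=1..n. (real n)\<^sup>2)"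
    by (intro sum_mono power_mono) auto
  then show ?thesis by (simp add: qv_def power3_eq_cube power2_eq_square)
qed

lemma qv_asymp: "(\<lambda>n. qv n / real n ^ 3) \<longlonglongrightarrow> 1 / 12"
  unfolding qv_eq by real_asymp

lemma qv_eventually_le:
  assumes "q > 1"
  shows "eventually (\<lambda>n. qv n \<le> q * real n ^ 3 / 12) sequentially"
proof -
  have "eventually (\<lambda>n. qv n / real n ^ 3 < q / 12) sequentially"
    using assms by (intro order_tendstoD(2)[OF qv_asymp]) simp
  then show ?thesis using eventually_gt_at_top[of 0]
    by eventually_elim (simp add: field_simps)
qed

section \<open>Exponential bounds from above\<close>

lemma mgf_step_le:
  assumes "n \<ge> 1" and X: "determined D n X" and nonneg: "\<And>\<omega>. 0 \<le> X \<omega>"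
  shows "expectation (\<lambda>\<omega>. X \<omega> * exp (l * (mart (Suc n) \<omega> - mart n \<omega>)))
    \<le> exp (l\<^sup>2 * (real (Suc n))\<^sup>2 / 8) * expectation X"
proof -
  note sp = determined_step_prob[OF order_refl, of n]
  let ?x = "l * real (Suc n)"
  have "expectation (\<lambda>\<omega>. X \<omega> * exp (l * (mart (Suc n) \<omega> - mart n \<omega>))) =
     expectation (\<lambda>\<omega>. X \<omega> * ((1 - step_prob n \<omega>) * exp (l * (- real (Suc n) * step_prob n \<omega>)) +
                            step_prob n \<omega> * exp (l * (real (Suc n) * (1 - step_prob n \<omega>)))))"
    by (rule expectation_mart_step[OF assms(1) X, of "\<lambda>y. exp (l * y)"])
  also have "\<dots> = expectation (\<lambda>\<omega>. X \<omega> *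
      ((1 - step_prob n \<omega>) * exp (- ?x * step_prob n \<omega>) + step_prob n \<omega> * exp (?x * (1 - step_prob n \<omega>))))"
    by (simp add: mult.assoc del: of_nat_Suc)
  also have "\<dots> \<le> expectation (\<lambda>\<omega>. X \<omega> * exp (?x\<^sup>2 / 8))"
  proof (rule integral_mono_AE)
    show "AE \<omega> in M. X \<omega> * ((1 - step_prob n \<omega>) * exp (- ?x * step_prob n \<omega>) +
        step_prob n \<omega> * exp (?x * (1 - step_prob n \<omega>))) \<le> X \<omega> * exp (?x\<^sup>2 / 8)"
      by (intro AE_I2 mult_left_mono[OF bernoulli_mgf_le[OF step_prob_bounds] nonneg])
    show "integrable M (\<lambda>\<omega>. X \<omega> * ((1 - step_prob n \<omega>) * exp (- ?x * step_prob n \<omega>) +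
        step_prob n \<omega> * exp (?x * (1 - step_prob n \<omega>))))"
      by (rule determined_integrable[OF determined_comp2[OF X sp,
            of "\<lambda>x p. x * ((1 - p) * exp (- ?x * p) + p * exp (?x * (1 - p)))"]])
    show "integrable M (\<lambda>\<omega>. X \<omega> * exp (?x\<^sup>2 / 8))"
      using determined_integrable[OF X] by simp
  qed
  finally show ?thesis by (simp add: power_mult_distrib mult.commute)
qed

text \<open>
  The weight \<open>X\<close> plays the role of the conditioning: the choice of indicators of past events
  makes this a bound for the conditional exponential moment given the past at time \<open>n\<close>.
\<close>

lemma mgf_le:
  assumes "1 \<le> n" "n \<le> j" and X: "determined D n X" and nonneg: "\<And>\<omega>. 0 \<le> X \<omega>"
  shows "expectation (\<lambda>\<omega>. X \<omega> * exp (l * (mart j \<omega> - mart n \<omega>)))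
    \<le> exp (l\<^sup>2 * (qv j - qv n) / 2) * expectation X"
  using assms(2)
proof (induction j rule: dec_induct)
  case (step j)
  have d: "determined D j (\<lambda>\<omega>. X \<omega> * exp (l * (mart j \<omega> - mart n \<omega>)))"
    by (rule determined_comp2[OF determined_mono[OF X step(1)]
          determined_comp2[OF determined_mart[OF order_refl] determined_mart[OF step(1)], of "(-)"],
          of "\<lambda>x y. x * exp (l * y)"])
  have "expectation (\<lambda>\<omega>. X \<omega> * exp (l * (mart (Suc j) \<omega> - mart n \<omega>))) =
    expectation (\<lambda>\<omega>. X \<omega> * exp (l * (mart j \<omega> - mart n \<omega>)) * exp (l * (mart (Suc j) \<omega> - mart j \<omega>)))"
    unfolding mult.assoc exp_add[symmetric] distrib_left[symmetric] by simp
  also have "\<dots> \<le> exp (l\<^sup>2 * (real (Suc j))\<^sup>2 / 8) * expectation (\<lambda>\<omega>. X \<omega> * exp (l * (mart j \<omega> - mart n \<omega>)))"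
    using step assms(1) by (intro mgf_step_le d) (simp_all add: nonneg)
  also have "\<dots> \<le> exp (l\<^sup>2 * (real (Suc j))\<^sup>2 / 8) * (exp (l\<^sup>2 * (qv j - qv n) / 2) * expectation X)"
    using step.IH by (intro mult_left_mono) auto
  also have "\<dots> = exp (l\<^sup>2 * (qv (Suc j) - qv n) / 2) * expectation X"
    unfolding mult.assoc[symmetric] exp_add[symmetric] qv_Suc by (simp add: field_simps)
  finally show ?case .
qed simp

lemma determined_exp_increment:
  assumes "determined D m X" "m \<le> n" "j \<le> n"
  shows "determined D n (\<lambda>\<omega>. X \<omega> * exp (l * (mart j \<omega> - mart m \<omega>)))"
  by (rule determined_comp2[OF determined_mono[OF assms(1,2)] determined_mart_increment[OF assms(3,2)],
        where f = "\<lambda>x y. x * exp (l * y)"])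

text \<open>
  The maximal inequality for the nonnegative supermartingale
  \<open>Z\<^sub>j = exp (l M\<^sub>j - l\<^sup>2 V\<^sub>j / 2)\<close>. Freezing it at the value \<open>exp a\<close> once this level has
  been exceeded gives a process \<open>W\<close> whose expectation still decreases, and the expectation
  of \<open>W\<^sub>N\<close> is at least \<open>exp a\<close> times the probability in question.
\<close>

lemma mart_maximal:
  assumes "1 \<le> N"
  shows "prob {\<omega> \<in> space M. \<exists>j\<in>{1..N}. a \<le> l * mart j \<omega> - l\<^sup>2 * qv j / 2} \<le> exp (- a)"
proof -
  define Z where "Z j \<omega> = exp (l * mart j \<omega> - l\<^sup>2 * qv j / 2)" for j \<omega>
  define B where "B j \<omega> \<longleftrightarrow> (\<exists>i\<in>{1..j}. a \<le> l * mart i \<omega> - l\<^sup>2 * qv i / 2)" for j \<omega>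
  define W where "W j \<omega> = (if B j \<omega> then exp a else Z j \<omega>)" for j \<omega>
  have detZ: "determined D j (Z j)" for j
    unfolding Z_def by (rule determined_comp[OF determined_mart[OF order_refl], where f = "\<lambda>m. exp (l * m - l\<^sup>2 * qv j / 2)"])
  have detB: "determined D j (B j)" for j
    unfolding B_def
    by (intro determined_bex determined_comp[OF determined_mart, where f = "\<lambda>m. a \<le> l * m - l\<^sup>2 * qv _ / 2"]) auto
  have detB': "determined D j (\<lambda>\<omega>. if B j \<omega> then c else 0 :: real)" for j c
    by (intro determined_if detB determined_const)
  have detW: "determined D j (W j)" for j
    unfolding W_def by (intro determined_if detB detZ determined_const)
  have W_step: "expectation (W (Suc j)) \<le> expectation (W j)" if "1 \<le> j" for j
  proof -
    let ?c = "exp (- (l\<^sup>2 * (real (Suc j))\<^sup>2 / 8))"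
    define X where "X \<omega> = (if B j \<omega> then 0 else Z j \<omega> * ?c)" for \<omega>
    have detX: "determined D j X"
      unfolding X_def
      by (intro determined_if detB determined_const determined_comp[OF detZ, where f = "\<lambda>z. z * ?c"])
    let ?R = "\<lambda>\<omega>. X \<omega> * exp (l * (mart (Suc j) \<omega> - mart j \<omega>))"
    have detR: "determined D (Suc j) ?R"
      by (rule determined_comp2[OF determined_mono[OF detX] determined_comp2[OF determined_mart
            determined_mart, where f = "(-)"], where f = "\<lambda>x y. x * exp (l * y)"]) auto
    have le: "W (Suc j) \<omega> \<le> (if B j \<omega> then exp a else 0) + ?R \<omega>" for \<omega>
    proof (cases "B j \<omega>")
      case True
      then have "B (Suc j) \<omega>" unfolding B_def by force
      then show ?thesis using True by (simp add: W_def X_def)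
    next
      case False
      have "?R \<omega> = Z (Suc j) \<omega>"
        unfolding X_def Z_def qv_Suc using False
        by (simp add: algebra_simps add_divide_distrib flip: exp_add del: of_nat_Suc)
      moreover have "W (Suc j) \<omega> \<le> Z (Suc j) \<omega>"
      proof (cases "B (Suc j) \<omega>")
        case True
        then have "a \<le> l * mart (Suc j) \<omega> - l\<^sup>2 * qv (Suc j) / 2"
          using False unfolding B_def by (auto simp: le_Suc_eq)
        then show ?thesis using True by (simp add: W_def Z_def)
      qed (simp add: W_def)
      ultimately show ?thesis using False by simp
    qed
    have "expectation (W (Suc j)) \<le> expectation (\<lambda>\<omega>. (if B j \<omega> then exp a else 0) + ?R \<omega>)"
      by (intro integral_mono le Bochner_Integration.integrable_add determined_integrable[OF detW]
          determined_integrable[OF detB'] determined_integrable[OF detR])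
    also have "\<dots> = expectation (\<lambda>\<omega>. if B j \<omega> then exp a else 0) + expectation ?R"
      by (intro Bochner_Integration.integral_add determined_integrable[OF detB'] determined_integrable[OF detR])
    also have "expectation ?R \<le> exp (l\<^sup>2 * (real (Suc j))\<^sup>2 / 8) * expectation X"
      by (rule mgf_step_le[OF that detX]) (simp add: X_def Z_def)
    also have "\<dots> = expectation (\<lambda>\<omega>. exp (l\<^sup>2 * (real (Suc j))\<^sup>2 / 8) * X \<omega>)"
      by simp
    also have "expectation (\<lambda>\<omega>. if B j \<omega> then exp a else 0) + \<dots> =
      expectation (\<lambda>\<omega>. (if B j \<omega> then exp a else 0) + exp (l\<^sup>2 * (real (Suc j))\<^sup>2 / 8) * X \<omega>)"
      using determined_integrable[OF detX]
      by (intro Bochner_Integration.integral_add[symmetric] determined_integrable[OF detB']) auto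
    also have "(\<lambda>\<omega>. (if B j \<omega> then exp a else 0) + exp (l\<^sup>2 * (real (Suc j))\<^sup>2 / 8) * X \<omega>) = W j"
      by (rule ext) (simp add: W_def X_def exp_minus del: of_nat_Suc)
    finally show ?thesis by simp
  qed
  have "expectation (W N) \<le> expectation (W 1)"
    using assms by (induction N rule: dec_induct) (use W_step order_trans in blast)+
  also have "expectation (W 1) \<le> expectation (\<lambda>_. 1)"
  proof (intro integral_mono determined_integrable[OF detW])
    fix \<omega>
    show "W 1 \<omega> \<le> 1"
      using qv_nonneg[of 1] unfolding W_def Z_def B_def
      by (auto simp: mart_1 zero_le_mult_iff intro: order_trans)
  qed simp
  finally have 1: "expectation (W N) \<le> 1" by (simp add: prob_space)
  have "exp a * prob {\<omega> \<in> space M. B N \<omega>} = expectation (\<lambda>\<omega>. if B N \<omega> then exp a else 0)"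
    by (rule expectation_if_determined[OF detB, symmetric])
  also have "\<dots> \<le> expectation (W N)"
    by (intro integral_mono determined_integrable[OF detW] determined_integrable[OF detB'])
       (simp add: W_def Z_def)
  finally have "exp a * prob {\<omega> \<in> space M. B N \<omega>} \<le> 1" using 1 by linarith
  then show ?thesis unfolding B_def by (simp add: exp_minus field_simps)
qed

lemma mart_upper_tail:
  assumes "1 \<le> N" "0 < a" "\<bar>s\<bar> = 1"
  shows "prob {\<omega> \<in> space M. \<exists>j\<in>{1..N}. sqrt (2 * a * qv N) \<le> s * mart j \<omega>} \<le> exp (- a)"
proof -
  (* with the tilt r * s the martingale term is at least 2 a on the event, the compensator at most a *)
  define r where "r = sqrt (2 * a / qv N)"
  have qN: "0 < qv N" using assms(1) by (simp add: qv_eq)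
  have s2: "s\<^sup>2 = 1" using assms(3) by (metis abs_1 power2_abs power_one)
  have r2: "r\<^sup>2 = 2 * a / qv N" "0 \<le> r" using qN assms(2) by (auto simp: r_def)
  have sets: "{\<omega> \<in> space M. \<exists>j\<in>{1..N}. a \<le> (r * s) * mart j \<omega> - (r * s)\<^sup>2 * qv j / 2} \<in> events"
    by (rule determined_sets[of N], intro determined_bex determined_comp[OF determined_mart, where f = "\<lambda>m. a \<le> (r * s) * m - (r * s)\<^sup>2 * qv _ / 2"]) auto
  have "prob {\<omega> \<in> space M. \<exists>j\<in>{1..N}. sqrt (2 * a * qv N) \<le> s * mart j \<omega>}
    \<le> prob {\<omega> \<in> space M. \<exists>j\<in>{1..N}. a \<le> (r * s) * mart j \<omega> - (r * s)\<^sup>2 * qv j / 2}"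
  proof (intro finite_measure_mono sets subsetI, clarify, intro bexI conjI)
    fix \<omega> j assume j: "j \<in> {1..N}" "sqrt (2 * a * qv N) \<le> s * mart j \<omega>"
    have "sqrt ((2 * a)\<^sup>2) = r * sqrt (2 * a * qv N)"
      unfolding r_def real_sqrt_mult[symmetric] using qN by (simp add: power2_eq_square)
    then have "2 * a = r * sqrt (2 * a * qv N)" using assms(2) by (simp only: real_sqrt_abs)
    also have "\<dots> \<le> r * (s * mart j \<omega>)" using j(2) r2(2) by (intro mult_left_mono)
    finally have 1: "2 * a \<le> (r * s) * mart j \<omega>" by (simp add: mult.assoc)
    have "(r * s)\<^sup>2 * qv j / 2 = a * (qv j / qv N)" using s2 r2 by (simp add: power_mult_distrib)
    also have "\<dots> \<le> a * 1" using j qN qv_mono[of j N] assms(2) by (intro mult_left_mono) auto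
    finally show "a \<le> (r * s) * mart j \<omega> - (r * s)\<^sup>2 * qv j / 2" using 1 by linarith
  qed auto
  also have "\<dots> \<le> exp (- a)" by (rule mart_maximal[OF assms(1)])
  finally show ?thesis .
qed

section \<open>Exponential bounds from below\<close>

text \<open>
  Under a small tilt the event that the centred descent number at time \<open>j\<close> exceeds \<open>\<kappa> j\<close> in
  absolute value carries a weight exponentially small in \<open>j\<close>. Indeed \<open>\<bar>M\<^sub>j - M\<^sub>n\<bar>\<close> is then
  at least \<open>\<kappa> j\<^sup>2 / 2\<close>, and a further tilt by \<open>\<theta> = \<kappa> / (2 j)\<close> in the direction of the
  deviation gains \<open>\<kappa>\<^sup>2 j / 4\<close> in the exponent, while the Hoeffding bound for the total tilt,
  at most \<open>2 \<theta>\<close>, costs only \<open>\<kappa>\<^sup>2 j / 8\<close>.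
\<close>

lemma mgf_tilted_deviation_le:
  assumes "1 \<le> n" "n \<le> j" and X: "determined D n X" and nonneg: "\<And>\<omega>. 0 \<le> X \<omega>"
    and supp: "\<And>\<omega>. X \<omega> \<noteq> 0 \<Longrightarrow> \<bar>mart n \<omega>\<bar> \<le> \<kappa> / 2 * (real n)\<^sup>2"
    and \<kappa>: "0 < \<kappa>" and l: "\<bar>l\<bar> * real j \<le> \<kappa> / 2"
  shows "expectation (\<lambda>\<omega>. if \<bar>mart j \<omega>\<bar> \<le> \<kappa> * (real j)\<^sup>2 then 0 else X \<omega> * exp (l * (mart j \<omega> - mart n \<omega>)))
    \<le> 2 * exp (- \<kappa>\<^sup>2 * real j / 8) * expectation X"
proof -
  define \<theta> where "\<theta> = \<kappa> / (2 * real j)"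
  have j: "1 \<le> real j" using assms(1,2) by simp
  have \<theta>: "0 < \<theta>" "\<bar>l\<bar> \<le> \<theta>" using \<kappa> j l by (auto simp: \<theta>_def field_simps)
  let ?Y = "\<lambda>t \<omega>. X \<omega> * exp (t * (mart j \<omega> - mart n \<omega>))"
  let ?c = "exp (- \<kappa>\<^sup>2 * real j / 4)"
  have detY: "determined D j (?Y t)" for t
    by (rule determined_exp_increment[OF X assms(2) order_refl])
  have bound: "expectation (?Y t) \<le> exp (\<kappa>\<^sup>2 * real j / 8) * expectation X" if t: "\<bar>t\<bar> \<le> 2 * \<theta>" for t
  proof -
    have "t\<^sup>2 \<le> (2 * \<theta>)\<^sup>2" using t \<theta>(1) abs_le_square_iff[of t "2 * \<theta>"] by simp
    moreover have "qv j - qv n \<le> real j ^ 3 / 4" using qv_le[of j] qv_nonneg[of n] by linarith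
    moreover have "0 \<le> qv j - qv n" using qv_mono[OF assms(2)] by simp
    ultimately have "t\<^sup>2 * (qv j - qv n) \<le> (2 * \<theta>)\<^sup>2 * (real j ^ 3 / 4)" by (intro mult_mono) auto
    also have "\<dots> = \<kappa>\<^sup>2 * real j / 4" using j by (simp add: \<theta>_def field_simps power2_eq_square power3_eq_cube)
    finally have "t\<^sup>2 * (qv j - qv n) / 2 \<le> \<kappa>\<^sup>2 * real j / 8" by linarith
    then have "exp (t\<^sup>2 * (qv j - qv n) / 2) \<le> exp (\<kappa>\<^sup>2 * real j / 8)" by (simp only: exp_le_cancel_iff)
    moreover have "0 \<le> expectation X" using nonneg by (intro Bochner_Integration.integral_nonneg)
    ultimately have "exp (t\<^sup>2 * (qv j - qv n) / 2) * expectation X \<le> exp (\<kappa>\<^sup>2 * real j / 8) * expectation X"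
      by (intro mult_right_mono)
    with mgf_le[OF assms(1,2) X nonneg, of t] show ?thesis by linarith
  qed
  have pointwise: "(if \<bar>mart j \<omega>\<bar> \<le> \<kappa> * (real j)\<^sup>2 then 0 else ?Y l \<omega>) \<le> ?c * (?Y (l + \<theta>) \<omega> + ?Y (l - \<theta>) \<omega>)" for \<omega>
  proof (cases "\<bar>mart j \<omega>\<bar> \<le> \<kappa> * (real j)\<^sup>2 \<or> X \<omega> = 0")
    case True
    then show ?thesis using nonneg[of \<omega>] by auto
  next
    case False
    define y where "y = mart j \<omega> - mart n \<omega>"
    have "\<kappa> / 2 * (real n)\<^sup>2 \<le> \<kappa> / 2 * (real j)\<^sup>2" using assms(2) \<kappa> by (intro mult_left_mono power_mono) auto
    then have "\<kappa> / 2 * (real j)\<^sup>2 \<le> \<bar>y\<bar>" using False supp[of \<omega>] unfolding y_def by linarith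
    then have "\<theta> * (\<kappa> / 2 * (real j)\<^sup>2) \<le> \<theta> * \<bar>y\<bar>" using \<theta>(1) by (intro mult_left_mono) auto
    moreover have "\<theta> * (\<kappa> / 2 * (real j)\<^sup>2) = \<kappa>\<^sup>2 * real j / 4" using j by (simp add: \<theta>_def power2_eq_square)
    ultimately have 1: "0 \<le> - \<kappa>\<^sup>2 * real j / 4 + \<theta> * \<bar>y\<bar>" by linarith
    have "exp (l * y) \<le> exp (- \<kappa>\<^sup>2 * real j / 4 + (l + \<theta>) * y) + exp (- \<kappa>\<^sup>2 * real j / 4 + (l - \<theta>) * y)"
    proof (cases "0 \<le> y")
      case True
      then have "exp (l * y) \<le> exp (- \<kappa>\<^sup>2 * real j / 4 + (l + \<theta>) * y)" using 1 by (simp add: algebra_simps)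
      then show ?thesis by (meson add_increasing2 exp_ge_zero)
    next
      case False
      then have "exp (l * y) \<le> exp (- \<kappa>\<^sup>2 * real j / 4 + (l - \<theta>) * y)" using 1 by (simp add: algebra_simps)
      then show ?thesis by (meson add_increasing exp_ge_zero)
    qed
    then have "X \<omega> * exp (l * y) \<le> X \<omega> * (?c * exp ((l + \<theta>) * y) + ?c * exp ((l - \<theta>) * y))"
      unfolding exp_add[symmetric] by (rule mult_left_mono[OF _ nonneg])
    then show ?thesis using False by (simp add: y_def algebra_simps)
  qed
  have "expectation (\<lambda>\<omega>. if \<bar>mart j \<omega>\<bar> \<le> \<kappa> * (real j)\<^sup>2 then 0 else ?Y l \<omega>) \<le>
    expectation (\<lambda>\<omega>. ?c * (?Y (l + \<theta>) \<omega> + ?Y (l - \<theta>) \<omega>))"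
  proof (rule integral_mono[OF _ _ pointwise])
    show "integrable M (\<lambda>\<omega>. if \<bar>mart j \<omega>\<bar> \<le> \<kappa> * (real j)\<^sup>2 then 0 else ?Y l \<omega>)"
      by (intro determined_integrable[of j] determined_if determined_const detY
          determined_comp[OF determined_mart[OF order_refl], where f = "\<lambda>m. \<bar>m\<bar> \<le> \<kappa> * (real j)\<^sup>2"])
    show "integrable M (\<lambda>\<omega>. ?c * (?Y (l + \<theta>) \<omega> + ?Y (l - \<theta>) \<omega>))"
      using determined_integrable[OF detY] by (intro integrable_mult_right Bochner_Integration.integrable_add) auto
  qed
  also have "\<dots> = ?c * (expectation (?Y (l + \<theta>)) + expectation (?Y (l - \<theta>)))"
    using determined_integrable[OF detY] by simp
  also have "\<dots> \<le> ?c * (exp (\<kappa>\<^sup>2 * real j / 8) * expectation X + exp (\<kappa>\<^sup>2 * real j / 8) * expectation X)"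
    using \<theta> by (intro mult_left_mono add_mono bound) auto
  also have "\<dots> = 2 * (?c * exp (\<kappa>\<^sup>2 * real j / 8)) * expectation X" by simp
  also have "?c * exp (\<kappa>\<^sup>2 * real j / 8) = exp (- \<kappa>\<^sup>2 * real j / 8)"
    unfolding exp_add[symmetric] by (rule arg_cong[of _ _ exp]) simp
  finally show ?thesis .
qed

text \<open>
  The reverse of \<open>mgf_le\<close>. A step contributes almost the full factor of Hoeffding's bound on
  the event that the current descent number is near its mean; the weight of the complement
  is controlled by \<open>mgf_tilted_deviation_le\<close>, and the losses of all steps add up to a
  convergent series.
\<close>

lemma mgf_ge:
  assumes \<epsilon>: "0 < \<epsilon>" "\<epsilon> \<le> 1" and \<kappa>: "\<kappa> = \<epsilon> / 4" and n: "1 \<le> n" "n \<le> N"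
    and X: "determined D n X" and nonneg: "\<And>\<omega>. 0 \<le> X \<omega>"
    and supp: "\<And>\<omega>. X \<omega> \<noteq> 0 \<Longrightarrow> \<bar>mart n \<omega>\<bar> \<le> \<kappa> / 2 * (real n)\<^sup>2"
    and l: "\<bar>l\<bar> * real N \<le> \<kappa> / 2"
  shows "exp ((1 - \<epsilon>) * l\<^sup>2 * (qv N - qv n) / 2) * (1 - (\<Sum>i\<in>{n..<N}. 2 * exp (- \<kappa>\<^sup>2 * real i / 8))) * expectation X
    \<le> expectation (\<lambda>\<omega>. X \<omega> * exp (l * (mart N \<omega> - mart n \<omega>)))"
  using n(2) l
proof (induction N rule: dec_induct)
  case (step j)
  have \<kappa>0: "0 < \<kappa>" using \<epsilon> \<kappa> by simp
  have EX: "0 \<le> expectation X" using nonneg by (intro Bochner_Integration.integral_nonneg)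
  have lS: "\<bar>l\<bar> * real (Suc j) \<le> \<kappa> / 2" using step.prems .
  have lj: "\<bar>l\<bar> * real j \<le> \<kappa> / 2"
    using mult_left_mono[of "real j" "real (Suc j)" "\<bar>l\<bar>"] lS by linarith
  have j1: "1 \<le> j" using n step(1) by simp
  define Y where "Y \<omega> = X \<omega> * exp (l * (mart j \<omega> - mart n \<omega>))" for \<omega>
  define G where "G \<omega> \<longleftrightarrow> \<bar>mart j \<omega>\<bar> \<le> \<kappa> * (real j)\<^sup>2" for \<omega>
  define \<phi> where "\<phi> \<omega> = (1 - step_prob j \<omega>) * exp (l * (- real (Suc j) * step_prob j \<omega>)) +
     step_prob j \<omega> * exp (l * (real (Suc j) * (1 - step_prob j \<omega>)))" for \<omega>
  define q where "q = exp ((1 - \<epsilon>) * (l * real (Suc j))\<^sup>2 / 8)"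
  have detY: "determined D j Y" unfolding Y_def by (rule determined_exp_increment[OF X step(1) order_refl])
  have detG: "determined D j G" unfolding G_def
    by (rule determined_comp[OF determined_mart[OF order_refl], where f = "\<lambda>m. \<bar>m\<bar> \<le> \<kappa> * (real j)\<^sup>2"])
  have detYphi: "determined D j (\<lambda>\<omega>. Y \<omega> * \<phi> \<omega>)"
    unfolding \<phi>_def
    by (rule determined_comp2[OF detY determined_step_prob[OF order_refl], where f = "\<lambda>y p. y *
        ((1 - p) * exp (l * (- real (Suc j) * p)) + p * exp (l * (real (Suc j) * (1 - p))))"])
  have det1: "determined D j (\<lambda>\<omega>. if G \<omega> then 0 else Y \<omega>)"
    by (intro determined_if detG detY determined_const)
  have Y0: "0 \<le> Y \<omega>" for \<omega> by (simp add: Y_def nonneg)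
  have good: "q \<le> \<phi> \<omega>" if "G \<omega>" for \<omega>
  proof -
    have "\<bar>step_prob j \<omega> - 1 / 2\<bar> = \<bar>mart j \<omega>\<bar> / (real j * (real j + 1))"
      using j1 by (simp add: step_prob_mart)
    also have "\<dots> \<le> \<kappa> * (real j)\<^sup>2 / (real j)\<^sup>2"
      using that j1 \<kappa>0 unfolding G_def by (intro frac_le) (auto simp: power2_eq_square)
    also have "\<dots> = \<epsilon> / 4" using j1 \<kappa> by simp
    finally have p: "\<bar>step_prob j \<omega> - 1 / 2\<bar> \<le> \<epsilon> / 4" .
    have x: "\<bar>l * real (Suc j)\<bar> \<le> \<epsilon> / 4" using lS \<kappa> \<epsilon> by (simp add: abs_mult)
    have "l * (- real (Suc j) * step_prob j \<omega>) = - (l * real (Suc j)) * step_prob j \<omega>"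
      "l * (real (Suc j) * (1 - step_prob j \<omega>)) = l * real (Suc j) * (1 - step_prob j \<omega>)"
      by (simp_all only: mult.assoc mult_minus_left mult_minus_right)
    then show ?thesis
      using bernoulli_mgf_ge[OF \<epsilon> p x] unfolding \<phi>_def q_def by (simp only:)
  qed
  have "q * (Y \<omega> - (if G \<omega> then 0 else Y \<omega>)) \<le> Y \<omega> * \<phi> \<omega>" for \<omega>
  proof (cases "G \<omega>")
    case True
    then show ?thesis using mult_left_mono[OF good Y0, of \<omega>] by (simp add: mult.commute)
  next
    case False
    have "0 \<le> \<phi> \<omega>" using step_prob_bounds[of j \<omega>] by (simp add: \<phi>_def)
    then show ?thesis using False Y0[of \<omega>] by simp
  qed
  then have m1: "expectation (\<lambda>\<omega>. q * (Y \<omega> - (if G \<omega> then 0 else Y \<omega>))) \<le> expectation (\<lambda>\<omega>. Y \<omega> * \<phi> \<omega>)"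
    using determined_integrable[OF detY] determined_integrable[OF det1]
    by (intro integral_mono determined_integrable[OF detYphi]) auto
  have m2: "expectation (\<lambda>\<omega>. q * (Y \<omega> - (if G \<omega> then 0 else Y \<omega>))) =
    q * (expectation Y - expectation (\<lambda>\<omega>. if G \<omega> then 0 else Y \<omega>))"
    using determined_integrable[OF detY] determined_integrable[OF det1] by simp
  have m3: "expectation (\<lambda>\<omega>. Y \<omega> * \<phi> \<omega>) = expectation (\<lambda>\<omega>. Y \<omega> * exp (l * (mart (Suc j) \<omega> - mart j \<omega>)))"
    unfolding \<phi>_def by (rule expectation_mart_step[OF j1 detY, where f = "\<lambda>y. exp (l * y)", symmetric])
  have m4: "(\<lambda>\<omega>. Y \<omega> * exp (l * (mart (Suc j) \<omega> - mart j \<omega>))) = (\<lambda>\<omega>. X \<omega> * exp (l * (mart (Suc j) \<omega> - mart n \<omega>)))"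
    unfolding Y_def mult.assoc exp_add[symmetric] distrib_left[symmetric] by simp
  have main: "q * (expectation Y - expectation (\<lambda>\<omega>. if G \<omega> then 0 else Y \<omega>)) \<le>
      expectation (\<lambda>\<omega>. X \<omega> * exp (l * (mart (Suc j) \<omega> - mart n \<omega>)))"
    using m1 unfolding m2 m3 m4 .
  have bad: "expectation (\<lambda>\<omega>. if G \<omega> then 0 else Y \<omega>) \<le> 2 * exp (- \<kappa>\<^sup>2 * real j / 8) * expectation X"
    unfolding G_def Y_def by (rule mgf_tilted_deviation_le[OF n(1) step(1) X nonneg supp \<kappa>0 lj])
  define g where "g = exp ((1 - \<epsilon>) * l\<^sup>2 * (qv j - qv n) / 2)"
  define S where "S = (\<Sum>i\<in>{n..<j}. 2 * exp (- \<kappa>\<^sup>2 * real i / 8))"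
  define r where "r = 2 * exp (- \<kappa>\<^sup>2 * real j / 8)"
  have "1 \<le> g" unfolding g_def using \<epsilon> qv_mono[OF step(1)] by simp
  then have "r * expectation X \<le> g * (r * expectation X)"
    using mult_right_mono[of 1 g "r * expectation X"] EX by (simp add: r_def)
  then have "g * (1 - (S + r)) * expectation X \<le> g * (1 - S) * expectation X - r * expectation X"
    by (simp add: algebra_simps)
  also have "\<dots> \<le> expectation Y - expectation (\<lambda>\<omega>. if G \<omega> then 0 else Y \<omega>)"
    using step.IH[OF lj] bad unfolding g_def S_def r_def Y_def by linarith
  finally have "q * (g * (1 - (S + r)) * expectation X) \<le> q * (expectation Y - expectation (\<lambda>\<omega>. if G \<omega> then 0 else Y \<omega>))"
    by (intro mult_left_mono) (auto simp: q_def)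
  also note main
  also have "q * (g * (1 - (S + r)) * expectation X) = (q * g) * (1 - (S + r)) * expectation X" by simp
  also have "q * g = exp ((1 - \<epsilon>) * l\<^sup>2 * (qv (Suc j) - qv n) / 2)"
    unfolding q_def g_def exp_add[symmetric] qv_Suc
    by (rule arg_cong[of _ _ exp]) (simp add: field_simps power_mult_distrib del: of_nat_Suc)
  also have "S + r = (\<Sum>i\<in>{n..<Suc j}. 2 * exp (- \<kappa>\<^sup>2 * real i / 8))"
    using step(1) by (simp add: S_def r_def)
  finally show ?case .
qed simp

text \<open>
  A lower bound for a tail probability from matching bounds on exponential moments. With \<open>L\<close>
  the increment multiplied by the tilt and \<open>v\<close> its variance bound, at least half of the
  expectation of \<open>exp L\<close> comes from values of \<open>L\<close> within \<open>\<delta> v\<close> of \<open>v\<close>: values below are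
  suppressed by comparison with the tilt \<open>1 - \<delta>\<close>, values above by comparison with the tilt
  \<open>1 + \<delta>\<close>, and both comparisons win \<open>\<delta>\<^sup>2 v / 2\<close> in the exponent, more than the \<open>\<delta>\<^sup>2 v / 4\<close>
  lost in \<open>mgf_ge\<close>. On the remaining event \<open>exp L\<close> is at most \<open>exp ((1 + \<delta>) v)\<close>.
\<close>

lemma mart_lower_tail:
  assumes \<delta>: "0 < \<delta>" "\<delta> \<le> 1" and \<kappa>: "\<kappa> = \<delta>\<^sup>2 / 8" and n: "1 \<le> n" "n \<le> N"
    and P: "determined D n P"
    and P_small: "\<And>\<omega>. P \<omega> \<Longrightarrow> \<bar>mart n \<omega>\<bar> \<le> \<kappa> / 2 * (real n)\<^sup>2"
    and l: "\<bar>l\<bar> * real N \<le> \<kappa> / 2"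
    and tail: "(\<Sum>i\<in>{n..<N}. 2 * exp (- \<kappa>\<^sup>2 * real i / 8)) \<le> 1 / 2"
    and v: "v = l\<^sup>2 * (qv N - qv n)" and v_large: "4 * ln 8 \<le> \<delta>\<^sup>2 * v"
  shows "1 / 4 * exp (- (1 + 3 * \<delta>) * v / 2) * prob {\<omega> \<in> space M. P \<omega>}
    \<le> prob {\<omega> \<in> space M. P \<omega> \<and> (1 - \<delta>) * v \<le> l * (mart N \<omega> - mart n \<omega>)}"
proof -
  define X where "X \<omega> = (if P \<omega> then 1 else 0 :: real)" for \<omega>
  define Q where "Q \<omega> \<longleftrightarrow> P \<omega> \<and> (1 - \<delta>) * v \<le> l * (mart N \<omega> - mart n \<omega>)" for \<omega>
  define p where "p = prob {\<omega> \<in> space M. P \<omega>}"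
  define pQ where "pQ = prob {\<omega> \<in> space M. Q \<omega>}"
  let ?Y = "\<lambda>t \<omega>. X \<omega> * exp ((t * l) * (mart N \<omega> - mart n \<omega>))"
  have detX: "determined D n X" unfolding X_def by (intro determined_if P determined_const)
  have X0: "0 \<le> X \<omega>" for \<omega> by (simp add: X_def)
  have detQ: "determined D N Q" unfolding Q_def
    by (rule determined_comp2[OF determined_mono[OF P n(2)] determined_mart_increment[OF order_refl n(2)],
         where f = "\<lambda>x y. x \<and> (1 - \<delta>) * v \<le> l * y"])
  have EX: "expectation X = p" unfolding X_def p_def using expectation_if_determined[OF P, of 1] by simp
  have p0: "0 \<le> p" by (simp add: p_def)
  have v0: "0 \<le> v" unfolding v using qv_mono[OF n(2)] by simp
  have int: "integrable M (?Y t)" for t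
    by (rule determined_integrable[OF determined_exp_increment[OF detX n(2) order_refl]])
  have intQ: "integrable M (\<lambda>\<omega>. if Q \<omega> then exp ((1 + \<delta>) * v) else 0)"
    by (intro determined_integrable[of N] determined_if detQ determined_const)
  have upper: "expectation (?Y t) \<le> exp (t\<^sup>2 * v / 2) * p" for t
  proof -
    have "(t * l)\<^sup>2 * (qv N - qv n) / 2 = t\<^sup>2 * v / 2" by (simp add: v power_mult_distrib)
    then show ?thesis using mgf_le[OF n detX X0, of "t * l"] by (simp only: EX)
  qed
  have lower: "exp ((1 - \<delta>\<^sup>2 / 2) * v / 2) * (1 / 2) * p \<le> expectation (?Y 1)"
  proof -
    have e: "0 < \<delta>\<^sup>2 / 2" "\<delta>\<^sup>2 / 2 \<le> 1" "\<kappa> = \<delta>\<^sup>2 / 2 / 4" using \<delta> \<kappa> power_le_one[of \<delta> 2] by auto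
    have "exp ((1 - \<delta>\<^sup>2 / 2) * v / 2) * (1 / 2) * p \<le>
      exp ((1 - \<delta>\<^sup>2 / 2) * v / 2) * (1 - (\<Sum>i\<in>{n..<N}. 2 * exp (- \<kappa>\<^sup>2 * real i / 8))) * p"
      using tail p0 by (intro mult_right_mono mult_left_mono) auto
    also have "\<dots> \<le> expectation (?Y 1)"
    proof -
      have supp: "\<bar>mart n \<omega>\<bar> \<le> \<kappa> / 2 * (real n)\<^sup>2" if "X \<omega> \<noteq> 0" for \<omega>
        using that P_small[of \<omega>] by (cases "P \<omega>") (simp_all add: X_def)
      have "(1 - \<delta>\<^sup>2 / 2) * l\<^sup>2 * (qv N - qv n) / 2 = (1 - \<delta>\<^sup>2 / 2) * v / 2" by (simp add: v)
      then show ?thesis using mgf_ge[OF e n detX X0 supp l] by (simp only: EX mult_1 simp_thms)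
    qed
    finally show ?thesis .
  qed
  have pointwise: "?Y 1 \<omega> \<le> exp (\<delta> * (1 - \<delta>) * v) * ?Y (1 - \<delta>) \<omega> + (if Q \<omega> then exp ((1 + \<delta>) * v) else 0)
      + exp (- \<delta> * (1 + \<delta>) * v) * ?Y (1 + \<delta>) \<omega>" for \<omega>
  proof (cases "P \<omega>")
    case True
    define L where "L = l * (mart N \<omega> - mart n \<omega>)"
    have Y: "?Y t \<omega> = exp (t * L)" for t using True by (simp add: X_def L_def mult.assoc)
    have nn: "0 \<le> exp (\<delta> * (1 - \<delta>) * v) * ?Y (1 - \<delta>) \<omega>" "0 \<le> exp (- \<delta> * (1 + \<delta>) * v) * ?Y (1 + \<delta>) \<omega>"
      "0 \<le> (if Q \<omega> then exp ((1 + \<delta>) * v) else 0)"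
      unfolding Y by auto
    consider "L < (1 - \<delta>) * v" | "(1 - \<delta>) * v \<le> L" "L \<le> (1 + \<delta>) * v" | "(1 + \<delta>) * v < L" by linarith
    then show ?thesis
    proof cases
      case 1
      then have "\<delta> * L \<le> \<delta> * ((1 - \<delta>) * v)" using \<delta> by (intro mult_left_mono) auto
      then have "L \<le> \<delta> * (1 - \<delta>) * v + (1 - \<delta>) * L" by (simp add: algebra_simps)
      then have "exp L \<le> exp (\<delta> * (1 - \<delta>) * v) * ?Y (1 - \<delta>) \<omega>" unfolding Y exp_add[symmetric] by simp
      then show ?thesis using nn Y[of 1] by simp
    next
      case 2
      then have "exp L \<le> (if Q \<omega> then exp ((1 + \<delta>) * v) else 0)" using True by (simp add: Q_def L_def)
      then show ?thesis using nn Y[of 1] by simp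
    next
      case 3
      then have "\<delta> * ((1 + \<delta>) * v) \<le> \<delta> * L" using \<delta> by (intro mult_left_mono) auto
      then have "L \<le> - \<delta> * (1 + \<delta>) * v + (1 + \<delta>) * L" by (simp add: algebra_simps)
      then have "exp L \<le> exp (- \<delta> * (1 + \<delta>) * v) * ?Y (1 + \<delta>) \<omega>" unfolding Y exp_add[symmetric] by simp
      then show ?thesis using nn Y[of 1] by simp
    qed
  qed (simp add: X_def Q_def)
  have "expectation (?Y 1) \<le> expectation (\<lambda>\<omega>. exp (\<delta> * (1 - \<delta>) * v) * ?Y (1 - \<delta>) \<omega> +
      (if Q \<omega> then exp ((1 + \<delta>) * v) else 0) + exp (- \<delta> * (1 + \<delta>) * v) * ?Y (1 + \<delta>) \<omega>)"
    by (rule integral_mono[OF int _ pointwise])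
       (intro Bochner_Integration.integrable_add integrable_mult_right int intQ)
  also have "\<dots> = exp (\<delta> * (1 - \<delta>) * v) * expectation (?Y (1 - \<delta>)) +
      expectation (\<lambda>\<omega>. if Q \<omega> then exp ((1 + \<delta>) * v) else 0) + exp (- \<delta> * (1 + \<delta>) * v) * expectation (?Y (1 + \<delta>))"
    by (subst Bochner_Integration.integral_add, intro Bochner_Integration.integrable_add integrable_mult_right int intQ,
        intro integrable_mult_right int, subst Bochner_Integration.integral_add, intro integrable_mult_right int, rule intQ, simp)
  also have "expectation (\<lambda>\<omega>. if Q \<omega> then exp ((1 + \<delta>) * v) else 0) = exp ((1 + \<delta>) * v) * pQ"
    unfolding pQ_def by (rule expectation_if_determined[OF detQ])
  also have "exp (\<delta> * (1 - \<delta>) * v) * expectation (?Y (1 - \<delta>)) \<le> exp (\<delta> * (1 - \<delta>) * v) * (exp ((1 - \<delta>)\<^sup>2 * v / 2) * p)"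
    by (intro mult_left_mono upper) simp
  also have "\<dots> = exp ((1 - \<delta>\<^sup>2) * v / 2) * p"
    unfolding mult.assoc[symmetric] exp_add[symmetric]
    by (intro arg_cong[of _ _ "\<lambda>x. exp x * p"]) (simp add: power2_eq_square field_simps)
  also have "exp (- \<delta> * (1 + \<delta>) * v) * expectation (?Y (1 + \<delta>)) \<le> exp (- \<delta> * (1 + \<delta>) * v) * (exp ((1 + \<delta>)\<^sup>2 * v / 2) * p)"
    by (intro mult_left_mono upper) simp
  also have "\<dots> = exp ((1 - \<delta>\<^sup>2) * v / 2) * p"
    unfolding mult.assoc[symmetric] exp_add[symmetric]
    by (intro arg_cong[of _ _ "\<lambda>x. exp x * p"]) (simp add: power2_eq_square field_simps)
  finally have A: "exp ((1 - \<delta>\<^sup>2 / 2) * v / 2) * (1 / 2) * p \<le> 2 * exp ((1 - \<delta>\<^sup>2) * v / 2) * p + exp ((1 + \<delta>) * v) * pQ"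
    using lower by linarith
  have B: "8 * exp ((1 - \<delta>\<^sup>2) * v / 2) \<le> exp ((1 - \<delta>\<^sup>2 / 2) * v / 2)"
  proof -
    have "8 * exp ((1 - \<delta>\<^sup>2) * v / 2) = exp (ln 8 + (1 - \<delta>\<^sup>2) * v / 2)" by (simp add: exp_add)
    also have "\<dots> \<le> exp ((1 - \<delta>\<^sup>2 / 2) * v / 2)" using v_large by (simp add: field_simps)
    finally show ?thesis .
  qed
  have "1 / 4 * exp ((1 - \<delta>\<^sup>2 / 2) * v / 2) * p \<le> exp ((1 + \<delta>) * v) * pQ"
    using mult_right_mono[OF B p0] A by simp
  then have C: "exp (- (1 + \<delta>) * v) * (1 / 4 * exp ((1 - \<delta>\<^sup>2 / 2) * v / 2) * p) \<le> exp (- (1 + \<delta>) * v) * (exp ((1 + \<delta>) * v) * pQ)"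
    by (intro mult_left_mono) auto
  have "exp (- (1 + 3 * \<delta>) * v / 2) \<le> exp (- (1 + \<delta>) * v) * exp ((1 - \<delta>\<^sup>2 / 2) * v / 2)"
  proof -
    have "\<delta>\<^sup>2 * v \<le> \<delta> * v" using \<delta> v0 by (intro mult_right_mono) (auto simp: power2_eq_square)
    moreover have "0 \<le> \<delta> * v" using \<delta> v0 by simp
    ultimately show ?thesis unfolding exp_add[symmetric] by (simp add: field_simps)
  qed
  note D = mult_right_mono[OF this p0]
  have "exp (- (1 + \<delta>) * v) * exp ((1 + \<delta>) * v) = 1"
    unfolding exp_add[symmetric] by (simp add: algebra_simps)
  then have "exp (- (1 + \<delta>) * v) * (exp ((1 + \<delta>) * v) * pQ) = pQ"
    unfolding mult.assoc[symmetric] by simp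
  moreover have "exp (- (1 + \<delta>) * v) * (1 / 4 * exp ((1 - \<delta>\<^sup>2 / 2) * v / 2) * p) =
      1 / 4 * (exp (- (1 + \<delta>) * v) * exp ((1 - \<delta>\<^sup>2 / 2) * v / 2) * p)" by (simp only: mult_ac)
  ultimately have "1 / 4 * exp (- (1 + 3 * \<delta>) * v / 2) * p \<le> pQ"
    using C D by linarith
  then show ?thesis by (simp add: p_def pQ_def Q_def)
qed

text \<open>
  If, given the past at time \<open>t k\<close>, the event \<open>G k\<close> has probability at least \<open>h k\<close> on \<open>C k\<close>,
  then the probability that \<open>C k\<close> holds and \<open>G k\<close> fails for all \<open>k\<close> in a range is at most
  the product of the factors \<open>1 - h k\<close>, which vanishes in the limit when the series
  diverges.
\<close>

lemma conditional_borel_cantelli: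
  fixes C G :: "nat \<Rightarrow> 'a \<Rightarrow> bool"
  assumes "mono t" and C: "\<And>k. determined D (t k) (C k)" and G: "\<And>k. determined D (t (Suc k)) (G k)"
    and h: "\<And>k. 0 \<le> h k" "\<not> summable h"
    and cond: "\<And>k P. k \<ge> k0 \<Longrightarrow> determined D (t k) P \<Longrightarrow>
      h k * prob {\<omega> \<in> space M. P \<omega> \<and> C k \<omega>} \<le> prob {\<omega> \<in> space M. (P \<omega> \<and> C k \<omega>) \<and> G k \<omega>}"
  shows "AE \<omega> in M. eventually (\<lambda>k. C k \<omega>) sequentially \<longrightarrow> frequently (\<lambda>k. G k \<omega>) sequentially"
proof -
  define U where "U K n \<omega> \<longleftrightarrow> (\<forall>k\<in>{K..<n}. C k \<omega> \<and> \<not> G k \<omega>)" for K n \<omega>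
  have detU: "determined D (t n) (U K n)" for K n
  proof -
    have "determined D (t n) (\<lambda>\<omega>. C k \<omega> \<and> \<not> G k \<omega>)" if "k \<in> {K..<n}" for k
      using that monoD[OF \<open>mono t\<close>, of k n] monoD[OF \<open>mono t\<close>, of "Suc k" n]
      by (intro determined_comp2[OF determined_mono[OF C] determined_mono[OF G], where f = "\<lambda>x y. x \<and> \<not> y"]) auto
    then show ?thesis unfolding U_def by (rule determined_ball)
  qed
  have setsU: "{\<omega> \<in> space M. U K n \<omega>} \<in> events" for K n by (rule determined_sets[OF detU])
  have bound: "prob {\<omega> \<in> space M. U K n \<omega>} \<le> exp (- (\<Sum>k\<in>{K..<n}. h k))" if "k0 \<le> K" "K \<le> n" for K n
    using that(2)
  proof (induction n rule: dec_induct)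
    case base
    show ?case by (simp add: U_def prob_space)
  next
    case (step n)
    let ?A = "{\<omega> \<in> space M. U K n \<omega> \<and> C n \<omega>}" and ?B = "{\<omega> \<in> space M. (U K n \<omega> \<and> C n \<omega>) \<and> G n \<omega>}"
    have detUC: "determined D (t n) (\<lambda>\<omega>. U K n \<omega> \<and> C n \<omega>)" by (rule determined_comp2[OF detU C])
    have sA: "?A \<in> events" by (rule determined_sets[OF detUC])
    have sB: "?B \<in> events"
      using monoD[OF \<open>mono t\<close>, of n "Suc n"]
      by (intro determined_sets[of "t (Suc n)"] determined_comp2[OF determined_mono[OF detUC] G]) auto
    have "{\<omega> \<in> space M. U K (Suc n) \<omega>} = ?A - ?B"
      using step(1) by (auto simp: U_def less_Suc_eq)
    also have "prob (?A - ?B) = prob ?A - prob ?B" by (intro finite_measure_Diff sA sB) auto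
    also have "\<dots> \<le> (1 - h n) * prob ?A" using cond[OF _ detU, of n K] step(1) that(1) by (simp add: algebra_simps)
    also have "\<dots> \<le> exp (- h n) * prob ?A" using exp_ge_add_one_self[of "- h n"] by (intro mult_right_mono) auto
    also have "\<dots> \<le> exp (- h n) * prob {\<omega> \<in> space M. U K n \<omega>}"
      by (intro mult_left_mono finite_measure_mono setsU) auto
    also have "\<dots> \<le> exp (- h n) * exp (- (\<Sum>k\<in>{K..<n}. h k))" by (intro mult_left_mono step.IH) auto
    also have "\<dots> = exp (- (\<Sum>k\<in>{K..<Suc n}. h k))" using step(1) by (simp flip: exp_add)
    finally show ?case .
  qed
  have "AE \<omega> in M. \<not> (\<forall>k\<ge>K. C k \<omega> \<and> \<not> G k \<omega>)" if "k0 \<le> K" for K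
  proof -
    have sets: "{\<omega> \<in> space M. \<forall>k\<ge>K. C k \<omega> \<and> \<not> G k \<omega>} \<in> events"
    proof -
      have "{\<omega> \<in> space M. \<forall>k\<ge>K. C k \<omega> \<and> \<not> G k \<omega>} = {\<omega> \<in> space M. \<forall>n. U K n \<omega>}"
      proof -
        have "(\<forall>k\<ge>K. R k) \<longleftrightarrow> (\<forall>n. \<forall>k\<in>{K..<n}. R k)" for R :: "nat \<Rightarrow> bool"
        proof -
          have "R k" if "\<forall>n. \<forall>k\<in>{K..<n}. R k" "K \<le> k" for k
            using spec[OF that(1), of "Suc k"] that(2) by simp
          then show ?thesis by auto
        qed
        then show ?thesis unfolding U_def by simp
      qed
      then show ?thesis using sets.sets_Collect_countable_All[of M "U K"] setsU by simp
    qed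
    have "prob {\<omega> \<in> space M. \<forall>k\<ge>K. C k \<omega> \<and> \<not> G k \<omega>} \<le> e" if "0 < e" for e
    proof -
      have "\<exists>n\<ge>K. - ln e \<le> (\<Sum>k\<in>{K..<n}. h k)"
      proof (rule ccontr)
        assume "\<not> ?thesis"
        then have b: "(\<Sum>k\<in>{K..<n}. h k) \<le> - ln e" if "K \<le> n" for n
          using that by (metis nle_le)
        have "summable h"
        proof (rule bounded_imp_summable[OF h(1)])
          fix n
          have "(\<Sum>k\<le>n. h k) \<le> (\<Sum>k\<in>{..<K} \<union> {K..<Suc n + K}. h k)" using h(1) by (intro sum_mono2) auto
          also have "\<dots> = (\<Sum>k<K. h k) + (\<Sum>k\<in>{K..<Suc n + K}. h k)" by (intro sum.union_disjoint) auto
          also have "\<dots> \<le> (\<Sum>k<K. h k) - ln e" using b[of "Suc n + K"] by simp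
          finally show "(\<Sum>k\<le>n. h k) \<le> (\<Sum>k<K. h k) - ln e" .
        qed
        with h(2) show False by contradiction
      qed
      then obtain n where n: "K \<le> n" "- ln e \<le> (\<Sum>k\<in>{K..<n}. h k)" by blast
      have "prob {\<omega> \<in> space M. \<forall>k\<ge>K. C k \<omega> \<and> \<not> G k \<omega>} \<le> prob {\<omega> \<in> space M. U K n \<omega>}"
        by (intro finite_measure_mono setsU) (auto simp: U_def)
      also have "\<dots> \<le> exp (- (\<Sum>k\<in>{K..<n}. h k))" by (rule bound[OF \<open>k0 \<le> K\<close> n(1)])
      also have "\<dots> \<le> exp (ln e)" using n(2) by (subst exp_le_cancel_iff) linarith
      also have "\<dots> = e" using that by simp
      finally show ?thesis .
    qed
    then have "prob {\<omega> \<in> space M. \<forall>k\<ge>K. C k \<omega> \<and> \<not> G k \<omega>} = 0"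
      using measure_nonneg[of M "{\<omega> \<in> space M. \<forall>k\<ge>K. C k \<omega> \<and> \<not> G k \<omega>}"]
      by (intro order_antisym[OF field_le_epsilon]) simp_all
    then have null: "emeasure M {\<omega> \<in> space M. \<forall>k\<ge>K. C k \<omega> \<and> \<not> G k \<omega>} = 0"
      by (simp only: emeasure_eq_measure ennreal_0)
    show ?thesis by (rule AE_I[OF _ null sets]) blast
  qed
  then have "AE \<omega> in M. \<forall>K\<in>{k0..}. \<not> (\<forall>k\<ge>K. C k \<omega> \<and> \<not> G k \<omega>)"
    by (subst AE_ball_countable) auto
  then show ?thesis
  proof eventually_elim
    case (elim \<omega>)
    show ?case
    proof (rule impI, rule ccontr)
      assume "eventually (\<lambda>k. C k \<omega>) sequentially" "\<not> frequently (\<lambda>k. G k \<omega>) sequentially"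
      then have "eventually (\<lambda>k. C k \<omega> \<and> \<not> G k \<omega>) sequentially"
        unfolding not_frequently by (rule eventually_conj)
      then obtain K where "\<forall>k\<ge>K. C k \<omega> \<and> \<not> G k \<omega>" unfolding eventually_sequentially by blast
      then have "\<forall>k\<ge>max K k0. C k \<omega> \<and> \<not> G k \<omega>" by simp
      then show False using bspec[OF elim, of "max K k0"] by simp
    qed
  qed
qed

section \<open>The law of the iterated logarithm\<close>

text \<open>
  The martingale is controlled up to time \<open>q ^ Suc k\<close> by one application of
  \<open>mart_upper_tail\<close> with \<open>a = q ln k\<close>, whose failure probabilities \<open>k powr - q\<close> are
  summable. For \<open>n\<close> between \<open>q ^ k\<close> and \<open>q ^ Suc k\<close> the bound exceeds the one with constant
  \<open>1 / sqrt 12\<close> asymptotically by a power of \<open>q\<close> only.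
\<close>

lemma mart_eventually_le:
  assumes s: "\<bar>s\<bar> = 1" and r: "1 / sqrt 12 < r"
  shows "AE \<omega> in M. eventually (\<lambda>n. s * mart n \<omega> \<le> r * lil_scale n) sequentially"
proof -
  have "0 < 1 / sqrt (12::real)" by simp
  with r have r0: "0 < r" by linarith
  have "(1 / sqrt 12)\<^sup>2 < r\<^sup>2" using r by (intro power_strict_mono) auto
  then have r12: "1 < 12 * r\<^sup>2" by (simp add: power_divide)
  (* six factors q are lost: three from the block length, one from the Borel-Cantelli exponent,
     one from replacing ln k by ln (ln n), and one from the asymptotics of qv *)
  define q where "q = root 6 (12 * r\<^sup>2)"
  have q: "1 < q" "q ^ 6 = 12 * r\<^sup>2" using r12 by (auto simp: q_def)
  define N where "N k = nat \<lfloor>q ^ Suc k\<rfloor>" for k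
  define a where "a k = q * ln (real k)" for k
  define E where "E k = {\<omega> \<in> space M. \<exists>j\<in>{1..N k}. sqrt (2 * a k * qv (N k)) \<le> s * mart j \<omega>}" for k
  have sets: "E k \<in> events" for k
    unfolding E_def
    by (rule determined_sets[of "N k"], intro determined_bex
        determined_comp[OF determined_mart, where f = "\<lambda>m. sqrt (2 * a k * qv (N k)) \<le> s * m"]) auto
  have "eventually (\<lambda>k. norm (prob (E k)) \<le> real k powr (- q)) sequentially"
    using eventually_ge_at_top[of 2]
  proof eventually_elim
    case (elim k)
    have "1 \<le> q ^ Suc k" using q(1) by (intro one_le_power) simp
    then have "1 \<le> N k" unfolding N_def by (intro le_nat_floor) simp
    moreover have "0 < a k" using elim q(1) by (simp add: a_def)
    ultimately have "prob (E k) \<le> exp (- a k)" unfolding E_def by (rule mart_upper_tail[OF _ _ s])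
    moreover have "exp (- a k) = real k powr (- q)" using elim by (simp add: a_def powr_def)
    ultimately show ?case by simp
  qed
  then have "summable (\<lambda>k. prob (E k))"
    by (rule summable_comparison_test_ev) (use q(1) in \<open>simp add: summable_real_powr_iff\<close>)
  then have "AE \<omega> in M. eventually (\<lambda>k. \<omega> \<in> space M - E k) sequentially"
    by (intro borel_cantelli_AE1 sets) (simp_all add: emeasure_eq_measure)
  then show ?thesis
  proof eventually_elim
    case (elim \<omega>)
    then obtain K where K: "\<And>k. k \<ge> K \<Longrightarrow> \<omega> \<in> space M - E k" unfolding eventually_sequentially by blast
    obtain n0 where n0: "\<And>n. n \<ge> n0 \<Longrightarrow> qv n \<le> q * real n ^ 3 / 12"
      using qv_eventually_le[OF q(1)] unfolding eventually_sequentially by blast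
    have LL: "eventually (\<lambda>n. ln (ln (real n) / ln q) \<le> q * ln (ln (real n))) sequentially"
      using q(1) by real_asymp
    have LL0: "eventually (\<lambda>n. 0 < ln (ln (real n))) sequentially"
      using loglog_at_top by (simp add: filterlim_at_top_dense)
    have "eventually (\<lambda>n. q ^ max K 2 \<le> real n) sequentially"
      using filterlim_real_sequentially by (simp add: filterlim_at_top)
    then show ?case using LL LL0 eventually_ge_at_top[of "max n0 1"]
    proof eventually_elim
      case (elim n)
      have n1: "1 \<le> n" "n0 \<le> n" using elim by auto
      define k where "k = nat \<lfloor>log q (real n)\<rfloor>"
      have lq: "0 < ln q" using q(1) by simp
      have "q powr real (max K 2) \<le> real n" using elim(1) q(1) by (subst powr_realpow) auto
      then have "real (max K 2) \<le> log q (real n)" using q(1) n1 by (subst le_log_iff) auto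
      then have "max K 2 \<le> k" unfolding k_def by (rule le_nat_floor)
      then have kK: "K \<le> k" "2 \<le> k" by auto
      have l0: "0 \<le> log q (real n)" using q(1) n1 by simp
      have k1: "real k \<le> log q (real n)" unfolding k_def using l0 by simp
      have k2: "log q (real n) < real (Suc k)" unfolding k_def using l0 by (simp, linarith)
      have "q powr real k \<le> real n" using k1 q(1) n1 by (subst (asm) le_log_iff) auto
      then have qk: "q ^ k \<le> real n" using q(1) by (subst (asm) powr_realpow) auto
      have "real n < q powr real (Suc k)" using k2 q(1) n1 by (subst (asm) log_less_iff) auto
      then have nq: "real n \<le> q ^ Suc k" using q(1) by (subst (asm) powr_realpow) auto
      have nN: "n \<le> N k" unfolding N_def by (rule le_nat_floor[OF nq])
      have "real (N k) \<le> q ^ Suc k" unfolding N_def using q(1) by (simp add: of_nat_floor)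
      also have "\<dots> \<le> q * real n" using qk q(1) by simp
      finally have Nq: "real (N k) \<le> q * real n" .
      have "ln (real k) \<le> ln (ln (real n) / ln q)"
        using k1 kK by (simp add: log_def)
      also have "\<dots> \<le> q * ln (ln (real n))" by (rule elim)
      finally have lnk: "ln (real k) \<le> q * ln (ln (real n))" .
      have "qv (N k) \<le> q * real (N k) ^ 3 / 12" using n0 nN n1 by simp
      also have "\<dots> \<le> q * (q * real n) ^ 3 / 12"
        using Nq q(1) by (intro divide_right_mono mult_left_mono power_mono) auto
      finally have qvN: "qv (N k) \<le> q * (q * real n) ^ 3 / 12" .
      have "2 * a k * qv (N k) \<le> 2 * (q * (q * ln (ln (real n)))) * (q * (q * real n) ^ 3 / 12)"
        using lnk qvN q(1) elim(3) kK unfolding a_def by (intro mult_mono qv_nonneg) auto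
      also have "\<dots> = q ^ 6 * (real n ^ 3 * ln (ln (real n)) / 6)"
        by (simp add: power_mult_distrib eval_nat_numeral)
      also have "\<dots> = r\<^sup>2 * (2 * real n ^ 3 * ln (ln (real n)))" unfolding q(2) by simp
      finally have "sqrt (2 * a k * qv (N k)) \<le> sqrt (r\<^sup>2 * (2 * real n ^ 3 * ln (ln (real n))))" by simp
      also have "\<dots> = r * lil_scale n" unfolding lil_scale_def real_sqrt_mult[of "r\<^sup>2"] using r0 by simp
      finally have "sqrt (2 * a k * qv (N k)) \<le> r * lil_scale n" .
      moreover have "s * mart n \<omega> < sqrt (2 * a k * qv (N k))"
        using K[OF kK(1)] nN n1 unfolding E_def by (auto simp: not_le)
      ultimately show ?case by linarith
    qed
  qed
qed

lemma abs_mart_eventually_le: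
  assumes r: "1 / sqrt 12 < r"
  shows "AE \<omega> in M. eventually (\<lambda>n. \<bar>mart n \<omega>\<bar> \<le> r * lil_scale n) sequentially"
proof -
  have "AE \<omega> in M. eventually (\<lambda>n. 1 * mart n \<omega> \<le> r * lil_scale n) sequentially"
    "AE \<omega> in M. eventually (\<lambda>n. - 1 * mart n \<omega> \<le> r * lil_scale n) sequentially"
    by (intro mart_eventually_le r; simp)+
  then show ?thesis
  proof eventually_elim
    case (elim \<omega>)
    from elim show ?case by eventually_elim simp
  qed
qed

text \<open>
  On the blocks from \<open>Q ^ k\<close> to \<open>Q ^ Suc k\<close> the tilt \<open>l k\<close> is chosen such that
  \<open>mart_lower_tail\<close> gives the conditional probability \<open>1 / (4 k)\<close> for an increment
  \<open>(1 - \<delta>) sqrt (v k * V k)\<close>. The ratio of this increment to the scale at the end of the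
  block, diminished by the bound for the value at the start of the block, tends to the
  constant in \<open>block_constant_tendsto\<close>.
\<close>

lemma mart_frequently_ge:
  assumes s: "\<bar>s\<bar> = 1" and r: "r < 1 / sqrt 12"
  shows "AE \<omega> in M. frequently (\<lambda>n. r * lil_scale n \<le> s * mart n \<omega>) sequentially"
proof -
  have "eventually (\<lambda>m. r < (1 - 1 / real m) * sqrt ((1 - 1 / real m ^ 3) / (12 * (1 + 3 * (1 / real m)))) - sqrt (1 / real m ^ 3)) sequentially"
    by (rule order_tendstoD(1)[OF block_constant_tendsto r])
  then have "eventually (\<lambda>m. 2 \<le> m \<and> r < (1 - 1 / real m) * sqrt ((1 - 1 / real m ^ 3) / (12 * (1 + 3 * (1 / real m)))) - sqrt (1 / real m ^ 3)) sequentially"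
    using eventually_ge_at_top[of 2] by eventually_elim simp
  from eventually_happens'[OF sequentially_bot this] obtain Q :: nat where Q: "2 \<le> Q"
    and rQ: "r < (1 - 1 / real Q) * sqrt ((1 - 1 / real Q ^ 3) / (12 * (1 + 3 * (1 / real Q)))) - sqrt (1 / real Q ^ 3)"
    by blast
  define \<delta> where "\<delta> = 1 / real Q"
  have \<delta>: "0 < \<delta>" "\<delta> \<le> 1" using Q by (auto simp: \<delta>_def)
  define \<kappa> where "\<kappa> = \<delta>\<^sup>2 / 8"
  have \<kappa>0: "0 < \<kappa>" using \<delta> by (simp add: \<kappa>_def)
  define t where "t k = Q ^ k" for k
  define V where "V k = qv (t (Suc k)) - qv (t k)" for k
  (* then (1 + 3 delta) v / 2 = ln k, so that the tail bound becomes 1 / (4 k) *)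
  define v where "v k = 2 * ln (real k) / (1 + 3 * \<delta>)" for k
  define l where "l k = s * sqrt (v k / V k)" for k
  define C where "C k \<omega> \<longleftrightarrow> \<bar>mart (t k) \<omega>\<bar> \<le> \<kappa> / 2 * (real (t k))\<^sup>2" for k \<omega>
  define G where "G k \<omega> \<longleftrightarrow> (1 - \<delta>) * v k \<le> l k * (mart (t (Suc k)) \<omega> - mart (t k) \<omega>)" for k \<omega>
  define h where "h k = 1 / 4 * inverse (real k)" for k
  have t_top: "filterlim t at_top sequentially"
    unfolding t_def using Q by (intro filterlim_subseq strict_monoI power_strict_increasing) auto
  have t_Suc_top: "filterlim (\<lambda>k. t (Suc k)) at_top sequentially"
    using t_top filterlim_sequentially_Suc by blast
  have t1: "1 \<le> t k" "t k \<le> t (Suc k)" for k using Q by (auto simp: t_def)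
  have mono_t: "mono t" by (rule incseq_SucI) (rule t1(2))
  have V_lim: "(\<lambda>k. V k / real (t (Suc k)) ^ 3) \<longlonglongrightarrow> (1 - 1 / real Q ^ 3) / 12"
  proof -
    have "(\<lambda>k. qv (t (Suc k)) / real (t (Suc k)) ^ 3 - 1 / real Q ^ 3 * (qv (t k) / real (t k) ^ 3))
      \<longlonglongrightarrow> 1 / 12 - 1 / real Q ^ 3 * (1 / 12)"
      by (intro tendsto_diff tendsto_mult tendsto_const filterlim_compose[OF qv_asymp t_Suc_top]
          filterlim_compose[OF qv_asymp t_top])
    moreover have "qv (t (Suc k)) / real (t (Suc k)) ^ 3 - 1 / real Q ^ 3 * (qv (t k) / real (t k) ^ 3) = V k / real (t (Suc k)) ^ 3" for k
      by (simp add: V_def t_def diff_divide_distrib power_mult_distrib)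
    ultimately show ?thesis by (simp add: diff_divide_distrib)
  qed
  have Q3: "1 / real Q ^ 3 < 1" using Q by simp
  have V_pos: "0 < V k" for k
  proof -
    have "t k < t (Suc k)" using Q by (simp add: t_def)
    then have "qv (Suc (t k)) \<le> qv (t (Suc k))" by (intro qv_mono) simp
    moreover have "0 < (real (Suc (t k)))\<^sup>2 / 4" by simp
    ultimately show ?thesis unfolding V_def qv_Suc by linarith
  qed
  have s2: "s * s = 1" using s abs_mult_self_eq[of s] by simp
  have l2: "(l k)\<^sup>2 * V k = v k" if "2 \<le> k" for k
    using that V_pos[of k] \<delta> s2 by (simp add: l_def v_def power_mult_distrib power2_eq_square[of s])
  have v_top: "filterlim v at_top sequentially"
    unfolding v_def using \<delta> by real_asymp

  (* the hypotheses of the tail bound, all valid for large k *)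
  have ev_v: "eventually (\<lambda>k. 4 * ln 8 \<le> \<delta>\<^sup>2 * v k) sequentially"
  proof -
    have "eventually (\<lambda>k. 4 * ln 8 / \<delta>\<^sup>2 \<le> v k) sequentially"
      using v_top by (simp add: filterlim_at_top)
    then show ?thesis by eventually_elim (use \<delta> in \<open>simp add: field_simps\<close>)
  qed
  have ev_l: "eventually (\<lambda>k. \<bar>l k\<bar> * real (t (Suc k)) \<le> \<kappa> / 2) sequentially"
  proof -
    have "(\<lambda>k. ln (real k) / real Q ^ Suc k) \<longlonglongrightarrow> 0"
      using Q by real_asymp
    then have "(\<lambda>k. 2 / (1 + 3 * \<delta>) * (ln (real k) / real Q ^ Suc k)) \<longlonglongrightarrow> 2 / (1 + 3 * \<delta>) * 0"
      by (intro tendsto_mult tendsto_const)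
    then have "(\<lambda>k. v k / real (t (Suc k))) \<longlonglongrightarrow> 0" by (simp add: v_def t_def)
    then have "(\<lambda>k. sqrt (v k / real (t (Suc k)) / (V k / real (t (Suc k)) ^ 3))) \<longlonglongrightarrow> sqrt (0 / ((1 - 1 / real Q ^ 3) / 12))"
      using Q3 by (intro tendsto_intros V_lim) auto
    then have lim: "(\<lambda>k. sqrt (v k / real (t (Suc k)) / (V k / real (t (Suc k)) ^ 3))) \<longlonglongrightarrow> 0" by simp
    have "eventually (\<lambda>k. sqrt (v k / real (t (Suc k)) / (V k / real (t (Suc k)) ^ 3)) < \<kappa> / 2) sequentially"
      using order_tendstoD(2)[OF lim, of "\<kappa> / 2"] \<kappa>0 by simp
    then show ?thesis using eventually_ge_at_top[of 2]
    proof eventually_elim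
      case (elim k)
      have T: "0 < real (t (Suc k))" using t1[of "Suc k"] by simp
      have "\<bar>l k\<bar> * real (t (Suc k)) = sqrt (v k / V k) * sqrt ((real (t (Suc k)))\<^sup>2)"
        using s V_pos[of k] elim(2) \<delta> T by (simp add: l_def abs_mult v_def)
      also have "\<dots> = sqrt (v k / real (t (Suc k)) / (V k / real (t (Suc k)) ^ 3))"
        unfolding real_sqrt_mult[symmetric] using T by (simp add: power2_eq_square power3_eq_cube)
      finally show ?case using elim(1) by simp
    qed
  qed
  have ev_tail: "eventually (\<lambda>k. (\<Sum>i\<in>{t k..<t (Suc k)}. 2 * exp (- \<kappa>\<^sup>2 * real i / 8)) \<le> 1 / 2) sequentially"
  proof -
    have "summable (\<lambda>i. 2 * exp (- \<kappa>\<^sup>2 / 8) ^ i)"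
      using \<kappa>0 by (intro summable_mult summable_geometric) simp
    then have "summable (\<lambda>i. 2 * exp (- \<kappa>\<^sup>2 * real i / 8))"
      by (simp add: mult.commute flip: exp_of_nat_mult)
    then obtain n0 where n0: "\<And>m n. m \<ge> n0 \<Longrightarrow> norm (\<Sum>i\<in>{m..<n}. 2 * exp (- \<kappa>\<^sup>2 * real i / 8)) < 1 / 2"
      unfolding summable_Cauchy using half_gt_zero[OF zero_less_one] by blast
    have "eventually (\<lambda>k. n0 \<le> t k) sequentially" using t_top by (simp add: filterlim_at_top)
    then show ?thesis
    proof eventually_elim
      case (elim k)
      then show ?case using n0[of "t k" "t (Suc k)"] unfolding real_norm_def by linarith
    qed
  qed
  (* the bound on the start of the block, which makes C hold eventually *)
  have ev_small: "eventually (\<lambda>k. lil_scale (t k) \<le> \<kappa> / 2 * (real (t k))\<^sup>2) sequentially"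
  proof -
    have "eventually (\<lambda>k. lil_scale (t k) / (real (t k))\<^sup>2 < \<kappa> / 2) sequentially"
      using \<kappa>0 by (intro order_tendstoD(2)[OF filterlim_compose[OF lil_scale_small t_top]]) simp
    then show ?thesis
    proof eventually_elim
      case (elim k)
      then show ?case using t1[of k] by (simp add: divide_simps split: if_splits)
    qed
  qed
  have ev_scale: "eventually (\<lambda>k. r * lil_scale (t (Suc k)) \<le> (1 - \<delta>) * sqrt (v k * V k) - lil_scale (t k)) sequentially"
  proof -
    define L where "L k = ln (ln (real (t (Suc k))))" for k
    have Lpos: "eventually (\<lambda>k. 0 < L k) sequentially"
      unfolding L_def using filterlim_compose[OF loglog_at_top t_Suc_top] by (simp add: filterlim_at_top_dense)
    have "(\<lambda>k. ln (real k) / ln (real (Suc k) * ln (real Q))) \<longlonglongrightarrow> 1"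
      using Q by real_asymp
    then have "(\<lambda>k. ln (real k) / L k) \<longlonglongrightarrow> 1"
      using Q by (simp add: L_def t_def ln_mult ln_realpow del: power_Suc)
    then have "(\<lambda>k. (1 - \<delta>) * sqrt (1 / (1 + 3 * \<delta>) * (ln (real k) / L k) * (V k / real (t (Suc k)) ^ 3)) - sqrt (1 / real Q ^ 3))
      \<longlonglongrightarrow> (1 - \<delta>) * sqrt (1 / (1 + 3 * \<delta>) * 1 * ((1 - 1 / real Q ^ 3) / 12)) - sqrt (1 / real Q ^ 3)"
      by (intro tendsto_intros V_lim)
    moreover have "r < (1 - \<delta>) * sqrt (1 / (1 + 3 * \<delta>) * 1 * ((1 - 1 / real Q ^ 3) / 12)) - sqrt (1 / real Q ^ 3)"
      using rQ by (simp add: \<delta>_def mult.commute)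
    ultimately have "eventually (\<lambda>k. r < (1 - \<delta>) * sqrt (1 / (1 + 3 * \<delta>) * (ln (real k) / L k) * (V k / real (t (Suc k)) ^ 3)) - sqrt (1 / real Q ^ 3)) sequentially"
      by (rule order_tendstoD(1))
    then show ?thesis using Lpos eventually_ge_at_top[of 2]
    proof eventually_elim
      case (elim k)
      have T: "0 < real (t k)" "0 < real (t (Suc k))" using t1[of "Suc k"] t1[of k] by simp_all
      have S: "0 \<le> lil_scale (t (Suc k))" using elim(2) T unfolding lil_scale_def L_def by simp
      have "r * lil_scale (t (Suc k)) \<le> ((1 - \<delta>) * sqrt (1 / (1 + 3 * \<delta>) * (ln (real k) / L k) * (V k / real (t (Suc k)) ^ 3)) - sqrt (1 / real Q ^ 3)) * lil_scale (t (Suc k))"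
        using elim(1) S by (intro mult_right_mono) auto
      also have "\<dots> = (1 - \<delta>) * (sqrt (1 / (1 + 3 * \<delta>) * (ln (real k) / L k) * (V k / real (t (Suc k)) ^ 3)) * lil_scale (t (Suc k)))
         - sqrt (1 / real Q ^ 3) * lil_scale (t (Suc k))" by (simp add: left_diff_distrib)
      also have "sqrt (1 / (1 + 3 * \<delta>) * (ln (real k) / L k) * (V k / real (t (Suc k)) ^ 3)) * lil_scale (t (Suc k)) = sqrt (v k * V k)"
        unfolding lil_scale_def L_def[symmetric] real_sqrt_mult[symmetric] using T elim(2)
        by (simp add: v_def)
      finally have "r * lil_scale (t (Suc k)) \<le> (1 - \<delta>) * sqrt (v k * V k) - sqrt (1 / real Q ^ 3) * lil_scale (t (Suc k))" .
      moreover have "lil_scale (t k) \<le> sqrt (1 / real Q ^ 3) * lil_scale (t (Suc k))"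
      proof -
        have "ln (ln (real (t k))) \<le> L k"
        proof -
          have "1 < real (t k)" using Q elim(3) by (simp add: t_def)
          then show ?thesis unfolding L_def using t1[of k] by (subst ln_le_cancel_iff) auto
        qed
        then have "2 * real (t k) ^ 3 * ln (ln (real (t k))) \<le> 2 * real (t k) ^ 3 * L k"
          by (intro mult_left_mono) auto
        also have "\<dots> = 1 / real Q ^ 3 * (2 * real (t (Suc k)) ^ 3 * L k)"
          using Q by (simp add: t_def power_mult_distrib)
        finally show ?thesis unfolding lil_scale_def L_def[symmetric] real_sqrt_mult[symmetric] by simp
      qed
      ultimately show ?case by linarith
    qed
  qed

  obtain k0 where k0: "\<And>k. k \<ge> k0 \<Longrightarrow> 2 \<le> k \<and> 4 * ln 8 \<le> \<delta>\<^sup>2 * v k \<and> \<bar>l k\<bar> * real (t (Suc k)) \<le> \<kappa> / 2 \<and>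
      (\<Sum>i\<in>{t k..<t (Suc k)}. 2 * exp (- \<kappa>\<^sup>2 * real i / 8)) \<le> 1 / 2"
    using eventually_conj[OF eventually_ge_at_top[of 2] eventually_conj[OF ev_v eventually_conj[OF ev_l ev_tail]]]
    unfolding eventually_sequentially by blast
  have detC: "determined D (t k) (C k)" for k
    unfolding C_def by (rule determined_comp[OF determined_mart[OF order_refl], where f = "\<lambda>m. \<bar>m\<bar> \<le> \<kappa> / 2 * (real (t k))\<^sup>2"])
  have detG: "determined D (t (Suc k)) (G k)" for k
    unfolding G_def by (rule determined_comp[OF determined_mart_increment[OF order_refl t1(2)], where f = "\<lambda>y. (1 - \<delta>) * v k \<le> l k * y"])
  have "AE \<omega> in M. eventually (\<lambda>k. C k \<omega>) sequentially \<longrightarrow> frequently (\<lambda>k. G k \<omega>) sequentially"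
  proof (rule conditional_borel_cantelli[OF mono_t detC detG])
    show "0 \<le> h k" for k by (simp add: h_def)
    show "\<not> summable h"
      unfolding h_def summable_cmult_iff using not_summable_harmonic[where 'a = real] by simp
    fix k and P :: "'a \<Rightarrow> bool" assume k: "k \<ge> k0" and P: "determined D (t k) P"
    have vk: "v k = (l k)\<^sup>2 * (qv (t (Suc k)) - qv (t k))" using l2 k0[OF k] by (simp add: V_def)
    have "1 / 4 * exp (- (1 + 3 * \<delta>) * v k / 2) * prob {\<omega> \<in> space M. P \<omega> \<and> C k \<omega>}
      \<le> prob {\<omega> \<in> space M. (P \<omega> \<and> C k \<omega>) \<and> (1 - \<delta>) * v k \<le> l k * (mart (t (Suc k)) \<omega> - mart (t k) \<omega>)}"
    proof (rule mart_lower_tail[OF \<delta> \<kappa>_def t1(1) t1(2) determined_comp2[OF P detC]])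
      show "\<bar>mart (t k) \<omega>\<bar> \<le> \<kappa> / 2 * (real (t k))\<^sup>2" if "P \<omega> \<and> C k \<omega>" for \<omega>
        using that unfolding C_def by blast
    qed (use vk k0[OF k] in blast)+
    moreover have "1 / 4 * exp (- (1 + 3 * \<delta>) * v k / 2) = h k"
    proof -
      have "- (1 + 3 * \<delta>) * v k / 2 = - ln (real k)" using \<delta> by (simp add: v_def field_simps)
      then show ?thesis using k0[OF k] by (simp add: h_def exp_minus)
    qed
    ultimately show "h k * prob {\<omega> \<in> space M. P \<omega> \<and> C k \<omega>} \<le> prob {\<omega> \<in> space M. (P \<omega> \<and> C k \<omega>) \<and> G k \<omega>}"
      unfolding G_def by simp
  qed
  moreover have "1 / sqrt 12 < (1::real)" by simp
  note abs_mart_eventually_le[OF this]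
  ultimately show ?thesis
  proof eventually_elim
    case (elim \<omega>)
    have small: "eventually (\<lambda>k. \<bar>mart (t k) \<omega>\<bar> \<le> 1 * lil_scale (t k)) sequentially"
      using eventually_compose_filterlim[OF elim(2) t_top] .
    then have "eventually (\<lambda>k. C k \<omega>) sequentially"
      using ev_small by eventually_elim (simp add: C_def)
    with elim(1) have "frequently (\<lambda>k. G k \<omega>) sequentially" by blast
    then have "frequently (\<lambda>k. G k \<omega> \<and> (2 \<le> k \<and> \<bar>mart (t k) \<omega>\<bar> \<le> 1 * lil_scale (t k) \<and>
        r * lil_scale (t (Suc k)) \<le> (1 - \<delta>) * sqrt (v k * V k) - lil_scale (t k))) sequentially"
      by (rule frequently_eventually_frequently) (intro eventually_conj eventually_ge_at_top small ev_scale)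
    then have "frequently (\<lambda>k. r * lil_scale (t (Suc k)) \<le> s * mart (t (Suc k)) \<omega>) sequentially"
    proof (rule frequently_elim1)
      fix k assume k: "G k \<omega> \<and> (2 \<le> k \<and> \<bar>mart (t k) \<omega>\<bar> \<le> 1 * lil_scale (t k) \<and>
        r * lil_scale (t (Suc k)) \<le> (1 - \<delta>) * sqrt (v k * V k) - lil_scale (t k))"
      define \<Delta> where "\<Delta> = mart (t (Suc k)) \<omega> - mart (t k) \<omega>"
      have vk: "0 < v k" using k \<delta> by (simp add: v_def)
      have "(1 - \<delta>) * v k \<le> l k * \<Delta>" using k by (simp add: G_def \<Delta>_def)
      then have "sqrt (V k / v k) * ((1 - \<delta>) * v k) \<le> sqrt (V k / v k) * (l k * \<Delta>)"
        using vk V_pos[of k] by (intro mult_left_mono) auto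
      moreover have "sqrt (V k / v k) * (l k * \<Delta>) = s * \<Delta>"
      proof -
        have "sqrt (V k / v k) * sqrt (v k / V k) = 1"
          unfolding real_sqrt_mult[symmetric] using vk V_pos[of k] by simp
        moreover have "sqrt (V k / v k) * (l k * \<Delta>) = (sqrt (V k / v k) * sqrt (v k / V k)) * (s * \<Delta>)"
          unfolding l_def by (simp only: mult_ac)
        ultimately show ?thesis by simp
      qed
      moreover have "sqrt (V k / v k) * ((1 - \<delta>) * v k) = (1 - \<delta>) * sqrt (v k * V k)"
      proof -
        have "sqrt (V k / v k) * v k = sqrt (V k / v k) * sqrt (v k * v k)" using vk by simp
        also have "\<dots> = sqrt (v k * V k)" unfolding real_sqrt_mult[symmetric] using vk by simp
        finally have "(1 - \<delta>) * (sqrt (V k / v k) * v k) = (1 - \<delta>) * sqrt (v k * V k)" by simp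
        then show ?thesis by (simp only: mult_ac)
      qed
      ultimately have "(1 - \<delta>) * sqrt (v k * V k) \<le> s * \<Delta>" by simp
      moreover have "s * mart (t (Suc k)) \<omega> = s * \<Delta> + s * mart (t k) \<omega>" by (simp add: \<Delta>_def algebra_simps)
      moreover have "- \<bar>mart (t k) \<omega>\<bar> \<le> s * mart (t k) \<omega>"
        using abs_ge_minus_self[of "s * mart (t k) \<omega>"] s by (simp add: abs_mult)
      ultimately show "r * lil_scale (t (Suc k)) \<le> s * mart (t (Suc k)) \<omega>" using k by linarith
    qed
    then show ?case
      unfolding frequently_def using eventually_compose_filterlim[OF _ t_Suc_top] by blast
  qed
qed

definition lil_ratio :: "nat \<Rightarrow> 'a \<Rightarrow> real" where
  "lil_ratio n \<omega> = sqrt (real n / (2 * ln (ln (real n)))) * (real (D n \<omega>) / real n - 1 / 2)"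

lemma lil_ratio_eq:
  assumes "0 < ln (ln (real n))" "1 \<le> n"
  shows "lil_ratio n \<omega> = mart n \<omega> / lil_scale n - sqrt (real n / (2 * ln (ln (real n)))) / (2 * real n)"
proof -
  have "real (D n \<omega>) / real n - 1 / 2 = mart n \<omega> / (real n)\<^sup>2 - 1 / (2 * real n)"
    using assms(2) by (simp add: mart_def power2_eq_square field_simps)
  then have "lil_ratio n \<omega> = mart n \<omega> * (sqrt (real n / (2 * ln (ln (real n)))) / (real n)\<^sup>2)
      - sqrt (real n / (2 * ln (ln (real n)))) / (2 * real n)"
    by (simp add: lil_ratio_def right_diff_distrib)
  then show ?thesis unfolding lil_normalisation[OF assms] by simp
qed

text \<open>
  Replacing \<open>mart\<close> by \<open>n\<^sup>2 (D\<^sub>n / n - 1 / 2)\<close> changes the ratio by a null sequence.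
  Exceptional sets are needed only for the countably many levels at distance \<open>1 / (j + 1)\<close>
  from the limit.
\<close>

lemma lil_ratio_bounds:
  assumes s: "\<bar>s\<bar> = 1"
  shows "AE \<omega> in M. (\<forall>r > 1 / sqrt 12. eventually (\<lambda>n. s * lil_ratio n \<omega> \<le> r) sequentially) \<and>
    (\<forall>r < 1 / sqrt 12. frequently (\<lambda>n. r \<le> s * lil_ratio n \<omega>) sequentially)"
proof -
  define c where "c = 1 / sqrt (12::real)"
  have "AE \<omega> in M. \<forall>j. eventually (\<lambda>n. s * mart n \<omega> \<le> (c + inverse (real (Suc j))) * lil_scale n) sequentially"
    unfolding AE_all_countable by (intro allI mart_eventually_le[OF s]) (simp add: c_def)
  moreover have "AE \<omega> in M. \<forall>j. frequently (\<lambda>n. (c - inverse (real (Suc j))) * lil_scale n \<le> s * mart n \<omega>) sequentially"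
    unfolding AE_all_countable by (intro allI mart_frequently_ge[OF s]) (simp add: c_def)
  ultimately show ?thesis unfolding c_def[symmetric]
  proof eventually_elim
    case (elim \<omega>)
    have LL: "eventually (\<lambda>n. 0 < ln (ln (real n)) \<and> 1 \<le> n) sequentially"
      using loglog_at_top by (intro eventually_conj eventually_ge_at_top) (simp add: filterlim_at_top_dense)
    have corr: "(\<lambda>n. sqrt (real n / (2 * ln (ln (real n)))) / (2 * real n)) \<longlonglongrightarrow> 0" by real_asymp
    have close: "eventually (\<lambda>n. \<bar>s * lil_ratio n \<omega> - s * mart n \<omega> / lil_scale n\<bar> < e \<and> 0 < lil_scale n) sequentially"
      if "0 < e" for e
      using tendstoD[OF corr that] LL
    proof eventually_elim
      case (elim n)
      have "s * lil_ratio n \<omega> - s * mart n \<omega> / lil_scale n = - (s * (sqrt (real n / (2 * ln (ln (real n)))) / (2 * real n)))"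
        using elim(2) by (simp add: lil_ratio_eq right_diff_distrib)
      then have "\<bar>s * lil_ratio n \<omega> - s * mart n \<omega> / lil_scale n\<bar> = \<bar>sqrt (real n / (2 * ln (ln (real n)))) / (2 * real n)\<bar>"
        using s by (simp only: abs_minus_cancel abs_mult mult_1)
      then show ?case using elim unfolding dist_real_def lil_scale_def by simp
    qed
    show ?case
    proof (intro conjI allI impI)
      fix r assume "c < r"
      then obtain j where j: "inverse (real (Suc j)) < r - c" using reals_Archimedean[of "r - c"] by auto
      define e where "e = r - c - inverse (real (Suc j))"
      have "0 < e" using j by (simp add: e_def)
      show "eventually (\<lambda>n. s * lil_ratio n \<omega> \<le> r) sequentially"
        using close[OF \<open>0 < e\<close>] elim(1)[rule_format, of j]
      proof eventually_elim
        case (elim n)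
        then have "s * mart n \<omega> / lil_scale n \<le> c + inverse (real (Suc j))"
          by (subst pos_divide_le_eq) auto
        then show ?case using elim(1) unfolding e_def by linarith
      qed
    next
      fix r assume "r < c"
      then obtain j where j: "inverse (real (Suc j)) < c - r" using reals_Archimedean[of "c - r"] by auto
      define e where "e = c - r - inverse (real (Suc j))"
      have "0 < e" using j by (simp add: e_def)
      have "frequently (\<lambda>n. (c - inverse (real (Suc j))) * lil_scale n \<le> s * mart n \<omega> \<and>
          (\<bar>s * lil_ratio n \<omega> - s * mart n \<omega> / lil_scale n\<bar> < e \<and> 0 < lil_scale n)) sequentially"
        by (rule frequently_eventually_frequently[OF elim(2)[rule_format, of j] close[OF \<open>0 < e\<close>]])
      then show "frequently (\<lambda>n. r \<le> s * lil_ratio n \<omega>) sequentially"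
      proof (rule frequently_elim1)
        fix n assume n: "(c - inverse (real (Suc j))) * lil_scale n \<le> s * mart n \<omega> \<and>
          (\<bar>s * lil_ratio n \<omega> - s * mart n \<omega> / lil_scale n\<bar> < e \<and> 0 < lil_scale n)"
        then have "c - inverse (real (Suc j)) \<le> s * mart n \<omega> / lil_scale n"
          by (subst pos_le_divide_eq) auto
        then show "r \<le> s * lil_ratio n \<omega>" using n unfolding e_def by linarith
      qed
    qed
  qed
qed

lemma iterated_logarithm:
  "AE \<omega> in M. limsup (\<lambda>n. ereal (lil_ratio n \<omega>)) = ereal (1 / sqrt 12) \<and>
    - liminf (\<lambda>n. ereal (lil_ratio n \<omega>)) = ereal (1 / sqrt 12) \<and>
    limsup (\<lambda>n. ereal (real n / (2 * ln (ln (real n))) * (real (D n \<omega>) / real n - 1 / 2)\<^sup>2)) = ereal (1 / 12)"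
proof -
  have "\<bar>1 :: real\<bar> = 1" "\<bar>- 1 :: real\<bar> = 1" by simp_all
  from lil_ratio_bounds[OF this(1)] lil_ratio_bounds[OF this(2)] show ?thesis
  proof eventually_elim
    case (elim \<omega>)
    let ?c = "1 / sqrt 12 :: real"
    have up: "eventually (\<lambda>n. lil_ratio n \<omega> \<le> r) sequentially" "eventually (\<lambda>n. - lil_ratio n \<omega> \<le> r) sequentially"
      if "?c < r" for r using that elim by simp_all
    have lo: "frequently (\<lambda>n. r \<le> lil_ratio n \<omega>) sequentially" "frequently (\<lambda>n. r \<le> - lil_ratio n \<omega>) sequentially"
      if "r < ?c" for r using that elim by simp_all
    have "limsup (\<lambda>n. ereal (- lil_ratio n \<omega>)) = ereal ?c"
      by (rule limsup_ereal_eqI) (rule up(2) lo(2); assumption)+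
    moreover have "limsup (\<lambda>n. ereal (- lil_ratio n \<omega>)) = - liminf (\<lambda>n. ereal (lil_ratio n \<omega>))"
      unfolding ereal_Limsup_uminus[symmetric] by simp
    moreover have "limsup (\<lambda>n. ereal (lil_ratio n \<omega>)) = ereal ?c"
      by (rule limsup_ereal_eqI) (rule up(1) lo(1); assumption)+
    moreover have "limsup (\<lambda>n. ereal (real n / (2 * ln (ln (real n))) * (real (D n \<omega>) / real n - 1 / 2)\<^sup>2)) = ereal (1 / 12)"
    proof -
      have sq: "eventually (\<lambda>n. real n / (2 * ln (ln (real n))) * (real (D n \<omega>) / real n - 1 / 2)\<^sup>2 = (lil_ratio n \<omega>)\<^sup>2) sequentially"
      proof -
        have "eventually (\<lambda>n. 0 < ln (ln (real n))) sequentially"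
          using loglog_at_top by (simp add: filterlim_at_top_dense)
        then show ?thesis by eventually_elim (simp add: lil_ratio_def power_mult_distrib)
      qed
      have c2: "?c = sqrt (1 / 12)" by (simp add: real_sqrt_divide)
      have "limsup (\<lambda>n. ereal ((lil_ratio n \<omega>)\<^sup>2)) = ereal (1 / 12)"
      proof (rule limsup_ereal_eqI)
        fix r :: real assume r: "1 / 12 < r"
        then have "?c < sqrt r" unfolding c2 by (subst real_sqrt_less_iff)
        from up[OF this] show "eventually (\<lambda>n. (lil_ratio n \<omega>)\<^sup>2 \<le> r) sequentially"
        proof eventually_elim
          case (elim n)
          then have "\<bar>lil_ratio n \<omega>\<bar> \<le> sqrt r" by linarith
          then have "\<bar>lil_ratio n \<omega>\<bar>\<^sup>2 \<le> (sqrt r)\<^sup>2" by (rule power_mono) simp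
          then show ?case using r by simp
        qed
      next
        fix r :: real assume r: "r < 1 / 12"
        then have "sqrt (max r 0) < ?c" unfolding c2 by (subst real_sqrt_less_iff) simp
        from lo(1)[OF this] show "frequently (\<lambda>n. r \<le> (lil_ratio n \<omega>)\<^sup>2) sequentially"
        proof (rule frequently_elim1)
          fix n assume "sqrt (max r 0) \<le> lil_ratio n \<omega>"
          then have "(sqrt (max r 0))\<^sup>2 \<le> (lil_ratio n \<omega>)\<^sup>2" by (rule power_mono) simp
          then show "r \<le> (lil_ratio n \<omega>)\<^sup>2" by simp
        qed
      qed
      moreover have "limsup (\<lambda>n. ereal (real n / (2 * ln (ln (real n))) * (real (D n \<omega>) / real n - 1 / 2)\<^sup>2)) =
        limsup (\<lambda>n. ereal ((lil_ratio n \<omega>)\<^sup>2))"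
        by (rule Limsup_eq) (use sq in eventually_elim, simp only:)
      ultimately show ?thesis by simp
    qed
    ultimately show ?case by simp
  qed
qed

section \<open>The quadratic strong law\<close>

definition noise :: "nat \<Rightarrow> 'a \<Rightarrow> real" where
  "noise n \<omega> = (mart (Suc n) \<omega> - mart n \<omega>) / real (Suc n)"

lemma determined_noise: "k < n \<Longrightarrow> determined D n (noise k)"
  unfolding noise_def
  by (rule determined_comp2[OF determined_mart determined_mart, where f = "\<lambda>x y. (x - y) / real (Suc k)"]) auto

text \<open>
  Orthogonality of martingale increments, with \<open>p (1 - p)\<close> bounded by \<open>1\<close> because only the
  order of magnitude is needed.
\<close>

lemma second_moment_le:
  assumes det: "\<And>k. k \<ge> 1 \<Longrightarrow> determined D k (w k)"
  shows "expectation (\<lambda>\<omega>. (\<Sum>k\<in>{1..<n}. w k \<omega> * noise k \<omega>)\<^sup>2) \<le> (\<Sum>k\<in>{1..<n}. expectation (\<lambda>\<omega>. (w k \<omega>)\<^sup>2))"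
proof (induction n)
  case (Suc n)
  show ?case
  proof (cases "n \<ge> 1")
    case True
    let ?Y = "\<lambda>\<omega>. \<Sum>k\<in>{1..<n}. w k \<omega> * noise k \<omega>"
    have dY: "determined D n ?Y"
      by (intro determined_sum determined_comp2[OF determined_mono[OF det] determined_noise, where f = "(*)"]) auto
    have dw: "determined D n (w n)" using det True by blast
    have dn: "determined D (Suc n) (noise n)" by (rule determined_noise) simp
    have d1: "determined D n (\<lambda>\<omega>. 2 * ?Y \<omega> * w n \<omega>)"
      by (rule determined_comp2[OF dY dw, of "\<lambda>x y. 2 * x * y"])
    have d2: "determined D n (\<lambda>\<omega>. (w n \<omega>)\<^sup>2)" by (rule determined_comp[OF dw])
    have d3: "determined D n (\<lambda>\<omega>. (?Y \<omega>)\<^sup>2)" by (rule determined_comp[OF dY])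
    have i1: "integrable M (\<lambda>\<omega>. 2 * ?Y \<omega> * w n \<omega> * noise n \<omega>)"
      by (rule determined_integrable[OF determined_comp2[OF determined_mono[OF d1] dn, of "(*)"]]) simp
    have i2: "integrable M (\<lambda>\<omega>. (w n \<omega>)\<^sup>2 * (noise n \<omega>)\<^sup>2)"
      by (rule determined_integrable[OF determined_comp2[OF determined_mono[OF d2] dn, of "\<lambda>x y. x * y\<^sup>2"]]) simp
    have scale: "- real (Suc n) * p / real (Suc n) = - p" "real (Suc n) * (1 - p) / real (Suc n) = 1 - p" for p
      by (simp_all del: of_nat_Suc)
    have e1: "expectation (\<lambda>\<omega>. 2 * ?Y \<omega> * w n \<omega> * noise n \<omega>) = 0"
      unfolding noise_def[of n]
      by (subst expectation_mart_step[OF True d1, of "\<lambda>y. y / real (Suc n)"])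
         (unfold scale, simp add: algebra_simps)
    have "expectation (\<lambda>\<omega>. (w n \<omega>)\<^sup>2 * (noise n \<omega>)\<^sup>2) =
      expectation (\<lambda>\<omega>. (w n \<omega>)\<^sup>2 * (step_prob n \<omega> * (1 - step_prob n \<omega>)))"
      unfolding noise_def[of n]
      by (subst expectation_mart_step[OF True d2, of "\<lambda>y. (y / real (Suc n))\<^sup>2"])
         (unfold scale, simp add: power2_eq_square algebra_simps)
    also have "\<dots> \<le> expectation (\<lambda>\<omega>. (w n \<omega>)\<^sup>2)"
    proof (rule integral_mono)
      show "integrable M (\<lambda>\<omega>. (w n \<omega>)\<^sup>2 * (step_prob n \<omega> * (1 - step_prob n \<omega>)))"
        by (rule determined_integrable[OF determined_comp2[OF d2 determined_step_prob[OF order_refl],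
              of "\<lambda>x y. x * (y * (1 - y))"]])
      show "integrable M (\<lambda>\<omega>. (w n \<omega>)\<^sup>2)" by (rule determined_integrable[OF d2])
      fix \<omega>
      have "step_prob n \<omega> * (1 - step_prob n \<omega>) \<le> 1 * 1"
        using step_prob_bounds[of n \<omega>] by (intro mult_mono) auto
      then show "(w n \<omega>)\<^sup>2 * (step_prob n \<omega> * (1 - step_prob n \<omega>)) \<le> (w n \<omega>)\<^sup>2"
        by (intro mult_left_le) auto
    qed
    finally have e2: "expectation (\<lambda>\<omega>. (w n \<omega>)\<^sup>2 * (noise n \<omega>)\<^sup>2) \<le> expectation (\<lambda>\<omega>. (w n \<omega>)\<^sup>2)" .
    have "expectation (\<lambda>\<omega>. (\<Sum>k\<in>{1..<Suc n}. w k \<omega> * noise k \<omega>)\<^sup>2) =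
      expectation (\<lambda>\<omega>. (?Y \<omega>)\<^sup>2 + 2 * ?Y \<omega> * w n \<omega> * noise n \<omega> + (w n \<omega>)\<^sup>2 * (noise n \<omega>)\<^sup>2)"
      using True by (simp add: power2_sum power_mult_distrib algebra_simps)
    also have "\<dots> = expectation (\<lambda>\<omega>. (?Y \<omega>)\<^sup>2) + expectation (\<lambda>\<omega>. 2 * ?Y \<omega> * w n \<omega> * noise n \<omega>)
       + expectation (\<lambda>\<omega>. (w n \<omega>)\<^sup>2 * (noise n \<omega>)\<^sup>2)"
      using i1 i2 determined_integrable[OF d3]
      by (subst Bochner_Integration.integral_add, simp, simp, subst Bochner_Integration.integral_add, simp, simp) (rule refl)
    finally show ?thesis using e1 e2 Suc.IH True by simp
  qed simp
qed simp

definition dev :: "nat \<Rightarrow> 'a \<Rightarrow> real" where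
  "dev n \<omega> = real (D n \<omega>) - (real n - 1) / 2"

lemma mart_eq_dev: "mart n \<omega> = real n * dev n \<omega>"
  by (simp add: mart_def dev_def)

lemma step_prob_dev: "step_prob n \<omega> = 1 / 2 - dev n \<omega> / real (Suc n)"
  by (simp add: step_prob_def dev_def field_simps)

lemma determined_dev: "k \<le> n \<Longrightarrow> determined D n (dev k)"
  by (simp add: determined_def dev_def)

text \<open>
  The deviation moves by \<open>1 / 2\<close> up or down in each step, which produces the constant
  \<open>1 / 4\<close>; the conditional mean of the move is \<open>- dev n / (n + 1)\<close>.
\<close>

lemma dev_square_step:
  assumes "n \<ge> 1"
  shows "AE \<omega> in M. (dev (Suc n) \<omega>)\<^sup>2 =
    (dev n \<omega>)\<^sup>2 * (1 - 2 / real (Suc n)) + 2 * dev n \<omega> * noise n \<omega> + 1 / 4"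
  using D_step[OF assms]
proof eventually_elim
  case (elim \<omega>)
  have noise: "noise n \<omega> = real (D (Suc n) \<omega>) - real (D n \<omega>) - 1 / 2 + dev n \<omega> / real (Suc n)"
    unfolding noise_def mart_increment step_prob_dev by (simp del: of_nat_Suc)
  have next_dev: "dev (Suc n) \<omega> = dev n \<omega> + (real (D (Suc n) \<omega>) - real (D n \<omega>)) - 1 / 2"
    by (simp add: dev_def field_simps)
  from elim consider "D (Suc n) \<omega> = D n \<omega>" | "D (Suc n) \<omega> = Suc (D n \<omega>)" by blast
  then show ?case
    by cases (simp_all add: noise next_dev power2_eq_square algebra_simps)
qed

lemma mart_eq_noise_sum:
  assumes "n \<ge> 1"
  shows "mart n \<omega> = (\<Sum>k\<in>{1..<n}. real (Suc k) * noise k \<omega>)"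
  using assms
proof (induction n rule: dec_induct)
  case (step n)
  have "mart (Suc n) \<omega> = mart n \<omega> + real (Suc n) * noise n \<omega>"
    by (simp add: noise_def del: of_nat_Suc)
  then show ?case using step by simp
qed (simp add: mart_1)

lemma dev_second_moment_le:
  assumes "n \<ge> 1"
  shows "expectation (\<lambda>\<omega>. (dev n \<omega>)\<^sup>2) \<le> real n"
proof -
  have "expectation (\<lambda>\<omega>. (mart n \<omega>)\<^sup>2) \<le> (\<Sum>k\<in>{1..<n}. expectation (\<lambda>\<omega>. (real (Suc k))\<^sup>2))"
    unfolding mart_eq_noise_sum[OF assms] by (rule second_moment_le) (rule determined_const)
  also have "\<dots> \<le> (\<Sum>k\<in>{1..<n}. (real n)\<^sup>2)"
    by (intro sum_mono) (simp add: prob_space power_mono del: of_nat_Suc)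
  also have "\<dots> \<le> real n * (real n)\<^sup>2" using assms by (simp add: algebra_simps)
  finally have "(real n)\<^sup>2 * expectation (\<lambda>\<omega>. (dev n \<omega>)\<^sup>2) \<le> (real n)\<^sup>2 * real n"
    by (simp add: mart_eq_dev power_mult_distrib mult.commute)
  then show ?thesis using assms by (subst (asm) mult_le_cancel_left_pos) auto
qed

text \<open>
  The martingale part that remains when \<open>(dev n)\<^sup>2 / n\<close> is written as the sum of its
  increments.
\<close>

definition dev_mart :: "nat \<Rightarrow> 'a \<Rightarrow> real" where
  "dev_mart n \<omega> = (\<Sum>k\<in>{1..<n}. 2 * dev k \<omega> / real (Suc k) * noise k \<omega>)"

lemma dev_mart_second_moment_le: "expectation (\<lambda>\<omega>. (dev_mart n \<omega>)\<^sup>2) \<le> 4 * harm n"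
proof -
  have det: "determined D k (\<lambda>\<omega>. 2 * dev k \<omega> / real (Suc k))" for k
    by (rule determined_comp[OF determined_dev[OF order_refl], where f = "\<lambda>x. 2 * x / real (Suc k)"])
  have "expectation (\<lambda>\<omega>. (dev_mart n \<omega>)\<^sup>2) \<le> (\<Sum>k\<in>{1..<n}. expectation (\<lambda>\<omega>. (2 * dev k \<omega> / real (Suc k))\<^sup>2))"
    unfolding dev_mart_def by (rule second_moment_le) (rule det)
  also have "\<dots> \<le> (\<Sum>k\<in>{1..<n}. 4 * inverse (real k))"
  proof (rule sum_mono)
    fix k assume k: "k \<in> {1..<n}"
    have "expectation (\<lambda>\<omega>. (2 * dev k \<omega> / real (Suc k))\<^sup>2) = 4 / (real (Suc k))\<^sup>2 * expectation (\<lambda>\<omega>. (dev k \<omega>)\<^sup>2)"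
      by (simp add: power_mult_distrib power_divide del: of_nat_Suc)
    also have "\<dots> \<le> 4 / (real k)\<^sup>2 * real k"
      using k dev_second_moment_le[of k] by (intro mult_mono divide_left_mono power_mono) auto
    also have "\<dots> = 4 * inverse (real k)" using k by (simp add: power2_eq_square field_simps)
    finally show "expectation (\<lambda>\<omega>. (2 * dev k \<omega> / real (Suc k))\<^sup>2) \<le> 4 * inverse (real k)" .
  qed
  also have "\<dots> = 4 * (\<Sum>k\<in>{1..<n}. inverse (real k))" by (simp add: sum_distrib_left)
  also have "\<dots> \<le> 4 * harm n"
    unfolding harm_def by (intro mult_left_mono sum_mono2) auto
  finally show ?thesis .
qed

lemma determined_dev_mart: "determined D n (dev_mart n)"
  unfolding dev_mart_def
  by (intro determined_sum determined_comp2[OF determined_dev determined_noise, where f = "\<lambda>x y. 2 * x / real (Suc _) * y"]) auto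

text \<open>
  Along \<open>2 ^ m\<^sup>2\<close> the second moment is \<open>O (m\<^sup>2)\<close> and the normalisation \<open>ln n\<close> is of order
  \<open>m\<^sup>2\<close>, so Chebyshev's inequality gives probabilities of order \<open>1 / m\<^sup>2\<close>.
\<close>

lemma dev_mart_subsequence:
  "AE \<omega> in M. (\<lambda>m. dev_mart (2 ^ m\<^sup>2) \<omega> / ln (real (2 ^ m\<^sup>2))) \<longlonglongrightarrow> 0"
proof -
  have ln_eq: "ln (real (2 ^ m\<^sup>2)) = (real m)\<^sup>2 * ln 2" for m by (simp add: ln_realpow)
  have "AE \<omega> in M. eventually (\<lambda>m. \<bar>dev_mart (2 ^ m\<^sup>2) \<omega>\<bar> < (real m)\<^sup>2 / real (Suc j)) sequentially" for j
  proof -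
    define E where "E m = {\<omega> \<in> space M. (real m)\<^sup>2 / real (Suc j) \<le> \<bar>dev_mart (2 ^ m\<^sup>2) \<omega>\<bar>}" for m
    have sets: "E m \<in> events" for m
      unfolding E_def by (rule determined_sets[OF determined_comp[OF determined_dev_mart]])
    have "eventually (\<lambda>n. harm n / ln (real n) < 2) sequentially"
      by (rule order_tendstoD(2)[OF harm_over_ln]) simp
    then have "eventually (\<lambda>m. harm (2 ^ m\<^sup>2) / ln (real (2 ^ m\<^sup>2)) < 2) sequentially"
      by (rule eventually_compose_filterlim[OF _ pow2_square_at_top])
    then have "eventually (\<lambda>m. norm (prob (E m)) \<le> 8 * (real (Suc j))\<^sup>2 * ln 2 * inverse (real m ^ 2)) sequentially"
      using eventually_gt_at_top[of 0]
    proof eventually_elim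
      case (elim m)
      have m: "0 < (real m)\<^sup>2" "0 < (real m)\<^sup>2 * ln 2" using elim(2) by auto
      have det2: "determined D (2 ^ m\<^sup>2) (\<lambda>\<omega>. (dev_mart (2 ^ m\<^sup>2) \<omega>)\<^sup>2)"
        by (rule determined_comp[OF determined_dev_mart])
      have "harm (2 ^ m\<^sup>2) \<le> 2 * ((real m)\<^sup>2 * ln 2)"
        using elim(1) m unfolding ln_eq by (simp add: pos_divide_less_eq del: zero_less_mult_iff)
      then have moment: "expectation (\<lambda>\<omega>. (dev_mart (2 ^ m\<^sup>2) \<omega>)\<^sup>2) \<le> 8 * ((real m)\<^sup>2 * ln 2)"
        using dev_mart_second_moment_le[of "2 ^ m\<^sup>2"] by linarith
      have "prob (E m) \<le> expectation (\<lambda>\<omega>. (dev_mart (2 ^ m\<^sup>2) \<omega>)\<^sup>2) / ((real m)\<^sup>2 / real (Suc j))\<^sup>2"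
        unfolding E_def
        using determined_integrable[OF determined_dev_mart] determined_integrable[OF det2] m
        by (intro second_moment_method) auto
      also have "\<dots> \<le> 8 * ((real m)\<^sup>2 * ln 2) / ((real m)\<^sup>2 / real (Suc j))\<^sup>2"
        by (intro divide_right_mono moment) auto
      also have "\<dots> = 8 * (real (Suc j))\<^sup>2 * ln 2 * inverse (real m ^ 2)"
        using m by (simp add: field_simps power2_eq_square del: of_nat_Suc)
      finally show ?case by simp
    qed
    then have "summable (\<lambda>m. prob (E m))"
      by (rule summable_comparison_test_ev) (intro summable_mult inverse_power_summable; simp)
    then have "AE \<omega> in M. eventually (\<lambda>m. \<omega> \<in> space M - E m) sequentially"
      by (intro borel_cantelli_AE1 sets) (simp_all add: emeasure_eq_measure)
    then show ?thesis
    proof eventually_elim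
      case (elim \<omega>)
      then show ?case by eventually_elim (auto simp: E_def not_le)
    qed
  qed
  then have "AE \<omega> in M. \<forall>j. eventually (\<lambda>m. \<bar>dev_mart (2 ^ m\<^sup>2) \<omega>\<bar> < (real m)\<^sup>2 / real (Suc j)) sequentially"
    unfolding AE_all_countable by (rule allI)
  then show ?thesis
  proof eventually_elim
    case (elim \<omega>)
    show ?case
    proof (rule tendstoI)
      fix e :: real assume e: "0 < e"
      then obtain j where j: "inverse (real (Suc j)) < e * ln 2" using reals_Archimedean[of "e * ln 2"] by auto
      show "eventually (\<lambda>m. dist (dev_mart (2 ^ m\<^sup>2) \<omega> / ln (real (2 ^ m\<^sup>2))) 0 < e) sequentially"
        using elim[rule_format, of j] eventually_gt_at_top[of 0]
      proof eventually_elim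
        case (elim m)
        have m: "0 < (real m)\<^sup>2" "0 < (real m)\<^sup>2 * ln 2" using elim(2) by auto
        have "(real m)\<^sup>2 / real (Suc j) = (real m)\<^sup>2 * inverse (real (Suc j))" by (simp only: divide_inverse)
        also have "\<dots> < (real m)\<^sup>2 * (e * ln 2)" using j m(1) by (intro mult_strict_left_mono)
        finally have "\<bar>dev_mart (2 ^ m\<^sup>2) \<omega>\<bar> < e * ((real m)\<^sup>2 * ln 2)" using elim(1) by (simp only: mult_ac)
        then show ?case unfolding ln_eq dist_real_def using m(2) by (simp add: abs_divide pos_divide_less_eq abs_mult)
      qed
    qed
  qed
qed

definition sq_dev :: "nat \<Rightarrow> 'a \<Rightarrow> real" where
  "sq_dev k \<omega> = (real (D k \<omega>) / real k - 1 / 2)\<^sup>2"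

text \<open>
  The difference, multiplied by \<open>k\<close>, between \<open>3 sq_dev k\<close> and the multiple of \<open>(dev k)\<^sup>2\<close>
  that arises from telescoping \<open>(dev k)\<^sup>2 / k\<close>. It tends to \<open>0\<close> almost surely, and then
  contributes nothing to a logarithmic mean.
\<close>

definition sq_corr :: "nat \<Rightarrow> 'a \<Rightarrow> real" where
  "sq_corr k \<omega> = real k * (3 * sq_dev k \<omega> - (3 * real k + 1) / (real k * (real k + 1)\<^sup>2) * (dev k \<omega>)\<^sup>2)"

lemma sq_dev_sum_eq:
  "AE \<omega> in M. \<forall>n\<ge>1. 3 * (\<Sum>k\<in>{1..<n}. sq_dev k \<omega>) =
     (harm n - 1) / 4 + dev_mart n \<omega> - (dev n \<omega>)\<^sup>2 / real n + (\<Sum>k\<in>{1..<n}. sq_corr k \<omega> / real k)"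
proof -
  have "AE \<omega> in M. \<forall>n\<in>{1..}. (dev (Suc n) \<omega>)\<^sup>2 =
    (dev n \<omega>)\<^sup>2 * (1 - 2 / real (Suc n)) + 2 * dev n \<omega> * noise n \<omega> + 1 / 4"
    using dev_square_step by (subst AE_ball_countable) auto
  then show ?thesis
  proof eventually_elim
    case (elim \<omega>)
    show ?case
    proof (intro allI impI)
      fix n :: nat assume "1 \<le> n"
      then show "3 * (\<Sum>k\<in>{1..<n}. sq_dev k \<omega>) =
       (harm n - 1) / 4 + dev_mart n \<omega> - (dev n \<omega>)\<^sup>2 / real n + (\<Sum>k\<in>{1..<n}. sq_corr k \<omega> / real k)"
      proof (induction n rule: dec_induct)
        case base
        show ?case by (simp add: dev_mart_def dev_def D_1 harm_Suc harm_def)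
      next
        case (step n)
        define N where "N = real n"
        define e where "e = dev n \<omega>"
        define z where "z = noise n \<omega>"
        have N: "0 < N" using step(1) by (simp add: N_def)
        (* the drift of dev^2 / n over one step *)
        have alg: "e\<^sup>2 / N - (e\<^sup>2 * (1 - 2 / (N + 1)) + 2 * e * z + 1 / 4) / (N + 1) + 1 / (4 * (N + 1)) + 2 * e / (N + 1) * z
            = (3 * N + 1) / (N * (N + 1)\<^sup>2) * e\<^sup>2"
        proof -
          have "e\<^sup>2 / N - (e\<^sup>2 * (1 - 2 / (N + 1)) + 2 * e * z + 1 / 4) / (N + 1) + 1 / (4 * (N + 1)) + 2 * e / (N + 1) * z
            = e\<^sup>2 * (1 / N - (1 - 2 / (N + 1)) / (N + 1))"
            by (simp add: add_divide_distrib diff_divide_distrib algebra_simps)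
          also have "1 / N - (1 - 2 / (N + 1)) / (N + 1) = (3 * N + 1) / (N * (N + 1)\<^sup>2)"
            using N by (simp add: divide_simps power2_eq_square) (simp add: algebra_simps)
          finally show ?thesis by simp
        qed
        have sq: "3 * sq_dev n \<omega> = (3 * N + 1) / (N * (N + 1)\<^sup>2) * e\<^sup>2 + sq_corr n \<omega> / N"
          using N by (simp add: sq_corr_def N_def[symmetric] e_def[symmetric])
        have dev: "(dev (Suc n) \<omega>)\<^sup>2 / real (Suc n) = (e\<^sup>2 * (1 - 2 / (N + 1)) + 2 * e * z + 1 / 4) / (N + 1)"
          using elim step(1) by (simp add: N_def e_def z_def add.commute)
        have m: "dev_mart (Suc n) \<omega> = dev_mart n \<omega> + 2 * e / (N + 1) * z"
          using step(1) by (simp add: dev_mart_def N_def e_def z_def add.commute)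
        have h: "harm (Suc n) = harm n + 1 / (N + 1)" by (simp add: harm_Suc N_def inverse_eq_divide add.commute)
        have "3 * (\<Sum>k\<in>{1..<Suc n}. sq_dev k \<omega>) = 3 * (\<Sum>k\<in>{1..<n}. sq_dev k \<omega>) + 3 * sq_dev n \<omega>"
          using step(1) by simp
        moreover have "(\<Sum>k\<in>{1..<Suc n}. sq_corr k \<omega> / real k) = (\<Sum>k\<in>{1..<n}. sq_corr k \<omega> / real k) + sq_corr n \<omega> / N"
          using step(1) by (simp add: N_def)
        moreover have "(harm n + 1 / (N + 1) - 1) / 4 = (harm n - 1) / 4 + 1 / (4 * (N + 1))"
          by (simp add: add_divide_distrib diff_divide_distrib)
        ultimately show ?case
          using step.IH alg unfolding dev m h sq by (simp only: N_def[symmetric] e_def[symmetric])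
      qed
    qed
  qed
qed

lemma quadratic_strong_law:
  "AE \<omega> in M. (\<lambda>n. 1 / ln (real n) * (\<Sum>k=1..n. (real (D k \<omega>) / real k - 1 / 2)\<^sup>2)) \<longlonglongrightarrow> 1 / 12"
proof -
  have "1 / sqrt 12 < (1::real)" by simp
  from abs_mart_eventually_le[OF this] dev_mart_subsequence sq_dev_sum_eq
  show ?thesis
  proof eventually_elim
    case (elim \<omega>)
    define g where "g m = (2::nat) ^ m\<^sup>2" for m
    have g_top: "filterlim g at_top sequentially" unfolding g_def by (rule pow2_square_at_top)
    (* u is D k / k - 1/2 up to 1 / (2 k), and null by the law of the iterated logarithm *)
    define u where "u k = mart k \<omega> / (real k)\<^sup>2" for k
    have ln_top: "filterlim (\<lambda>n. ln (real n)) at_top sequentially" by real_asymp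
    have u0: "u \<longlonglongrightarrow> 0"
    proof (rule tendsto_rabs_zero_cancel, rule tendsto_sandwich[OF _ _ tendsto_const lil_scale_small])
      show "eventually (\<lambda>k. 0 \<le> \<bar>u k\<bar>) sequentially" by simp
      show "eventually (\<lambda>k. \<bar>u k\<bar> \<le> lil_scale k / (real k)\<^sup>2) sequentially"
        using elim(1) by eventually_elim (simp add: u_def abs_divide divide_right_mono)
    qed
    have sq_dev_u: "sq_dev k \<omega> = (u k - 1 / (2 * real k))\<^sup>2" if "1 \<le> k" for k
    proof -
      have "real (D k \<omega>) / real k - 1 / 2 = u k - 1 / (2 * real k)"
        using that by (simp add: u_def mart_def power2_eq_square field_simps)
      then show ?thesis by (simp add: sq_dev_def)
    qed
    have corr: "(\<lambda>k. sq_corr k \<omega>) \<longlonglongrightarrow> 0"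
    proof (rule Lim_transform_eventually)
      have "(\<lambda>k. (u k)\<^sup>2 * ((5 * (real k)\<^sup>2 + 3 * real k) / (real k + 1)\<^sup>2) - 3 * u k + 3 / (4 * real k)) \<longlonglongrightarrow> 0\<^sup>2 * 5 - 3 * 0 + 0"
        by (intro tendsto_add tendsto_diff tendsto_mult tendsto_power u0 tendsto_const) real_asymp+
      then show "(\<lambda>k. (u k)\<^sup>2 * ((5 * (real k)\<^sup>2 + 3 * real k) / (real k + 1)\<^sup>2) - 3 * u k + 3 / (4 * real k)) \<longlonglongrightarrow> 0"
        by simp
      show "eventually (\<lambda>k. (u k)\<^sup>2 * ((5 * (real k)\<^sup>2 + 3 * real k) / (real k + 1)\<^sup>2) - 3 * u k + 3 / (4 * real k) = sq_corr k \<omega>) sequentially"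
        using eventually_ge_at_top[of 1]
      proof eventually_elim
        case (elim k)
        define x where "x = real k"
        have x: "0 < x" using elim by (simp add: x_def)
        have dev: "dev k \<omega> = x * u k" using x by (simp add: u_def mart_eq_dev x_def power2_eq_square)
        have "sq_corr k \<omega> = x * (3 * (u k - 1 / (2 * x))\<^sup>2 - (3 * x + 1) / (x * (x + 1)\<^sup>2) * (x * u k)\<^sup>2)"
          unfolding sq_corr_def sq_dev_u[OF elim] dev x_def ..
        also have "\<dots> = 3 * x * (u k)\<^sup>2 - 3 * u k + 3 / (4 * x) - (3 * x + 1) * x\<^sup>2 / (x + 1)\<^sup>2 * (u k)\<^sup>2"
        proof -
          have "x * ((3 * x + 1) / (x * (x + 1)\<^sup>2) * (x * u k)\<^sup>2) = (3 * x + 1) * x\<^sup>2 / (x + 1)\<^sup>2 * (u k)\<^sup>2"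
            using x by (simp add: power_mult_distrib)
          moreover have "x * (3 * (u k - 1 / (2 * x))\<^sup>2) = 3 * x * (u k)\<^sup>2 - 3 * u k + 3 / (4 * x)"
            using x by (simp add: power2_eq_square field_simps)
          ultimately show ?thesis by (simp only: right_diff_distrib)
        qed
        also have "3 * x * (u k)\<^sup>2 - 3 * u k + 3 / (4 * x) - (3 * x + 1) * x\<^sup>2 / (x + 1)\<^sup>2 * (u k)\<^sup>2
          = (u k)\<^sup>2 * (3 * x - (3 * x + 1) * x\<^sup>2 / (x + 1)\<^sup>2) - 3 * u k + 3 / (4 * x)"
          by (simp add: algebra_simps)
        also have "3 * x - (3 * x + 1) * x\<^sup>2 / (x + 1)\<^sup>2 = (5 * x\<^sup>2 + 3 * x) / (x + 1)\<^sup>2"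
          using x by (simp add: divide_simps) (simp add: power2_eq_square algebra_simps)
        finally show ?case by (simp add: x_def)
      qed
    qed
    (* here the rate of the law of the iterated logarithm enters *)
    have dev0: "(\<lambda>n. (dev n \<omega>)\<^sup>2 / real n / ln (real n)) \<longlonglongrightarrow> 0"
    proof (rule tendsto_sandwich[OF _ _ tendsto_const])
      show "(\<lambda>n. 2 * ln (ln (real n)) / ln (real n)) \<longlonglongrightarrow> 0" by real_asymp
      show "eventually (\<lambda>n. 0 \<le> (dev n \<omega>)\<^sup>2 / real n / ln (real n)) sequentially"
        using eventually_ge_at_top[of 1] by eventually_elim simp
      have "eventually (\<lambda>n. 0 < ln (ln (real n))) sequentially"
        using loglog_at_top by (simp add: filterlim_at_top_dense)
      with elim(1) show "eventually (\<lambda>n. (dev n \<omega>)\<^sup>2 / real n / ln (real n) \<le> 2 * ln (ln (real n)) / ln (real n)) sequentially"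
        using eventually_ge_at_top[of 1]
      proof eventually_elim
        case (elim n)
        have n: "0 < real n" using elim(3) by simp
        have "(mart n \<omega>)\<^sup>2 \<le> (lil_scale n)\<^sup>2"
          using elim(1) by (simp add: abs_le_square_iff[symmetric])
        also have "(lil_scale n)\<^sup>2 = 2 * real n ^ 3 * ln (ln (real n))"
          using elim(2) by (simp add: lil_scale_def)
        finally have "(real n)\<^sup>2 * (dev n \<omega>)\<^sup>2 \<le> (real n)\<^sup>2 * (2 * real n * ln (ln (real n)))"
          by (simp add: mart_eq_dev power_mult_distrib power2_eq_square power3_eq_cube mult_ac)
        then have "(dev n \<omega>)\<^sup>2 \<le> 2 * real n * ln (ln (real n))" using n by simp
        then have "(dev n \<omega>)\<^sup>2 / real n \<le> 2 * ln (ln (real n))" using n by (simp add: field_simps)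
        then show ?case using elim(3) by (intro divide_right_mono) auto
      qed
    qed
    define T where "T n = (\<Sum>k\<in>{1..<n}. sq_dev k \<omega>)" for n
    have sq_nonneg: "0 \<le> sq_dev k \<omega>" for k by (simp add: sq_dev_def)
    have T_nonneg: "0 \<le> T n" for n unfolding T_def by (intro sum_nonneg sq_nonneg)
    have T_mono: "mono T" unfolding T_def by (intro monoI sum_mono2) (auto simp: sq_nonneg)
    have l1: "(\<lambda>m. harm (g m) / ln (real (g m))) \<longlonglongrightarrow> 1" by (rule filterlim_compose[OF harm_over_ln g_top])
    have l2: "(\<lambda>m. 1 / ln (real (g m))) \<longlonglongrightarrow> 0"
      by (rule filterlim_compose[OF _ g_top]) real_asymp
    have l3: "(\<lambda>m. dev_mart (g m) \<omega> / ln (real (g m))) \<longlonglongrightarrow> 0" using elim(2) by (simp add: g_def)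
    have l4: "(\<lambda>m. (dev (g m) \<omega>)\<^sup>2 / real (g m) / ln (real (g m))) \<longlonglongrightarrow> 0" by (rule filterlim_compose[OF dev0 g_top])
    have l5: "(\<lambda>m. (\<Sum>k\<in>{1..<g m}. sq_corr k \<omega> / real k) / ln (real (g m))) \<longlonglongrightarrow> 0"
      by (rule filterlim_compose[OF logarithmic_mean_null[OF corr] g_top])
    have "(\<lambda>m. 1 / 3 * ((harm (g m) / ln (real (g m)) - 1 / ln (real (g m))) / 4 + dev_mart (g m) \<omega> / ln (real (g m))
        - (dev (g m) \<omega>)\<^sup>2 / real (g m) / ln (real (g m)) + (\<Sum>k\<in>{1..<g m}. sq_corr k \<omega> / real k) / ln (real (g m))))
      \<longlonglongrightarrow> 1 / 3 * ((1 - 0) / 4 + 0 - 0 + 0)"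
      by (rule tendsto_mult[OF tendsto_const tendsto_add[OF tendsto_diff[OF tendsto_add[OF
            tendsto_divide[OF tendsto_diff[OF l1 l2] tendsto_const] l3] l4] l5]]) simp
    moreover have "1 / 3 * ((harm (g m) / ln (real (g m)) - 1 / ln (real (g m))) / 4 + dev_mart (g m) \<omega> / ln (real (g m))
        - (dev (g m) \<omega>)\<^sup>2 / real (g m) / ln (real (g m)) + (\<Sum>k\<in>{1..<g m}. sq_corr k \<omega> / real k) / ln (real (g m)))
      = T (g m) / ln (real (g m))" for m
    proof -
      have third: "t = 1 / 3 * R" if "3 * t = R" for t R :: real using that by simp
      have "1 \<le> g m" by (simp add: g_def)
      then have "3 * T (g m) = (harm (g m) - 1) / 4 + dev_mart (g m) \<omega> - (dev (g m) \<omega>)\<^sup>2 / real (g m) + (\<Sum>k\<in>{1..<g m}. sq_corr k \<omega> / real k)"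
        using elim(3) unfolding T_def by blast
      note third[OF this]
      then show ?thesis by (simp add: add_divide_distrib diff_divide_distrib)
    qed
    ultimately have "(\<lambda>m. T (g m) / ln (real (g m))) \<longlonglongrightarrow> 1 / 3 * ((1 - 0) / 4 + 0 - 0 + 0)"
      by (simp only:)
    then have "(\<lambda>m. T (g m) / ln (real (g m))) \<longlonglongrightarrow> 1 / 12" by simp
    then have T_lim: "(\<lambda>n. T n / ln (real n)) \<longlonglongrightarrow> 1 / 12"
      using logarithmic_mean_from_subsequence[OF T_mono T_nonneg, of "1 / 12"] unfolding g_def by simp
    have "(\<lambda>k. (u k - 1 / (2 * real k))\<^sup>2) \<longlonglongrightarrow> (0 - 0)\<^sup>2"
      by (intro tendsto_power tendsto_diff u0) real_asymp
    then have "(\<lambda>k. (u k - 1 / (2 * real k))\<^sup>2 / ln (real k)) \<longlonglongrightarrow> 0"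
      by (rule tendsto_divide_0) (rule filterlim_at_top_imp_at_infinity[OF ln_top])
    from tendsto_add[OF T_lim this]
    have lim: "(\<lambda>n. T n / ln (real n) + (u n - 1 / (2 * real n))\<^sup>2 / ln (real n)) \<longlonglongrightarrow> 1 / 12" by simp
    show ?case
    proof (rule Lim_transform_eventually[OF lim])
      show "eventually (\<lambda>n. T n / ln (real n) + (u n - 1 / (2 * real n))\<^sup>2 / ln (real n) =
        1 / ln (real n) * (\<Sum>k=1..n. (real (D k \<omega>) / real k - 1 / 2)\<^sup>2)) sequentially"
        using eventually_ge_at_top[of 1]
      proof eventually_elim
        case (elim n)
        have "{1..n} = insert n {1..<n}" using elim by auto
        then have "(\<Sum>k=1..n. sq_dev k \<omega>) = sq_dev n \<omega> + T n" by (simp add: T_def)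
        then show ?case unfolding sq_dev_u[OF elim, symmetric] unfolding sq_dev_def[symmetric]
          by (simp add: add_divide_distrib)
      qed
    qed
  qed
qed

end

section \<open>Descents under insertion of the maximum\<close>

lemma insertion_perm_Suc:
  assumes "1 \<le> n"
  shows "insertion_perm v (Suc n) =
    (\<lambda>k. if k \<notin> {1..Suc n} then k
         else if k < v (Suc n) then insertion_perm v n k
         else if k = v (Suc n) then Suc n
         else insertion_perm v n (k - 1))"
  using assms by (cases n) auto

lemma insertion_perm_outside: "k \<notin> {1..n} \<Longrightarrow> insertion_perm v n k = k"
  by (induction v n rule: insertion_perm.induct) auto

lemma insertion_perm_le: "k \<le> n \<Longrightarrow> insertion_perm v n k \<le> n"
proof (induction n arbitrary: k)
  case (Suc n)
  show ?case
  proof (cases "n = 0")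
    case False
    have *: "insertion_perm v n i \<le> Suc n" if "i \<le> Suc n" for i
      using that Suc.IH[of i] insertion_perm_outside[of i n v] by (cases "i \<le> n") auto
    show ?thesis
      using Suc.prems False *[of k] *[of "k - 1"] by (auto simp: insertion_perm_Suc)
  qed (use Suc.prems in auto)
qed simp

lemma insertion_perm_cong:
  "(\<And>m. m \<in> {1..n} \<Longrightarrow> v m = v' m) \<Longrightarrow> insertion_perm v n = insertion_perm v' n"
proof (induction n)
  case (Suc n)
  show ?case
  proof (cases "n = 0")
    case False
    then have "1 \<le> n" by simp
    moreover have "insertion_perm v n = insertion_perm v' n" using Suc.prems by (intro Suc.IH) auto
    moreover have "v (Suc n) = v' (Suc n)" using Suc.prems by simp
    ultimately show ?thesis by (simp only: insertion_perm_Suc)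
  qed simp
qed simp

definition descent_set :: "nat \<Rightarrow> (nat \<Rightarrow> nat) \<Rightarrow> nat set" where
  "descent_set n p = {k \<in> {1..<n}. p (k + 1) < p k}"

lemma num_descents_eq_card: "num_descents n p = card (descent_set n p)"
  by (simp add: num_descents_def descent_set_def)

lemma finite_descent_set [simp]: "finite (descent_set n p)"
  by (simp add: descent_set_def)

lemma num_descents_le: "num_descents n p \<le> n - 1"
proof -
  have "card (descent_set n p) \<le> card {1..<n}"
    by (intro card_mono) (auto simp: descent_set_def)
  then show ?thesis by (simp add: num_descents_eq_card)
qed

text \<open>
  A value inserted at position \<open>w\<close> separates the entries at \<open>w - 1\<close> and \<open>w\<close>. A new maximum
  there creates a descent at \<open>w\<close>, unless it is last, and destroys the descent at \<open>w - 1\<close> if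
  there was one.
\<close>

definition raising_positions :: "nat \<Rightarrow> (nat \<Rightarrow> nat) \<Rightarrow> nat set" where
  "raising_positions n p = {1..n} - Suc ` descent_set n p"

lemma card_raising_positions:
  assumes "1 \<le> n"
  shows "card (raising_positions n p) = n - num_descents n p"
proof -
  have "Suc ` descent_set n p \<subseteq> {1..n}" by (auto simp: descent_set_def)
  then show ?thesis
    unfolding raising_positions_def num_descents_eq_card
    by (simp add: card_Diff_subset card_image)
qed

lemma descent_set_insertion:
  assumes n: "1 \<le> n" and w: "v (Suc n) \<in> {1..Suc n}"
  shows "descent_set (Suc n) (insertion_perm v (Suc n)) =
    {k \<in> descent_set n (insertion_perm v n). Suc k < v (Suc n)} \<union>
    Suc ` {k \<in> descent_set n (insertion_perm v n). v (Suc n) \<le> k} \<union>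
    (if v (Suc n) \<le> n then {v (Suc n)} else {})"
    (is "?L = ?A \<union> ?B \<union> ?C")
proof -
  define p where "p = insertion_perm v n"
  define p' where "p' = insertion_perm v (Suc n)"
  define w where "w = v (Suc n)"
  have w1: "1 \<le> w" "w \<le> Suc n" using w by (auto simp: w_def)
  have p': "p' k = (if k < w then p k else if k = w then Suc n else p (k - 1))" if "k \<in> {1..Suc n}" for k
    using that n by (simp add: p'_def insertion_perm_Suc p_def w_def)
  have le: "p k \<le> n" if "k \<le> n" for k using insertion_perm_le[OF that] by (simp add: p_def)
  have "k \<in> descent_set (Suc n) p' \<longleftrightarrow>
    k \<in> {k \<in> descent_set n p. Suc k < w} \<union> Suc ` {k \<in> descent_set n p. w \<le> k} \<union> (if w \<le> n then {w} else {})" for k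
  proof (cases "k \<in> {1..<Suc n}")
    case True
    consider "Suc k < w" | "Suc k = w" | "k = w" | "w < k" by linarith
    then show ?thesis
    proof cases
      case 1
      then show ?thesis using True w1 p'[of k] p'[of "k + 1"] by (auto simp: descent_set_def)
    next
      case 2
      then show ?thesis using True w1 p'[of k] p'[of "k + 1"] le[of k] by (auto simp: descent_set_def)
    next
      case 3
      then show ?thesis using True w1 p'[of k] p'[of "k + 1"] le[of k] by (auto simp: descent_set_def less_Suc_eq_le)
    next
      case 4
      then obtain j where j: "k = Suc j" by (cases k) auto
      have "k \<in> descent_set (Suc n) p' \<longleftrightarrow> p k < p j"
        using True 4 p'[of k] p'[of "k + 1"] j by (auto simp: descent_set_def)
      also have "\<dots> \<longleftrightarrow> j \<in> descent_set n p" using True 4 j w1 by (auto simp: descent_set_def)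
      finally show ?thesis using 4 j by auto
    qed
  qed (use w1 in \<open>auto simp: descent_set_def split: if_splits\<close>)
  then show ?thesis by (auto simp: p_def p'_def w_def)
qed

lemma num_descents_insertion:
  assumes n: "1 \<le> n" and w: "v (Suc n) \<in> {1..Suc n}"
  shows "num_descents (Suc n) (insertion_perm v (Suc n)) =
    num_descents n (insertion_perm v n) +
    (if v (Suc n) \<in> raising_positions n (insertion_perm v n) then 1 else 0)"
proof -
  define S where "S = descent_set n (insertion_perm v n)"
  define w where "w = v (Suc n)"
  have fin: "finite S" by (simp add: S_def)
  have w1: "1 \<le> w" "w \<le> Suc n" using assms(2) by (auto simp: w_def)
  have "num_descents (Suc n) (insertion_perm v (Suc n)) =
    card ({k \<in> S. Suc k < w} \<union> Suc ` {k \<in> S. w \<le> k} \<union> (if w \<le> n then {w} else {}))"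
    unfolding num_descents_eq_card descent_set_insertion[where v = v, OF assms] by (simp only: S_def w_def)
  also have "\<dots> = card ({k \<in> S. Suc k < w} \<union> Suc ` {k \<in> S. w \<le> k}) + (if w \<le> n then 1 else 0)"
    using fin by (subst card_Un_disjoint) auto
  also have "card ({k \<in> S. Suc k < w} \<union> Suc ` {k \<in> S. w \<le> k}) = card {k \<in> S. Suc k < w} + card {k \<in> S. w \<le> k}"
    using fin by (subst card_Un_disjoint) (auto simp: card_image)
  finally have new: "num_descents (Suc n) (insertion_perm v (Suc n)) =
    card {k \<in> S. Suc k < w} + card {k \<in> S. w \<le> k} + (if w \<le> n then 1 else 0)" .
  have "S = {k \<in> S. Suc k < w} \<union> {k \<in> S. w \<le> k} \<union> (if w \<in> Suc ` S then {w - 1} else {})"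
  proof -
    have "Suc x < w" if "x \<in> S" "x < w" "w \<notin> Suc ` S" for x
      using that by (metis Suc_lessI imageI)
    then show ?thesis using w1 by (auto simp: not_le)
  qed
  then have "card S = card ({k \<in> S. Suc k < w} \<union> {k \<in> S. w \<le> k} \<union> (if w \<in> Suc ` S then {w - 1} else {}))"
    by (rule arg_cong)
  also have "\<dots> = card ({k \<in> S. Suc k < w} \<union> {k \<in> S. w \<le> k}) + (if w \<in> Suc ` S then 1 else 0)"
    using fin w1 by (subst card_Un_disjoint) auto
  also have "card ({k \<in> S. Suc k < w} \<union> {k \<in> S. w \<le> k}) = card {k \<in> S. Suc k < w} + card {k \<in> S. w \<le> k}"
    using fin by (subst card_Un_disjoint) auto
  finally have old: "card S = card {k \<in> S. Suc k < w} + card {k \<in> S. w \<le> k} + (if w \<in> Suc ` S then 1 else 0)" .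
  have "w \<in> Suc ` S \<Longrightarrow> w \<le> n" by (auto simp: S_def descent_set_def)
  then show ?thesis
    using new old w1 unfolding num_descents_eq_card raising_positions_def S_def[symmetric] w_def[symmetric]
    by auto
qed

section \<open>From insertion positions to the descent chain\<close>

lemma (in prob_space) expectation_indep_last:
  fixes F :: "nat list \<Rightarrow> real"
  assumes indep: "indep_vars (\<lambda>_. count_space UNIV) V {1..}"
    and int: "integrable M (\<lambda>\<omega>. F (map (\<lambda>k. V k \<omega>) [1..<Suc n]))"
  shows "expectation (\<lambda>\<omega>. F (map (\<lambda>k. V k \<omega>) [1..<Suc n]) * indicator {w} (V (Suc n) \<omega>)) =
    expectation (\<lambda>\<omega>. F (map (\<lambda>k. V k \<omega>) [1..<Suc n])) * prob {\<omega> \<in> space M. V (Suc n) \<omega> = (w::nat)}"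
proof -
  let ?P = "\<lambda>A. PiM A (\<lambda>_. count_space UNIV :: nat measure)"
  let ?Y1 = "\<lambda>f. F (map f [1..<Suc n])" and ?Y2 = "\<lambda>f. indicator {w} (f (Suc n)) :: real"
  have rv: "V (Suc n) \<in> measurable M (count_space UNIV)"
    using indep unfolding indep_vars_def by auto
  have "indep_var (?P {1..n}) (\<lambda>\<omega>. restrict (\<lambda>i. V i \<omega>) {1..n}) (?P {Suc n}) (\<lambda>\<omega>. restrict (\<lambda>i. V i \<omega>) {Suc n})"
    by (rule indep_var_restrict[OF indep]) auto
  moreover have "?Y1 \<in> borel_measurable (?P {1..n})"
    by (rule measurable_compose[OF measurable_map_count_space, where g = F])
       (auto intro!: measurable_component_singleton)
  moreover have "?Y2 \<in> borel_measurable (?P {Suc n})"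
    by (rule measurable_compose[OF measurable_component_singleton]) auto
  ultimately have iv: "indep_var borel (?Y1 \<circ> (\<lambda>\<omega>. restrict (\<lambda>i. V i \<omega>) {1..n})) borel (?Y2 \<circ> (\<lambda>\<omega>. restrict (\<lambda>i. V i \<omega>) {Suc n}))"
    by (rule indep_var_compose)
  have e1: "?Y1 \<circ> (\<lambda>\<omega>. restrict (\<lambda>i. V i \<omega>) {1..n}) = (\<lambda>\<omega>. F (map (\<lambda>k. V k \<omega>) [1..<Suc n]))"
    by (rule ext) (auto intro!: arg_cong[of _ _ F])
  have e2: "?Y2 \<circ> (\<lambda>\<omega>. restrict (\<lambda>i. V i \<omega>) {Suc n}) = (\<lambda>\<omega>. indicator {w} (V (Suc n) \<omega>))"
    by (rule ext) simp
  have m2: "(\<lambda>\<omega>. indicator {w} (V (Suc n) \<omega>) :: real) \<in> borel_measurable M"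
    by (rule measurable_compose[OF rv]) simp
  have int2: "integrable M (\<lambda>\<omega>. indicator {w} (V (Suc n) \<omega>) :: real)"
    by (rule integrable_const_bound[OF _ m2, of 1]) (simp add: indicator_def)
  have "expectation (\<lambda>\<omega>. F (map (\<lambda>k. V k \<omega>) [1..<Suc n]) * indicator {w} (V (Suc n) \<omega>)) =
    expectation (\<lambda>\<omega>. F (map (\<lambda>k. V k \<omega>) [1..<Suc n])) * expectation (\<lambda>\<omega>. indicator {w} (V (Suc n) \<omega>))"
    by (rule indep_var_lebesgue_integral[OF iv[unfolded e1 e2] int int2])
  also have "expectation (\<lambda>\<omega>. indicator {w} (V (Suc n) \<omega>) :: real) = expectation (indicator {\<omega> \<in> space M. V (Suc n) \<omega> = w})"
    by (intro Bochner_Integration.integral_cong) (auto simp: indicator_def)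
  also have "\<dots> = prob {\<omega> \<in> space M. V (Suc n) \<omega> = w}"
  proof -
    have "{\<omega> \<in> space M. V (Suc n) \<omega> = w} \<in> events" using rv by measurable
    then show ?thesis by simp
  qed
  finally show ?thesis .
qed

text \<open>
  The increment of the descent number is the sum over all positions \<open>w\<close> of the indicators
  that \<open>w\<close> is a raising position and that \<open>w\<close> is chosen. The first is a function of the
  earlier positions and the second is independent of them with mean \<open>1 / (n + 1)\<close>, so the
  drift is the number of raising positions divided by \<open>n + 1\<close>.
\<close>

lemma descent_chain_descents:
  fixes M :: "'a measure" and V :: "nat \<Rightarrow> 'a \<Rightarrow> nat"
  assumes "prob_space M"
    and indep: "prob_space.indep_vars M (\<lambda>_. count_space UNIV) V {1..}"
    and unif: "\<And>n. n \<ge> 1 \<Longrightarrow> distr M (count_space UNIV) (V n) = measure_pmf (pmf_of_set {1..n})"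
  shows "descent_chain M (descents V)"
proof -
  interpret prob_space M by fact
  (* V 0 is left out of the history: nothing is assumed about it, and no descent number depends on it *)
  define H where "H n \<omega> = map (\<lambda>k. V k \<omega>) [1..<Suc n]" for n \<omega>
  define p where "p n \<omega> = insertion_perm (\<lambda>m. V m \<omega>) n" for n \<omega>
  have rv: "V k \<in> measurable M (count_space UNIV)" if "1 \<le> k" for k
    using indep that unfolding indep_vars_def by auto
  have H_rv: "H n \<in> measurable M (count_space UNIV)" for n
    unfolding H_def by (rule measurable_map_count_space) (auto intro: rv)
  have H_eq: "V k \<omega> = V k \<omega>'" if "H n \<omega> = H n \<omega>'" "k \<in> {1..n}" for n k \<omega> \<omega>'
    using that unfolding H_def map_eq_conv by (auto simp del: upt_Suc)
  have factor: "\<exists>F. \<forall>\<omega>. X \<omega> = F (H n \<omega>)" if "\<And>\<omega> \<omega>'. H n \<omega> = H n \<omega>' \<Longrightarrow> X \<omega> = X \<omega>'" for X :: "'a \<Rightarrow> 'b" and n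
  proof (intro exI allI)
    fix \<omega>
    have "H n (SOME \<omega>'. H n \<omega>' = H n \<omega>) = H n \<omega>" by (rule someI) (rule refl)
    from that[OF this] show "X \<omega> = (\<lambda>l. X (SOME \<omega>'. H n \<omega>' = l)) (H n \<omega>)" by simp
  qed
  have p_cong: "p k \<omega> = p k \<omega>'" if "H n \<omega> = H n \<omega>'" "k \<le> n" for n k \<omega> \<omega>'
    unfolding p_def by (rule insertion_perm_cong) (use H_eq[OF that(1)] that(2) in auto)
  have descents_p: "descents V n \<omega> = num_descents n (p n \<omega>)" for n \<omega> by (simp add: descents_def p_def)
  have descents_le: "descents V n \<omega> \<le> n" for n \<omega>
    unfolding descents_p using num_descents_le[of n "p n \<omega>"] by linarith
  have descents_rv: "descents V n \<in> measurable M (count_space UNIV)" for n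
  proof -
    have "\<exists>F. \<forall>\<omega>. descents V n \<omega> = F (H n \<omega>)"
    proof (rule factor)
      fix \<omega> \<omega>' assume "H n \<omega> = H n \<omega>'"
      from p_cong[OF this order_refl] show "descents V n \<omega> = descents V n \<omega>'" by (simp only: descents_p)
    qed
    then obtain F where "\<And>\<omega>. descents V n \<omega> = F (H n \<omega>)" by blast
    then have "descents V n = (\<lambda>\<omega>. F (H n \<omega>))" by blast
    then show ?thesis using measurable_compose[OF H_rv, of F "count_space UNIV"] by simp
  qed
  have prob_V: "prob {\<omega> \<in> space M. V n \<omega> = w} = 1 / real n" if "1 \<le> n" "w \<in> {1..n}" for n w
  proof -
    have "prob {\<omega> \<in> space M. V n \<omega> = w} = measure (distr M (count_space UNIV) (V n)) {w}"
      by (subst measure_distr[OF rv[OF that(1)]]) (auto intro!: arg_cong[of _ _ prob])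
    also have "\<dots> = pmf (pmf_of_set {1..n}) w" unfolding unif[OF that(1)] by (simp add: pmf.rep_eq)
    also have "\<dots> = 1 / real n" using that by (subst pmf_of_set) auto
    finally show ?thesis .
  qed
  have V_range: "AE \<omega> in M. V n \<omega> \<in> {1..n}" if "1 \<le> n" for n
  proof -
    have "AE x in distr M (count_space UNIV) (V n). x \<in> {1..n}"
      unfolding unif[OF that] using that by (subst AE_measure_pmf_iff) (auto simp: set_pmf_of_set)
    then show ?thesis by (subst (asm) AE_distr_iff[OF rv[OF that]]) auto
  qed
  have step: "AE \<omega> in M. V (Suc n) \<omega> \<in> {1..Suc n} \<and> descents V (Suc n) \<omega> =
      descents V n \<omega> + (if V (Suc n) \<omega> \<in> raising_positions n (p n \<omega>) then 1 else 0)" if "1 \<le> n" for n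
    using V_range[of "Suc n", OF le_SucI[OF that]]
  proof eventually_elim
    case (elim \<omega>)
    then show ?case using num_descents_insertion[where v = "\<lambda>m. V m \<omega>", OF that] unfolding descents_p p_def by simp
  qed
  interpret bounded_process M "descents V"
    by unfold_locales (rule descents_rv, rule descents_le)
  show ?thesis
  proof unfold_locales
    show "descents V (Suc 0) \<omega> = 0" for \<omega> by (simp add: descents_def num_descents_def)
    show "AE \<omega> in M. descents V (Suc n) \<omega> = descents V n \<omega> \<or> descents V (Suc n) \<omega> = Suc (descents V n \<omega>)"
      if "1 \<le> n" for n
      using step[OF that] by eventually_elim auto
    fix n :: nat and X :: "'a \<Rightarrow> real"
    assume n: "1 \<le> n" and X: "determined (descents V) n X"
    have X_H: "X \<omega> = X \<omega>'" if "H n \<omega> = H n \<omega>'" for \<omega> \<omega>'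
    proof -
      have "\<forall>k\<le>n. descents V k \<omega> = descents V k \<omega>'" unfolding descents_p using p_cong[OF that] by simp
      then show ?thesis using X unfolding determined_def by blast
    qed
    define R where "R w \<omega> = X \<omega> * indicator (raising_positions n (p n \<omega>)) w" for w \<omega>
    have R_int: "integrable M (R w)" and R_factor: "\<exists>F. \<forall>\<omega>. R w \<omega> = F (H n \<omega>)" for w
    proof -
      show "\<exists>F. \<forall>\<omega>. R w \<omega> = F (H n \<omega>)"
      proof (rule factor)
        fix \<omega> \<omega>' assume "H n \<omega> = H n \<omega>'"
        from p_cong[OF this order_refl] X_H[OF this] show "R w \<omega> = R w \<omega>'" by (simp only: R_def)
      qed
      then obtain F where "\<And>\<omega>. R w \<omega> = F (H n \<omega>)" by blast
      then have "R w = (\<lambda>\<omega>. F (H n \<omega>))" by blast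
      then have "R w \<in> borel_measurable M" using measurable_compose[OF H_rv, of F borel] by simp
      then show "integrable M (R w)"
        by (rule Bochner_Integration.integrable_bound[OF determined_integrable[OF X]]) (auto simp: R_def indicator_def)
    qed
    have mean: "expectation (\<lambda>\<omega>. R w \<omega> * indicator {w} (V (Suc n) \<omega>)) = expectation (R w) / real (Suc n)"
      if "w \<in> {1..Suc n}" for w
    proof -
      obtain F where F: "\<And>\<omega>. R w \<omega> = F (H n \<omega>)" using R_factor by blast
      have "integrable M (\<lambda>\<omega>. F (map (\<lambda>k. V k \<omega>) [1..<Suc n]))" using R_int[of w] unfolding F H_def .
      from expectation_indep_last[OF indep this, of w] that
      show ?thesis unfolding F H_def by (subst (asm) prob_V) auto
    qed
    have R_prod_int: "integrable M (\<lambda>\<omega>. R w \<omega> * indicator {w} (V (Suc n) \<omega>))" for w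
    proof (rule Bochner_Integration.integrable_bound[OF R_int[of w]])
      have "(\<lambda>\<omega>. indicator {w} (V (Suc n) \<omega>) :: real) \<in> borel_measurable M"
        by (rule measurable_compose[OF rv]) auto
      then show "(\<lambda>\<omega>. R w \<omega> * indicator {w} (V (Suc n) \<omega>)) \<in> borel_measurable M"
        using R_int[of w] by (intro borel_measurable_times) auto
    qed (auto simp: indicator_def)
    have sub: "raising_positions n (p n \<omega>) \<subseteq> {1..Suc n}" for \<omega> by (auto simp: raising_positions_def)
    have "expectation (\<lambda>\<omega>. X \<omega> * (real (descents V (Suc n) \<omega>) - real (descents V n \<omega>))) =
      expectation (\<lambda>\<omega>. \<Sum>w\<in>{1..Suc n}. R w \<omega> * indicator {w} (V (Suc n) \<omega>))"
    proof (rule integral_cong_AE)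
      show "AE \<omega> in M. X \<omega> * (real (descents V (Suc n) \<omega>) - real (descents V n \<omega>)) =
        (\<Sum>w\<in>{1..Suc n}. R w \<omega> * indicator {w} (V (Suc n) \<omega>))"
        using step[OF n]
      proof eventually_elim
        case (elim \<omega>)
        have "(\<Sum>w\<in>{1..Suc n}. R w \<omega> * indicator {w} (V (Suc n) \<omega>)) =
          (\<Sum>w\<in>{1..Suc n}. if w = V (Suc n) \<omega> then R w \<omega> else 0)"
          by (intro sum.cong) (auto simp: indicator_def)
        also have "\<dots> = R (V (Suc n) \<omega>) \<omega>" using elim by (subst sum.delta) auto
        also have "\<dots> = X \<omega> * (real (descents V (Suc n) \<omega>) - real (descents V n \<omega>))"
          using elim by (simp add: R_def indicator_def)
        finally show ?case by simp
      qed
      show "(\<lambda>\<omega>. X \<omega> * (real (descents V (Suc n) \<omega>) - real (descents V n \<omega>))) \<in> borel_measurable M"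
      proof -
        have "determined (descents V) (Suc n) (\<lambda>\<omega>. X \<omega> * (real (descents V (Suc n) \<omega>) - real (descents V n \<omega>)))"
          by (intro determined_comp2[OF determined_mono[OF X] determined_comp2[OF determined_D determined_D,
                where f = "\<lambda>x y. real x - real y"], where f = "(*)"]) auto
        from determined_integrable[OF this] show ?thesis by auto
      qed
      show "(\<lambda>\<omega>. \<Sum>w\<in>{1..Suc n}. R w \<omega> * indicator {w} (V (Suc n) \<omega>)) \<in> borel_measurable M"
        using R_prod_int by (intro borel_measurable_sum) auto
    qed
    also have "\<dots> = (\<Sum>w\<in>{1..Suc n}. expectation (\<lambda>\<omega>. R w \<omega> * indicator {w} (V (Suc n) \<omega>)))"
      by (rule Bochner_Integration.integral_sum) (rule R_prod_int)
    also have "\<dots> = (\<Sum>w\<in>{1..Suc n}. expectation (R w) / real (Suc n))" by (rule sum.cong[OF refl mean])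
    also have "\<dots> = expectation (\<lambda>\<omega>. (\<Sum>w\<in>{1..Suc n}. R w \<omega>) / real (Suc n))"
      using R_int by (simp add: sum_divide_distrib[symmetric] Bochner_Integration.integral_sum)
    also have "(\<lambda>\<omega>. (\<Sum>w\<in>{1..Suc n}. R w \<omega>) / real (Suc n)) =
      (\<lambda>\<omega>. X \<omega> * ((real n - real (descents V n \<omega>)) / real (Suc n)))"
    proof
      fix \<omega>
      have "(\<Sum>w\<in>{1..Suc n}. R w \<omega>) = X \<omega> * (\<Sum>w\<in>{1..Suc n}. indicator (raising_positions n (p n \<omega>)) w)"
        by (simp only: R_def sum_distrib_left)
      also have "(\<Sum>w\<in>{1..Suc n}. indicator (raising_positions n (p n \<omega>)) w :: real) =
        real (card ({1..Suc n} \<inter> raising_positions n (p n \<omega>)))"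
      proof -
        have "(\<Sum>w\<in>{1..Suc n}. indicator (raising_positions n (p n \<omega>)) w :: real) =
          (\<Sum>w\<in>{1..Suc n}. if w \<in> raising_positions n (p n \<omega>) then 1 else 0)"
          by (rule sum.cong) (auto simp: indicator_def)
        also have "\<dots> = (\<Sum>w\<in>{1..Suc n} \<inter> raising_positions n (p n \<omega>). 1)"
          by (rule sum.inter_restrict[symmetric]) simp
        finally show ?thesis by simp
      qed
      also have "{1..Suc n} \<inter> raising_positions n (p n \<omega>) = raising_positions n (p n \<omega>)" using sub by blast
      also have "real (card (raising_positions n (p n \<omega>))) = real n - real (descents V n \<omega>)"
        using descents_le[of n \<omega>] by (simp add: card_raising_positions[OF n] descents_p of_nat_diff)
      finally show "(\<Sum>w\<in>{1..Suc n}. R w \<omega>) / real (Suc n) = X \<omega> * ((real n - real (descents V n \<omega>)) / real (Suc n))"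
        by simp
    qed
    finally show "expectation (\<lambda>\<omega>. X \<omega> * (real (descents V (Suc n) \<omega>) - real (descents V n \<omega>))) =
      expectation (\<lambda>\<omega>. X \<omega> * ((real n - real (descents V n \<omega>)) / real (Suc n)))" .
  qed
qed

theorem proposition2p1:
  fixes M :: "'a measure" and V :: "nat \<Rightarrow> 'a \<Rightarrow> nat" and D :: "nat \<Rightarrow> 'a \<Rightarrow> nat"
  assumes "prob_space M"
    and "prob_space.indep_vars M (\<lambda>_. count_space UNIV) V {1..}"
    and "\<And>n. n \<ge> 1 \<Longrightarrow> distr M (count_space UNIV) (V n) = measure_pmf (pmf_of_set {1..n})"
    and "\<And>n \<omega>. D n \<omega> = descents V n \<omega>"
  shows "(AE \<omega> in M.
            (\<lambda>n. 1 / ln (real n) * (\<Sum>k=1..n. (real (D k \<omega>) / real k - 1 / 2)\<^sup>2)) \<longlonglongrightarrow> 1 / 12) \<and>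
         (AE \<omega> in M.
            limsup (\<lambda>n. ereal (sqrt (real n / (2 * ln (ln (real n)))) * (real (D n \<omega>) / real n - 1 / 2)))
              = ereal (1 / sqrt 12) \<and>
            - liminf (\<lambda>n. ereal (sqrt (real n / (2 * ln (ln (real n)))) * (real (D n \<omega>) / real n - 1 / 2)))
              = ereal (1 / sqrt 12)) \<and>
         (AE \<omega> in M.
            limsup (\<lambda>n. ereal (real n / (2 * ln (ln (real n))) * (real (D n \<omega>) / real n - 1 / 2)\<^sup>2))
              = ereal (1 / 12))"
proof -
  have "D = descents V" by (intro ext assms(4))
  then interpret descent_chain M D using descent_chain_descents[OF assms(1-3)] by simp
  have lil: "AE \<omega> in M. limsup (\<lambda>n. ereal (lil_ratio n \<omega>)) = ereal (1 / sqrt 12) \<and>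
      - liminf (\<lambda>n. ereal (lil_ratio n \<omega>)) = ereal (1 / sqrt 12)"
    using iterated_logarithm by eventually_elim blast
  have lil_square: "AE \<omega> in M. limsup (\<lambda>n. ereal (real n / (2 * ln (ln (real n))) * (real (D n \<omega>) / real n - 1 / 2)\<^sup>2))
      = ereal (1 / 12)"
    using iterated_logarithm by eventually_elim blast
  show ?thesis
    by (intro conjI quadratic_strong_law lil[unfolded lil_ratio_def] lil_square)
qed

end
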